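(* Let $\xi$ be a subordinator with Laplace exponent $\phi$, killing rate $\kappa$, drift $c$ and Lévy measure $\pi$. Let $\Phi(q)=\int_0^q\phi(s)\,\mathrm ds$ for $q\ge 0$, let $\Phi^{-1}:[0,\infty)\to[0,\infty)$ be the inverse function of $\Phi$, and let $\rho(t)=\inf\{r\ge 0:\int_0^r\xi_u\,\mathrm du>t\}$ for $t\ge 0$. Then the function $\Phi^{-1}$ is the Laplace exponent of a subordinator. Denoting by $L$ the Lévy measure of that subordinator, for all $q>0$ and $t\ge 0$, $$\mathbb E\left[e^{-q\xi_{\rho(t)}}\right]=\phi(q)\int_0^\infty e^{-\Phi(q)x-\frac{t}{x}}\,x\,L(\mathrm dx).$$
   Context: A subordinator here is a càdlàg non-decreasing $[0,\infty]$-valued process with stationary independent increments, possibly killed (sent to the absorbing state $\infty$) at an independent exponential time of rate $\kappa$. The subordinator $\xi$ starts from $\xi_0=0$ and has Laplace exponent $\phi(q)=-\log\mathbb E[e^{-q\xi_1}]=\kappa+cq+\int_0^\infty(1-e^{-qx})\,\pi(\mathrm dx)$, where $\kappa\ge 0$, $c\ge 0$ and $\pi$ is a measure on $(0,\infty)$ with $\int_0^\infty(1\wedge x)\,\pi(\mathrm dx)<\infty$. Standing assumption: $\pi(0,\infty)>0$. Conventions: $\inf\emptyset=\infty$, $e^{-\infty}=0$. In general, the Lévy measure of a subordinator with Laplace exponent $\psi$ is the measure $\mu$ on $(0,\infty)$ with $\psi(q)=k+dq+\int_0^\infty(1-e^{-qx})\mu(\mathrm dx)$, $k,d\ge0$.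 *)

theory Defs
  imports "HOL-Probability.Probability"
begin

definition cadlag :: "(real \<Rightarrow> real) \<Rightarrow> bool" where
  "cadlag f \<longleftrightarrow> (\<forall>t\<ge>0. continuous (at_right t) f) \<and> (\<forall>t>0. \<exists>l. (f \<longlongrightarrow> l) (at_left t))"

text \<open>Processes are indexed by \<open>real\<close>; only the times \<open>t \<ge> 0\<close> are meaningful.\<close>

definition unkilled_subordinator :: "'a measure \<Rightarrow> (real \<Rightarrow> 'a \<Rightarrow> real) \<Rightarrow> bool" where
  "unkilled_subordinator M \<eta> \<longleftrightarrow>
     prob_space M \<and>
     (\<forall>t\<ge>0. \<eta> t \<in> borel_measurable M) \<and>
     (\<forall>\<omega>\<in>space M. \<eta> 0 \<omega> = 0 \<and> mono_on {0..} (\<lambda>t. \<eta> t \<omega>) \<and> cadlag (\<lambda>t. \<eta> t \<omega>)) \<and>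
     (\<forall>s\<ge>0. \<forall>t\<ge>0. distr M borel (\<lambda>\<omega>. \<eta> (s + t) \<omega> - \<eta> s \<omega>) = distr M borel (\<eta> t)) \<and>
     (\<forall>(n::nat) (\<tau>::nat \<Rightarrow> real). 0 \<le> \<tau> 0 \<and> mono \<tau> \<longrightarrow>
        prob_space.indep_vars M (\<lambda>_. borel) (\<lambda>i \<omega>. \<eta> (\<tau> (Suc i)) \<omega> - \<eta> (\<tau> i) \<omega>) {..<n})"

definition kill_at :: "('a \<Rightarrow> ennreal) \<Rightarrow> (real \<Rightarrow> 'a \<Rightarrow> real) \<Rightarrow> real \<Rightarrow> 'a \<Rightarrow> ennreal" where
  "kill_at \<zeta> \<eta> t \<omega> = (if ennreal t < \<zeta> \<omega> then ennreal (\<eta> t \<omega>) else \<infinity>)"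

text \<open>
  The killing time \<open>\<zeta>\<close> is exponential of rate \<open>\<kappa>\<close>, expressed through its survival function so
  that the rate \<open>\<kappa> = 0\<close> is covered as well, meaning \<open>\<zeta> = \<infinity>\<close> almost surely (no killing).
  It is independent of the whole path of \<open>\<eta>\<close>.
\<close>

definition subordinator :: "'a measure \<Rightarrow> real \<Rightarrow> (real \<Rightarrow> 'a \<Rightarrow> ennreal) \<Rightarrow> bool" where
  "subordinator M \<kappa> \<xi> \<longleftrightarrow> 0 \<le> \<kappa> \<and>
     (\<exists>\<eta> \<zeta>.
        unkilled_subordinator M \<eta> \<and>
        \<zeta> \<in> borel_measurable M \<and>
        (\<forall>\<omega>\<in>space M. 0 < \<zeta> \<omega>) \<and>
        (\<forall>t\<ge>0. measure M {\<omega> \<in> space M. ennreal t < \<zeta> \<omega>} = exp (- \<kappa> * t)) \<and>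
        prob_space.indep_set M
          (sets (vimage_algebra (space M) (\<lambda>\<omega>. \<lambda>t\<in>{0..}. \<eta> t \<omega>) (PiM {0..} (\<lambda>_. borel))))
          (sets (vimage_algebra (space M) \<zeta> borel)) \<and>
        (\<forall>t\<ge>0. \<forall>\<omega>\<in>space M. \<xi> t \<omega> = kill_at \<zeta> \<eta> t \<omega>))"

text \<open>
  \<open>e\<^sup>-\<^sup>q\<^sup>x\<close> for \<open>x \<in> [0,\<infinity>]\<close>. It vanishes at \<open>x = \<infinity>\<close> for \<^emph>\<open>every\<close> \<open>q \<ge> 0\<close>, including \<open>q = 0\<close>,
  so that a Laplace exponent takes the value \<open>\<kappa>\<close> at \<open>0\<close>.
\<close>

definition exp_neg :: "real \<Rightarrow> ennreal \<Rightarrow> real" where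
  "exp_neg q x = (if x = \<infinity> then 0 else exp (- q * enn2real x))"

definition has_laplace_exponent ::
    "'a measure \<Rightarrow> (real \<Rightarrow> 'a \<Rightarrow> ennreal) \<Rightarrow> (real \<Rightarrow> real) \<Rightarrow> bool" where
  "has_laplace_exponent M \<xi> \<psi> \<longleftrightarrow> (\<forall>q\<ge>0. \<psi> q = - ln (\<integral>\<omega>. exp_neg q (\<xi> 1 \<omega>) \<partial>M))"

text \<open>A measure on \<open>(0,\<infinity>)\<close> is a Borel measure on the line that does not charge \<open>(-\<infinity>,0]\<close>.\<close>

definition levy_measure :: "real measure \<Rightarrow> bool" where
  "levy_measure \<mu> \<longleftrightarrow>
     sets \<mu> = sets borel \<and> emeasure \<mu> {..0} = 0 \<and>
     (\<integral>\<^sup>+x\<in>{0<..}. ennreal (min 1 x) \<partial>\<mu>) < \<infinity>"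

definition levy_khintchine :: "(real \<Rightarrow> real) \<Rightarrow> real \<Rightarrow> real \<Rightarrow> real measure \<Rightarrow> bool" where
  "levy_khintchine \<psi> k d \<mu> \<longleftrightarrow>
     0 \<le> k \<and> 0 \<le> d \<and> levy_measure \<mu> \<and>
     (\<forall>q\<ge>0. \<psi> q = k + d * q + (LINT x:{0<..}|\<mu>. 1 - exp (- q * x)))"

text \<open>
  \<open>\<xi>\<close> is a subordinator on \<open>M\<close> with Laplace exponent \<open>\<psi>\<close>, killing rate \<open>k\<close>, drift \<open>d\<close> and
  Levy measure \<open>\<mu>\<close>.
\<close>

definition subordinator_with :: "'a measure \<Rightarrow> (real \<Rightarrow> 'a \<Rightarrow> ennreal) \<Rightarrow>
    (real \<Rightarrow> real) \<Rightarrow> real \<Rightarrow> real \<Rightarrow> real measure \<Rightarrow> bool" where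
  "subordinator_with M \<xi> \<psi> k d \<mu> \<longleftrightarrow>
     subordinator M k \<xi> \<and> has_laplace_exponent M \<xi> \<psi> \<and> levy_khintchine \<psi> k d \<mu>"

text \<open>
  HOL cannot quantify over the type of the sample space. The type \<open>real \<Rightarrow> real\<close> is no
  restriction: it carries, for instance, the path \<open>(\<eta>\<^sub>t)\<close> in the coordinates \<open>t \<ge> 0\<close> and the
  killing time, encoded as a real, in the coordinate \<open>-1\<close>.
\<close>

definition subordinator_exponent :: "(real \<Rightarrow> real) \<Rightarrow> bool" where
  "subordinator_exponent \<psi> \<longleftrightarrow>
     (\<exists>(N :: (real \<Rightarrow> real) measure) Y k d \<mu>. subordinator_with N Y \<psi> k d \<mu>)"

definition levy_measure_of :: "(real \<Rightarrow> real) \<Rightarrow> real measure \<Rightarrow> bool" where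
  "levy_measure_of \<psi> \<mu> \<longleftrightarrow> (\<exists>k d. levy_khintchine \<psi> k d \<mu>)"

definition primitive :: "(real \<Rightarrow> real) \<Rightarrow> real \<Rightarrow> real" where
  "primitive \<phi> q = integral {0..q} \<phi>"

definition primitive_inv :: "(real \<Rightarrow> real) \<Rightarrow> real \<Rightarrow> real" where
  "primitive_inv \<phi> = inv_into {0..} (primitive \<phi>)"

definition rho :: "(real \<Rightarrow> 'a \<Rightarrow> ennreal) \<Rightarrow> real \<Rightarrow> 'a \<Rightarrow> ennreal" where
  "rho \<xi> t \<omega> =
     Inf {ennreal r | r. 0 \<le> r \<and> ennreal t < (\<integral>\<^sup>+u\<in>{0..r}. \<xi> u \<omega> \<partial>lborel)}"

text \<open>
  A process evaluated at a \<open>[0,\<infinity>]\<close>-valued time, with the value \<open>\<infinity>\<close> at time \<open>\<infinity>\<close>. When the Levy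
  measure is nonzero, \<open>rho \<xi> t\<close> is almost surely finite, so that convention is immaterial there.
\<close>

definition at_time :: "(real \<Rightarrow> 'a \<Rightarrow> ennreal) \<Rightarrow> ennreal \<Rightarrow> 'a \<Rightarrow> ennreal" where
  "at_time \<xi> r \<omega> = (if r = \<infinity> then \<infinity> else \<xi> (enn2real r) \<omega>)"

end

theory Submission
  imports Defs
begin

text \<open>
  Write \<open>\<Phi>\<close> for the primitive of \<open>\<phi>\<close> and \<open>\<psi>\<close> for its inverse. Then \<open>\<psi>' = 1 / \<phi> \<circ> \<psi>\<close>, and \<open>1 / \<phi>\<close> is completely
  monotone since \<open>\<phi>\<close> is a Bernstein function. Induction on the order of the derivative gives that
  \<open>\<psi>'\<close> is completely monotone, hence by Bernstein's theorem \<open>\<psi>\<close> has a Levy--Khintchine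
  representation and every \<open>e\<^sup>-\<^sup>t\<^sup>\<psi>\<close> is the Laplace transform of a probability measure. These measures
  form a convolution semigroup, from which Kolmogorov's extension theorem and right limits of the
  paths along the rationals yield a subordinator with exponent \<open>\<psi>\<close>.

  For the identity put \<open>A r = \<integral>\<^sub>0\<^sup>r \<xi>\<^sub>u du\<close>, so that \<open>\<rho>\<close> is the right-continuous inverse of \<open>A\<close>. On both
  sides, one takes the Laplace transform in \<open>t\<close> at \<open>l > 0\<close>. The change of variables \<open>t = A r\<close> turns the
  left-hand side into the integral over \<open>r\<close> of the expectation of
  \<open>\<xi>\<^sub>r exp (- q \<xi>\<^sub>r - l A r)\<close> on survival up to \<open>r\<close>, and
  \<open>E exp (- q \<xi>\<^sub>r - l A r) = exp (- (\<Phi> (q + l r) - \<Phi> q) / l)\<close>; differentiate in \<open>q\<close>. The right-hand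
  side becomes \<open>\<phi> q\<close> times the integral of \<open>x\<^sup>2 e\<^sup>-\<^sup>\<Phi>\<^sup>q\<^sup>x / (1 + l x)\<close> against \<open>L\<close>, and both agree because
  \<open>\<psi>' (\<Phi> s) = 1 / \<phi> s\<close>. Equality of the Laplace transforms gives the identity for almost every
  \<open>t\<close>, and right-continuity in \<open>t\<close> extends it to every \<open>t \<ge> 0\<close>.
\<close>


section \<open>Laplace transforms determine measures\<close>

text \<open>Two obstacles shape the proof. Without killing, \<open>1 / \<phi>\<close> blows up at 0,
  so the measure representing \<open>\<psi>'\<close> may be infinite. Bernstein's theorem is
  therefore proved for the shifts \<open>f (e + l)\<close>, whose total mass \<open>f e\<close> is
  finite and where tightness is available; the resulting measures are then glued by removing an
  exponential tilt. Uniqueness of Laplace transforms is likewise set up for measures of infinite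
  mass, and this also serves for densities in \<open>t\<close> on the half-line. The other obstacle
  is killing. Either the area exceeds \<open>t\<close> while the path is alive, and then it equals
  \<open>t\<close> exactly at the passage time, or it does not, and the passage takes place at the
  killing time, possibly \<infinity>, where \<open>exp_neg\<close> is 0. Only the unkilled path on
  \<open>r < \<zeta>\<close> thus enters, and its independence of \<zeta> returns the killing rate
  that \<open>\<phi>\<close> contains. Consistency of the finite-dimensional laws and independence
  of increments are both read off from joint Laplace transforms, so that convolutions never have to
  be computed.\<close>

text \<open>Support in \<open>[-1, 1]\<close> bounds the terms of the exponential series by those of
  \<open>exp \<bar>t\<bar>\<close>, so the characteristic function is a power series whose
  coefficients are the moments.\<close>

lemma real_distribution_moments_unique:
  assumes M: "real_distribution M" and N: "real_distribution N"
    and bM: "AE x in M. \<bar>x\<bar> \<le> 1" and bN: "AE x in N. \<bar>x\<bar> \<le> 1"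
    and eq: "\<And>n. (\<integral>x. x ^ n \<partial>M) = (\<integral>x. x ^ n \<partial>N)"
  shows "M = N"
proof -
  have char_eq: "char M t = (\<Sum>n. ((\<i> * of_real t) ^ n / fact n) * of_real (\<integral>x. x ^ n \<partial>M))"
    if "real_distribution M" "AE x in M. \<bar>x\<bar> \<le> 1" for M t
  proof -
    interpret real_distribution M by fact
    have int: "integrable M (\<lambda>x. x ^ n)" for n :: nat
    proof (rule integrable_const_bound[where B = 1])
      show "AE x in M. norm (x ^ n) \<le> 1"
        using that(2) by eventually_elim (simp add: power_abs power_le_one)
    qed simp
    have 1: "integrable M (\<lambda>x. ((\<i> * of_real t) ^ n / fact n) * complex_of_real (x ^ n))" for n
      using int[of n] by (intro integrable_mult_right integrable_of_real) auto
    have 2: "norm (((\<i> * of_real t) ^ n / fact n) * complex_of_real (x ^ n)) = \<bar>t\<bar> ^ n / fact n * \<bar>x\<bar> ^ n" for n x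
      by (simp add: norm_mult norm_power norm_divide power_mult_distrib)
    have sm: "summable (\<lambda>n. \<bar>t\<bar> ^ n / fact n)"
      using summable_exp[of "\<bar>t\<bar>"] by (simp add: field_simps)
    have "(\<Sum>n. ((\<i> * of_real t) ^ n / fact n) * complex_of_real (x ^ n)) = iexp (t * x)" for x
      unfolding exp_def by (intro suminf_cong) (simp add: scaleR_conv_of_real field_simps power_mult_distrib)
    then have "char M t = (\<integral>x. (\<Sum>n. ((\<i> * of_real t) ^ n / fact n) * complex_of_real (x ^ n)) \<partial>M)"
      by (simp add: char_def)
    also have "\<dots> = (\<Sum>n. (\<integral>x. ((\<i> * of_real t) ^ n / fact n) * complex_of_real (x ^ n) \<partial>M))"
    proof (rule integral_suminf[OF 1])
      show "AE x in M. summable (\<lambda>i. norm (((\<i> * of_real t) ^ i / fact i) * complex_of_real (x ^ i)))"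
        using that(2)
      proof eventually_elim
        case (elim x)
        show ?case unfolding 2
          by (rule summable_comparison_test'[OF sm, of 0])
            (use elim in \<open>auto simp: power_le_one mult_left_le divide_right_mono\<close>)
      qed
      have b: "(\<integral>x. norm (((\<i> * of_real t) ^ n / fact n) * complex_of_real (x ^ n)) \<partial>M) \<le> \<bar>t\<bar> ^ n / fact n" for n
      proof -
        have "(\<integral>x. norm (((\<i> * of_real t) ^ n / fact n) * complex_of_real (x ^ n)) \<partial>M) \<le> (\<integral>x. \<bar>t\<bar> ^ n / fact n \<partial>M)"
        proof (rule integral_mono_AE)
          show "AE x in M. norm (((\<i> * of_real t) ^ n / fact n) * complex_of_real (x ^ n)) \<le> \<bar>t\<bar> ^ n / fact n"
            using that(2) unfolding 2 by eventually_elim (auto simp: power_le_one mult_left_le divide_right_mono)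
        qed (use 1 in \<open>auto intro: integrable_norm\<close>)
        then show ?thesis by (simp add: prob_space[simplified])
      qed
      show "summable (\<lambda>i. \<integral>x. norm (((\<i> * of_real t) ^ i / fact i) * complex_of_real (x ^ i)) \<partial>M)"
        by (rule summable_comparison_test'[OF sm, of 0]) (use b in auto)
    qed
    also have "\<dots> = (\<Sum>n. ((\<i> * of_real t) ^ n / fact n) * of_real (\<integral>x. x ^ n \<partial>M))"
      using int by (intro suminf_cong) (simp del: of_real_power)
    finally show ?thesis .
  qed
  show ?thesis
    by (rule Levy_uniqueness[OF M N]) (simp add: fun_eq_iff char_eq[OF M bM] char_eq[OF N bN] eq)
qed

text \<open>The map \<open>x \<mapsto> exp (- x)\<close> carries the half-line into
  \<open>(0, 1]\<close>, where moments decide. Tilting by \<open>exp (- x)\<close> first makes the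
  mass finite, so the measures themselves may be infinite. Only the transforms at positive integers
  are used.\<close>

lemma laplace_unique:
  fixes M N :: "real measure"
  assumes sM: "sets M = sets borel" and sN: "sets N = sets borel"
    and pM: "emeasure M {..<0} = 0" and pN: "emeasure N {..<0} = 0"
    and fin: "\<And>q. 0 < q \<Longrightarrow> (\<integral>\<^sup>+x. ennreal (exp (- q * x)) \<partial>M) < \<infinity>"
    and eq: "\<And>q. 0 < q \<Longrightarrow> (\<integral>\<^sup>+x. ennreal (exp (- q * x)) \<partial>M) = (\<integral>\<^sup>+x. ennreal (exp (- q * x)) \<partial>N)"
  shows "M = N"
proof -
  define c where "c = enn2real (\<integral>\<^sup>+x. ennreal (exp (- x)) \<partial>M)"
  have cM: "(\<integral>\<^sup>+x. ennreal (exp (- x)) \<partial>M) = ennreal c"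
    unfolding c_def using fin[of 1] by simp
  have cN: "(\<integral>\<^sup>+x. ennreal (exp (- x)) \<partial>N) = ennreal c"
    using eq[of 1] cM by simp
  have [measurable_cong]: "sets M = sets borel" "sets N = sets borel" by fact+
  have c0: "0 \<le> c" by (simp add: c_def)
  show ?thesis
  proof (cases "c = 0")
    case True
    have "K = null_measure borel" if "sets K = sets borel" "(\<integral>\<^sup>+x. ennreal (exp (- x)) \<partial>K) = 0" for K :: "real measure"
    proof -
      have [measurable_cong]: "sets K = sets borel" by fact
      have "AE x in K. ennreal (exp (- x)) = 0"
        using that(2) by (subst (asm) nn_integral_0_iff_AE) auto
      then have "AE x in K. False" by (rule AE_mp) simp
      then have "emeasure K (space K) = 0" by (simp add: AE_iff_measurable[OF sets.top])
      then have "emeasure K A = 0" for A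
        by (metis emeasure_eq_0 emeasure_notin_sets sets.sets_into_space sets.top)
      then show ?thesis by (intro measure_eqI) (auto simp: that)
    qed
    then show ?thesis using cM cN True sM sN by (metis ennreal_0)
  next
    case False
    with c0 have cpos: "0 < c" by simp
    \<comment> \<open>Normalised tilt followed by \<open>u = exp (- x)\<close>; the
      \<open>n\<close>-th moment of \<open>T K\<close> is the transform of \<open>K\<close> at
      \<open>n + 1\<close> divided by \<open>c\<close>.\<close>
    define T where "T K = distr (density K (\<lambda>x. ennreal (exp (- x) / c))) borel (\<lambda>x. exp (- x))" for K :: "real measure"
    have props: "real_distribution (T K) \<and> (AE u in T K. \<bar>u\<bar> \<le> 1) \<and>
        (\<forall>n. (\<integral>u. u ^ n \<partial>T K) = enn2real (\<integral>\<^sup>+x. ennreal (exp (- real (Suc n) * x)) \<partial>K) / c)"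
      if sK: "sets K = sets borel" and pK: "emeasure K {..<0} = 0" and cK: "(\<integral>\<^sup>+x. ennreal (exp (- x)) \<partial>K) = ennreal c" for K
    proof (intro conjI allI)
      note [measurable_cong] = sK
      have ae: "AE x in K. 0 \<le> x"
        by (subst AE_iff_measurable[where N = "{..<0}"]) (use pK sets_eq_imp_space_eq[OF sK] in \<open>auto simp: sK not_le\<close>)
      have "emeasure (density K (\<lambda>x. ennreal (exp (- x) / c))) (space K) = 1"
      proof -
        have "emeasure (density K (\<lambda>x. ennreal (exp (- x) / c))) (space K) = (\<integral>\<^sup>+x. ennreal (exp (- x)) * ennreal (1 / c) \<partial>K)"
          using cpos by (subst emeasure_density) (auto intro!: nn_integral_cong simp flip: ennreal_mult)
        also have "\<dots> = ennreal c * ennreal (1 / c)" by (subst nn_integral_multc) (auto simp: cK)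
        also have "\<dots> = 1" using cpos by (simp flip: ennreal_mult)
        finally show ?thesis .
      qed
      then have ps: "prob_space (density K (\<lambda>x. ennreal (exp (- x) / c)))"
        by (intro prob_spaceI) simp
      show rd: "real_distribution (T K)" unfolding T_def
        by (intro prob_space.real_distribution_distr ps) simp
      show "AE u in T K. \<bar>u\<bar> \<le> 1" unfolding T_def
        using ae by (subst AE_distr_iff) (auto simp: AE_density elim!: eventually_mono)
      fix n
      have "(\<integral>u. u ^ n \<partial>T K) = (\<integral>x. exp (-x) / c * exp (- x) ^ n \<partial>K)"
        unfolding T_def using cpos by (subst integral_distr) (auto simp: integral_density)
      also have "\<dots> = (\<integral>x. exp (- real (Suc n) * x) / c \<partial>K)"
        by (intro Bochner_Integration.integral_cong refl)
          (simp add: exp_of_nat_mult[symmetric] exp_add[symmetric] algebra_simps)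
      also have "\<dots> = enn2real (\<integral>\<^sup>+x. ennreal (exp (- real (Suc n) * x)) \<partial>K) / c"
        by (subst integral_divide_zero) (simp add: integral_eq_nn_integral)
      finally show "(\<integral>u. u ^ n \<partial>T K) = enn2real (\<integral>\<^sup>+x. ennreal (exp (- real (Suc n) * x)) \<partial>K) / c" .
    qed
    have eq': "(\<integral>\<^sup>+x. ennreal (exp (- (real (Suc n) * x))) \<partial>M) = (\<integral>\<^sup>+x. ennreal (exp (- (real (Suc n) * x))) \<partial>N)" for n
      using eq[of "real (Suc n)"] by (simp del: of_nat_Suc)
    have "T M = T N"
      by (rule real_distribution_moments_unique)
        (use props[OF sM pM cM] props[OF sN pN cN] in \<open>auto simp: eq' simp del: of_nat_Suc\<close>)
    \<comment> \<open>Both operations are invertible: \<open>- ln\<close> undoes the change of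
      variable and the density \<open>c * exp x\<close> undoes the tilt, so \<open>T\<close>
      determines the measure.\<close>
    moreover have "density (distr (T K) borel (\<lambda>u. - ln u)) (\<lambda>x. ennreal (c * exp x)) = K" if "sets K = sets borel" for K
    proof -
      note [measurable_cong] = that
      have "distr (T K) borel (\<lambda>u. - ln u) = distr (density K (\<lambda>x. ennreal (exp (- x) / c))) borel (\<lambda>x. x)"
        unfolding T_def by (subst distr_distr) (auto simp: comp_def)
      also have "\<dots> = density K (\<lambda>x. ennreal (exp (- x) / c))"
        by (rule distr_id2) (simp add: that)
      finally have "density (distr (T K) borel (\<lambda>u. - ln u)) (\<lambda>x. ennreal (c * exp x)) = density K (\<lambda>x. 1)"
        using cpos by (simp add: density_density_eq exp_minus field_simps flip: ennreal_mult)
      then show ?thesis by (simp add: density_1)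
    qed
    ultimately show ?thesis using sM sN by metis
  qed
qed

section \<open>Completely monotone functions\<close>

text \<open>\<open>f'\<close> is minus the derivative, so each level asks for nonnegativity again.
  The order is finite so that complete monotonicity can be obtained by induction on it, and the
  domain is open at 0 so that blow-up there is allowed.\<close>

fun cm_upto :: "nat \<Rightarrow> (real \<Rightarrow> real) \<Rightarrow> bool" where
  "cm_upto 0 f \<longleftrightarrow> (\<forall>x>0. 0 \<le> f x)"
| "cm_upto (Suc n) f \<longleftrightarrow> (\<forall>x>0. 0 \<le> f x) \<and>
     (\<exists>f'. (\<forall>x>0. (f has_real_derivative - f' x) (at x)) \<and> cm_upto n f')"

lemma cm_upto_nonneg: "cm_upto n f \<Longrightarrow> 0 < x \<Longrightarrow> 0 \<le> f x"
  by (cases n) auto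

lemma cm_upto_SucD: "cm_upto (Suc n) f \<Longrightarrow> cm_upto n f"
proof (induction n arbitrary: f)
  case (Suc n)
  then obtain f' where "\<forall>x>0. 0 \<le> f x" "\<forall>x>0. (f has_real_derivative - f' x) (at x)" "cm_upto (Suc n) f'"
    by auto
  with Suc.IH show ?case by auto
qed simp

lemma cm_upto_cong:
  assumes "cm_upto n f" "\<And>x. 0 < x \<Longrightarrow> f x = g x"
  shows "cm_upto n g"
proof (cases n)
  case 0
  then show ?thesis using assms by auto
next
  case (Suc m)
  then obtain f' where f': "\<forall>x>0. 0 \<le> f x" "\<forall>x>0. (f has_real_derivative - f' x) (at x)" "cm_upto m f'"
    using assms by auto
  have "(g has_real_derivative - f' x) (at x)" if "x > 0" for x
    by (rule has_field_derivative_transform_within_open[of f _ _ "{0<..}"]) (use f' assms that in auto)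
  with f' assms Suc show ?thesis by auto
qed

lemma cm_upto_add: "cm_upto n f \<Longrightarrow> cm_upto n g \<Longrightarrow> cm_upto n (\<lambda>x. f x + g x)"
proof (induction n arbitrary: f g)
  case (Suc n)
  then obtain f' g' where "\<forall>x>0. 0 \<le> f x" "\<forall>x>0. (f has_real_derivative - f' x) (at x)" "cm_upto n f'"
     "\<forall>x>0. 0 \<le> g x" "\<forall>x>0. (g has_real_derivative - g' x) (at x)" "cm_upto n g'"
    by auto
  then show ?case using Suc.IH[of f' g']
    by (auto intro!: exI[of _ "\<lambda>x. f' x + g' x"] derivative_eq_intros)
qed simp

lemma cm_upto_mult: "cm_upto n f \<Longrightarrow> cm_upto n g \<Longrightarrow> cm_upto n (\<lambda>x. f x * g x)"
proof (induction n arbitrary: f g)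
  case (Suc n)
  then obtain f' g' where fg: "\<forall>x>0. 0 \<le> f x" "\<forall>x>0. (f has_real_derivative - f' x) (at x)" "cm_upto n f'"
     "\<forall>x>0. 0 \<le> g x" "\<forall>x>0. (g has_real_derivative - g' x) (at x)" "cm_upto n g'"
    by auto
  have "cm_upto n (\<lambda>x. f' x * g x + f x * g' x)"
    by (intro cm_upto_add Suc.IH fg cm_upto_SucD[OF Suc.prems(1)] cm_upto_SucD[OF Suc.prems(2)])
  with fg show ?case
    by (auto intro!: exI[of _ "\<lambda>x. f' x * g x + f x * g' x"] derivative_eq_intros simp: algebra_simps)
qed simp

text \<open>\<open>F n\<close> is \<open>(-1)^n\<close> times the \<open>n\<close>-th derivative of
  \<open>F 0\<close>.\<close>

definition cm_sequence :: "(nat \<Rightarrow> real \<Rightarrow> real) \<Rightarrow> bool" where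
  "cm_sequence F \<longleftrightarrow> (\<forall>n. \<forall>x>0. 0 \<le> F n x \<and> (F n has_real_derivative - F (Suc n) x) (at x))"

lemma cm_sequence_shift: "cm_sequence F \<Longrightarrow> cm_sequence (\<lambda>n. F (Suc n))"
  by (auto simp: cm_sequence_def)

lemma cm_sequence_imp_cm_upto: "cm_sequence F \<Longrightarrow> cm_upto n (F k)"
  by (induction n arbitrary: k) (auto simp: cm_sequence_def)

lemma cm_upto_deriv:
  assumes "cm_upto (Suc n) f"
  shows "cm_upto n (\<lambda>x. - deriv f x)" and "0 < x \<Longrightarrow> (f has_real_derivative deriv f x) (at x)"
proof -
  obtain f' where f': "\<forall>x>0. (f has_real_derivative - f' x) (at x)" "cm_upto n f'"
    using assms by auto
  show "cm_upto n (\<lambda>x. - deriv f x)"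
    by (rule cm_upto_cong[OF f'(2)]) (use f' DERIV_imp_deriv in fastforce)
  show "0 < x \<Longrightarrow> (f has_real_derivative deriv f x) (at x)"
    using f' DERIV_deriv_iff_has_field_derivative by blast
qed

text \<open>The derivatives hidden in \<open>cm_upto n f\<close> are chosen anew for each
  \<open>n\<close>; iterating minus \<open>deriv\<close> gives one sequence that serves all
  orders.\<close>

lemma cm_sequence_exists:
  assumes "\<And>n. cm_upto n f"
  obtains F where "cm_sequence F" "F 0 = f"
proof
  let ?F = "\<lambda>k. ((\<lambda>g x. - deriv g x) ^^ k) f"
  have cm: "cm_upto n (?F k)" for n k
  proof (induction k arbitrary: n)
    case (Suc k)
    show ?case using cm_upto_deriv(1)[OF Suc.IH[of "Suc n"]] by simp
  qed (use assms in simp)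
  show "cm_sequence ?F" unfolding cm_sequence_def
    using cm_upto_nonneg[OF cm] cm_upto_deriv(2)[OF cm] by simp
qed simp

text \<open>The derivative of \<open>F k (u y)\<close> is \<open>- F (Suc k) (u y) * g y\<close>, a
  product covered by the induction hypothesis at index \<open>Suc k\<close>; hence \<open>k\<close>
  is arbitrary. The composite has one order more than \<open>g\<close>, and this gain is what closes
  the induction in \<open>psi_deriv_cm\<close>.\<close>

lemma cm_upto_compose:
  assumes F: "cm_sequence F" and pos: "\<And>y. 0 < y \<Longrightarrow> 0 < u y"
    and der: "\<And>y. 0 < y \<Longrightarrow> (u has_real_derivative g y) (at y)"
    and g: "cm_upto n g"
  shows "cm_upto (Suc n) (\<lambda>y. F k (u y))"
  using g
proof (induction n arbitrary: k)
  case 0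
  have "((\<lambda>y. F k (u y)) has_real_derivative - (F (Suc k) (u y) * g y)) (at y)" if "0 < y" for y
    using F pos[OF that] der[OF that] unfolding cm_sequence_def
    by (auto intro!: DERIV_chain2[of "F k" "- F (Suc k) (u y)" u, THEN DERIV_cong])
  with 0 F pos show ?case
    by (auto simp: cm_sequence_def intro!: exI[of _ "\<lambda>y. F (Suc k) (u y) * g y"])
next
  case (Suc n)
  have "((\<lambda>y. F k (u y)) has_real_derivative - (F (Suc k) (u y) * g y)) (at y)" if "0 < y" for y
    using F pos[OF that] der[OF that] unfolding cm_sequence_def
    by (auto intro!: DERIV_chain2[of "F k" "- F (Suc k) (u y)" u, THEN DERIV_cong])
  moreover have "cm_upto (Suc n) (\<lambda>y. F (Suc k) (u y) * g y)"
    by (intro cm_upto_mult Suc.IH cm_upto_SucD[OF Suc.prems] Suc.prems)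
  ultimately show ?case
    using F pos unfolding cm_upto.simps(2)[of "Suc n"]
    by (intro conjI exI[of _ "\<lambda>y. F (Suc k) (u y) * g y"]) (simp_all add: cm_sequence_def)
qed

section \<open>Taylor expansion of completely monotone functions\<close>

definition taylor_rest :: "(nat \<Rightarrow> real \<Rightarrow> real) \<Rightarrow> real \<Rightarrow> nat \<Rightarrow> real \<Rightarrow> real" where
  "taylor_rest F a n s = F 0 s - (\<Sum>k<n. F k a * (a - s) ^ k / fact k)"

text \<open>The signs carried by \<open>cm_sequence\<close> turn the powers of \<open>s - a\<close>
  into powers of \<open>a - s\<close>, so all Taylor terms are nonnegative left of \<open>a\<close>.
  Differentiation leads to the remainder of the shifted sequence, one order lower, on which the next
  induction rests.\<close>

lemma taylor_rest_deriv:
  assumes F: "cm_sequence F" and "0 < s"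
  shows "(taylor_rest F a (Suc n) has_real_derivative - taylor_rest (\<lambda>k. F (Suc k)) a n s) (at s)"
proof -
  have "((\<lambda>s. F 0 s - (\<Sum>k<Suc n. F k a * (a - s) ^ k / fact k)) has_real_derivative
      - F (Suc 0) s - (\<Sum>k<Suc n. F k a * (real k * (a - s) ^ (k - 1) * (- 1)) / fact k)) (at s)"
    using F \<open>0 < s\<close> unfolding cm_sequence_def
    by (auto intro!: derivative_eq_intros simp: algebra_simps)
  moreover have "(\<Sum>k<Suc n. F k a * (real k * (a - s) ^ (k - 1) * (- 1)) / fact k) =
      - (\<Sum>k<n. F (Suc k) a * (a - s) ^ k / fact k)"
    by (subst sum.lessThan_Suc_shift) (simp add: sum_negf[symmetric] fact_Suc field_simps del: of_nat_Suc)
  ultimately show ?thesis by (simp add: taylor_rest_def[abs_def])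
qed

lemma taylor_rest_at: "taylor_rest F a (Suc n) a = 0"
  unfolding taylor_rest_def by (subst sum.lessThan_Suc_shift) simp

text \<open>The divided remainder is non-increasing, which beats the geometric factor in the next lemma
  on the whole of \<open>(0, a]\<close> and not just on \<open>(a/2, a]\<close>.\<close>

lemma taylor_rest_mono:
  assumes "cm_sequence F" "0 < s" "s \<le> a"
  shows "0 \<le> taylor_rest F a n s \<and>
    (\<forall>u\<in>{s..a}. taylor_rest F a n u * (a - s) ^ n \<le> taylor_rest F a n s * (a - u) ^ n)"
  using assms
proof (induction n arbitrary: F s)
  case 0
  have "F 0 u \<le> F 0 s" if "s \<le> u" "u \<le> a" for u
  proof (rule DERIV_nonpos_imp_nonincreasing[OF that(1)])
    fix x assume "s \<le> x"
    then have "0 \<le> F (Suc 0) x \<and> (F 0 has_real_derivative - F (Suc 0) x) (at x)"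
      using 0 unfolding cm_sequence_def by (meson less_le_trans)
    then show "\<exists>y. (F 0 has_real_derivative y) (at x) \<and> y \<le> 0"
      by (intro exI[of _ "- F (Suc 0) x"]) simp
  qed
  with 0 show ?case by (auto simp: taylor_rest_def cm_sequence_def)
next
  case (Suc n)
  let ?T = "taylor_rest F a (Suc n)" and ?R = "taylor_rest (\<lambda>k. F (Suc k)) a n"
  have F': "cm_sequence (\<lambda>k. F (Suc k))" using Suc.prems(1) by (rule cm_sequence_shift)
  have R0: "0 \<le> ?R u" if "0 < u" "u \<le> a" for u
    using Suc.IH[OF F' that] by simp
  have Rmono: "?R v * (a - u) ^ n \<le> ?R u * (a - v) ^ n" if "0 < u" "u \<le> v" "v \<le> a" for u v
    using Suc.IH[OF F', of u] that by simp
  have T0: "0 \<le> ?T u" if "0 < u" "u \<le> a" for u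
  proof -
    have "?T a \<le> ?T u"
    proof (rule DERIV_nonpos_imp_nonincreasing[OF that(2), of ?T])
      fix v assume "u \<le> v" "v \<le> a"
      then show "\<exists>y. (?T has_real_derivative y) (at v) \<and> y \<le> 0"
        using R0[of v] taylor_rest_deriv[OF Suc.prems(1), of v a n] that
        by (intro exI[of _ "- ?R v"]) simp
    qed
    then show ?thesis by (simp add: taylor_rest_at)
  qed
  have key: "real (Suc n) * ?T u \<le> (a - u) * ?R u" if u: "0 < u" "u < a" for u
  proof -
    \<comment> \<open>\<open>h\<close> integrates the bound \<open>Rmono\<close> on
      \<open>?R v\<close> from \<open>v\<close> to \<open>a\<close>: its derivative is nonpositive,
      it vanishes at \<open>a\<close>, and \<open>0 \<le> h u\<close> is the claim.\<close>
    define h where "h v = ?R u * (a - v) ^ Suc n / (real (Suc n) * (a - u) ^ n) - ?T v" for v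
    have "h a \<le> h u"
    proof (rule DERIV_nonpos_imp_nonincreasing[of u a h])
      fix v assume v: "u \<le> v" "v \<le> a"
      have "(h has_real_derivative (?R u * (real (Suc n) * (a - v) ^ n * (- 1)) / (real (Suc n) * (a - u) ^ n) - (- ?R v))) (at v)"
        unfolding h_def
        by (intro DERIV_diff DERIV_cdivide DERIV_cmult taylor_rest_deriv Suc.prems)
          (use u v in \<open>auto intro!: derivative_eq_intros simp del: of_nat_Suc power_Suc\<close>)
      moreover have "?R u * (real (Suc n) * (a - v) ^ n * (- 1)) / (real (Suc n) * (a - u) ^ n) - (- ?R v) \<le> 0"
      proof -
        have "?R u * (real (Suc n) * (a - v) ^ n * (- 1)) / (real (Suc n) * (a - u) ^ n) = - (?R u * (a - v) ^ n / (a - u) ^ n)"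
          using u by (simp add: field_simps del: of_nat_Suc)
        moreover have "?R v \<le> ?R u * (a - v) ^ n / (a - u) ^ n"
          using Rmono[of u v] u v by (simp add: pos_le_divide_eq)
        ultimately show ?thesis by simp
      qed
      ultimately show "\<exists>y. (h has_real_derivative y) (at v) \<and> y \<le> 0" by blast
    qed (use u in simp)
    then have "?T u \<le> ?R u * (a - u) ^ Suc n / (real (Suc n) * (a - u) ^ n)"
      by (simp add: h_def taylor_rest_at del: of_nat_Suc)
    also have "\<dots> = (a - u) * ?R u / real (Suc n)"
      using u by (simp add: field_simps del: of_nat_Suc)
    finally show ?thesis by (simp add: pos_le_divide_eq mult.commute del: of_nat_Suc)
  qed
  have "?T u * (a - s) ^ Suc n \<le> ?T s * (a - u) ^ Suc n" if u: "s \<le> u" "u \<le> a" for u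
  proof (cases "u = a")
    case True
    then show ?thesis by (simp add: taylor_rest_at)
  next
    case False
    with u have "u < a" by simp
    have "?T u / (a - u) ^ Suc n \<le> ?T s / (a - s) ^ Suc n"
    proof (rule DERIV_nonpos_imp_nonincreasing[OF u(1), of "\<lambda>u. ?T u / (a - u) ^ Suc n"])
      fix v assume v: "s \<le> v" "v \<le> u"
      then have v': "0 < v" "v < a" using \<open>u < a\<close> Suc.prems by auto
      \<comment> \<open>Quotient rule; up to a nonnegative factor the numerator is
        \<open>(n + 1) T v - (a - v) R v\<close>, whose sign is given by \<open>key\<close>.\<close>
      define D where "D = (- ?R v * (a - v) ^ Suc n - ?T v * (real (Suc n) * (a - v) ^ n * (- 1))) / ((a - v) ^ Suc n * (a - v) ^ Suc n)"
      have "((\<lambda>u. ?T u / (a - u) ^ Suc n) has_real_derivative D) (at v)"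
        unfolding D_def
        by (intro DERIV_divide taylor_rest_deriv Suc.prems v')
          (use v' in \<open>auto intro!: derivative_eq_intros simp del: of_nat_Suc power_Suc\<close>)
      moreover have "D \<le> 0"
      proof -
        have "- ?R v * (a - v) ^ Suc n - ?T v * (real (Suc n) * (a - v) ^ n * (- 1)) =
            (real (Suc n) * ?T v - (a - v) * ?R v) * (a - v) ^ n"
          by (simp add: algebra_simps del: of_nat_Suc)
        also have "\<dots> \<le> 0"
          using key[OF v'] v' by (intro mult_nonpos_nonneg) auto
        finally show ?thesis unfolding D_def using v' by (intro divide_nonpos_nonneg) auto
      qed
      ultimately show "\<exists>y. ((\<lambda>u. ?T u / (a - u) ^ Suc n) has_real_derivative y) (at v) \<and> y \<le> 0" by blast
    qed
    then show ?thesis using \<open>u < a\<close> u by (simp add: field_simps del: power_Suc)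
  qed
  then show ?case using T0 Suc.prems by auto
qed

text \<open>Passing from the remainder at a smaller point \<open>s'\<close> to that at
  \<open>s\<close> gains \<open>r ^ n\<close> with \<open>r < 1\<close>, and the remainder at
  \<open>s'\<close> never exceeds \<open>F 0 s'\<close>. Any \<open>s'\<close> in
  \<open>(0, s)\<close> would do.\<close>

lemma cm_sequence_taylor:
  assumes F: "cm_sequence F" and s: "0 < s" "s \<le> a"
  shows "(\<lambda>k. F k a * (a - s) ^ k / fact k) sums F 0 s"
proof -
  define s' where "s' = s / 2"
  have s': "0 < s'" "s' < s" using s by (auto simp: s'_def)
  define r where "r = (a - s) / (a - s')"
  have r: "0 \<le> r" "r < 1" using s s' by (auto simp: r_def field_simps)
  have "0 \<le> taylor_rest F a n s" for n
    using taylor_rest_mono[OF F s] by simp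
  moreover have "taylor_rest F a n s \<le> F 0 s' * r ^ n" for n
  proof -
    have "taylor_rest F a n s * (a - s') ^ n \<le> taylor_rest F a n s' * (a - s) ^ n"
      using taylor_rest_mono[OF F, of s' a n] s s' by auto
    also have "\<dots> \<le> F 0 s' * (a - s) ^ n"
      unfolding taylor_rest_def using F s s'
      by (intro mult_right_mono) (auto simp: cm_sequence_def intro!: sum_nonneg)
    finally show ?thesis using s s' by (simp add: r_def power_divide pos_le_divide_eq)
  qed
  moreover have "(\<lambda>n. F 0 s' * r ^ n) \<longlonglongrightarrow> F 0 s' * 0"
    using r by (intro tendsto_mult tendsto_const LIMSEQ_power_zero) auto
  ultimately have "(\<lambda>n. taylor_rest F a n s) \<longlonglongrightarrow> 0"
    by (intro tendsto_sandwich[where f = "\<lambda>_. 0" and h = "\<lambda>n. F 0 s' * r ^ n" and g = "\<lambda>n. taylor_rest F a n s"]) auto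
  then have "(\<lambda>n. F 0 s - taylor_rest F a n s) \<longlonglongrightarrow> F 0 s - 0"
    by (intro tendsto_diff tendsto_const)
  then show ?thesis by (simp add: sums_def taylor_rest_def)
qed

section \<open>Bernstein's theorem\<close>

lemma AE_nonneg_of_null: 
  fixes M :: "real measure"
  assumes "sets M = sets borel" "emeasure M {..<0} = 0"
  shows "AE x in M. 0 \<le> x"
  by (subst AE_iff_measurable[where N = "{..<0}"])
    (use assms sets_eq_imp_space_eq[OF assms(1)] in \<open>auto simp: not_le\<close>)

lemma cm_sequence_antimono:
  assumes "cm_sequence F" "0 < x" "x \<le> y"
  shows "F n y \<le> F n x"
proof (rule DERIV_nonpos_imp_nonincreasing[OF assms(3)])
  fix u assume "x \<le> u"
  then have "0 \<le> F (Suc n) u \<and> (F n has_real_derivative - F (Suc n) u) (at u)"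
    using assms unfolding cm_sequence_def by (meson less_le_trans)
  then show "\<exists>y. (F n has_real_derivative y) (at u) \<and> y \<le> 0"
    by (intro exI[of _ "- F (Suc n) u"]) simp
qed

lemma scaled_one_minus_exp_tendsto:
  assumes "0 \<le> (l::real)"
  shows "(\<lambda>N. real (Suc N) * (1 - exp (- l / real (Suc N)))) \<longlonglongrightarrow> l"
proof (rule tendsto_sandwich)
  show "eventually (\<lambda>N. real (Suc N) * (1 - exp (- l / real (Suc N))) \<le> l) sequentially"
  proof (rule always_eventually, rule allI)
    fix N
    have "1 + (- l / real (Suc N)) \<le> exp (- l / real (Suc N))" by (rule exp_ge_add_one_self)
    then have "1 - exp (- l / real (Suc N)) \<le> l / real (Suc N)" by simp
    then show "real (Suc N) * (1 - exp (- l / real (Suc N))) \<le> l"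
      by (simp add: pos_le_divide_eq mult.commute del: of_nat_Suc)
  qed
  show "eventually (\<lambda>N. l / (1 + l / real (Suc N)) \<le> real (Suc N) * (1 - exp (- l / real (Suc N)))) sequentially"
  proof (rule always_eventually, rule allI)
    fix N
    define x where "x = l / real (Suc N)"
    have x: "0 \<le> x" using assms by (simp add: x_def)
    have "1 + x \<le> exp x" by (rule exp_ge_add_one_self)
    then have "exp (- x) \<le> 1 / (1 + x)" using x by (simp add: exp_minus field_simps)
    then have "1 - 1 / (1 + x) \<le> 1 - exp (- x)" by simp
    moreover have "1 - 1 / (1 + x) = x / (1 + x)" using x by (simp add: field_simps)
    ultimately have "real (Suc N) * (x / (1 + x)) \<le> real (Suc N) * (1 - exp (- x))"
      by (intro mult_left_mono) simp_all
    moreover have "real (Suc N) * (x / (1 + x)) = l / (1 + x)" by (simp add: x_def del: of_nat_Suc)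
    ultimately show "l / (1 + l / real (Suc N)) \<le> real (Suc N) * (1 - exp (- l / real (Suc N)))"
      by (simp add: x_def)
  qed
  have "(\<lambda>N. l / (1 + l / real (Suc N))) \<longlonglongrightarrow> l / (1 + 0)"
    by (intro tendsto_intros LIMSEQ_Suc[OF lim_const_over_n]) simp
  then show "(\<lambda>N. l / (1 + l / real (Suc N))) \<longlonglongrightarrow> l" by simp
qed simp

text \<open>Expand around the far point \<open>e + A N\<close> and evaluate at \<open>s l N\<close>.
  There \<open>(e + A N - s l N) ^ k = A N ^ k * exp (- l * k / A N)\<close>, so the Taylor series
  is the Laplace transform at \<open>l\<close> of masses placed at \<open>k / A N\<close>. Since
  \<open>s l N\<close> tends to \<open>e + l\<close>, a weak limit of these discrete laws represents
  \<open>F 0 (e + l)\<close>.\<close>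

lemma bernstein_shifted:
  assumes F: "cm_sequence F" and e: "0 < e"
  shows "\<exists>m::real measure. sets m = sets borel \<and> emeasure m {..<0} = 0 \<and>
    (\<forall>l\<ge>0. (\<integral>\<^sup>+x. ennreal (exp (- l * x)) \<partial>m) = ennreal (F 0 (e + l)))"
proof (cases "F 0 e = 0")
  case True
  have "F 0 (e + l) = 0" if "0 \<le> l" for l
    using cm_sequence_antimono[OF F e, of "e + l" 0] F e that True
    by (auto simp: cm_sequence_def intro!: antisym)
  then show ?thesis by (intro exI[of _ "null_measure borel"]) (auto simp: nn_integral_null_measure)
next
  case False
  define c where "c = F 0 e"
  have c: "0 < c" using False F e by (auto simp: c_def cm_sequence_def less_le)
  define A where "A N = real (Suc N)" for N
  have A: "0 < A N" for N by (simp add: A_def)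
  define s where "s l N = e + A N * (1 - exp (- l / A N))" for l N
  have s_pos: "0 < s l N" "e \<le> s l N" if "0 \<le> l" for l N
  proof -
    have "0 \<le> A N * (1 - exp (- l / A N))"
      using A[of N] that by (intro mult_nonneg_nonneg) auto
    then show "0 < s l N" "e \<le> s l N" using e by (auto simp: s_def)
  qed
  have s_le: "s l N \<le> e + l" if "0 \<le> l" for l N
  proof -
    have "1 + (- l / A N) \<le> exp (- l / A N)" by (rule exp_ge_add_one_self)
    then have "1 - exp (- l / A N) \<le> l / A N" by simp
    then show ?thesis using A[of N] by (simp add: s_def pos_le_divide_eq mult.commute)
  qed
  have s_lim: "(\<lambda>N. s l N) \<longlonglongrightarrow> e + l" if "0 \<le> l" for l
    unfolding s_def A_def by (intro tendsto_add tendsto_const scaled_one_minus_exp_tendsto that)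
  \<comment> \<open>These weights sum to 1 because \<open>s 0 N = e\<close> and
    \<open>c = F 0 e\<close>.\<close>
  define w where "w N n = F n (e + A N) * A N ^ n / fact n / c" for N n
  have w0: "0 \<le> w N n" for N n
    using F A[of N] c e by (auto simp: w_def cm_sequence_def intro!: divide_nonneg_nonneg mult_nonneg_nonneg)
  have w_sums: "(\<lambda>n. w N n * exp (- l * (real n / A N))) sums (F 0 (s l N) / c)" if "0 \<le> l" for l N
  proof -
    have "(\<lambda>k. F k (e + A N) * (e + A N - s l N) ^ k / fact k) sums F 0 (s l N)"
      by (rule cm_sequence_taylor[OF F]) (use s_pos[OF that] A[of N] in \<open>auto simp: s_def\<close>)
    then have "(\<lambda>k. F k (e + A N) * (e + A N - s l N) ^ k / fact k / c) sums (F 0 (s l N) / c)"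
      by (rule sums_divide)
    moreover have "F k (e + A N) * (e + A N - s l N) ^ k / fact k / c = w N k * exp (- l * (real k / A N))" for k
    proof -
      have "e + A N - s l N = A N * exp (- l / A N)" by (simp add: s_def algebra_simps)
      then have "(e + A N - s l N) ^ k = A N ^ k * exp (- l * (real k / A N))"
        by (simp add: power_mult_distrib exp_of_nat_mult[symmetric])
      then show ?thesis by (simp add: w_def)
    qed
    ultimately show ?thesis by simp
  qed
  have w1: "(\<integral>\<^sup>+n. ennreal (w N n) \<partial>count_space UNIV) = 1" for N
    using suminf_ennreal_eq[OF w0 w_sums[of 0 N, simplified]] c
    by (simp add: nn_integral_count_space_nat s_def c_def)
  define p where "p N = embed_pmf (w N)" for N
  have pmf_p: "pmf (p N) n = w N n" for N n
    unfolding p_def by (rule pmf_embed_pmf[OF w0 w1])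
  define \<mu> where "\<mu> N = distr (measure_pmf (p N)) borel (\<lambda>n. real n / A N)" for N
  have rd: "real_distribution (\<mu> N)" for N
    unfolding \<mu>_def by (intro prob_space.real_distribution_distr measure_pmf.prob_space_axioms) simp
  have ae: "AE x in \<mu> N. 0 \<le> x" for N
    unfolding \<mu>_def using A[of N] by (subst AE_distr_iff) auto
  \<comment> \<open>\<open>max 0\<close> makes the exponential bounded and continuous on the whole
    line, as weak convergence requires; the laws sit on \<open>[0, \<infinity>)\<close>, where it
    changes nothing.\<close>
  define g where "g l x = exp (- l * max 0 x)" for l x :: real
  have [measurable]: "g l \<in> borel_measurable borel" for l unfolding g_def by measurable
  have g_int: "(\<integral>x. g l x \<partial>\<mu> N) = F 0 (s l N) / c" if "0 \<le> l" for l N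
  proof -
    have "(\<integral>\<^sup>+x. ennreal (g l x) \<partial>\<mu> N) = (\<integral>\<^sup>+n. ennreal (exp (- l * (real n / A N))) \<partial>measure_pmf (p N))"
      unfolding \<mu>_def using A[of N] by (subst nn_integral_distr) (auto simp: g_def intro!: nn_integral_cong)
    also have "\<dots> = (\<Sum>n. ennreal (w N n * exp (- l * (real n / A N))))"
      by (subst nn_integral_measure_pmf) (simp add: nn_integral_count_space_nat pmf_p ennreal_mult w0)
    also have "\<dots> = ennreal (F 0 (s l N) / c)"
      by (rule suminf_ennreal_eq) (use w_sums[OF that] w0 in auto)
    finally show ?thesis
      using F s_pos[OF that, of N] c
      by (subst integral_eq_nn_integral) (auto simp: \<mu>_def g_def cm_sequence_def)
  qed
  have cont: "isCont (F 0) (e + l)" if "0 \<le> l" for l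
  proof -
    have "(F 0 has_real_derivative - F (Suc 0) (e + l)) (at (e + l))"
      using F e that by (simp add: cm_sequence_def)
    then show ?thesis by (rule DERIV_isCont)
  qed
  have F_lim: "(\<lambda>N. F 0 (s l N) / c) \<longlonglongrightarrow> F 0 (e + l) / c" if "0 \<le> l" for l
    by (intro tendsto_divide isCont_tendsto_compose[OF cont] s_lim that tendsto_const) (use c in auto)
  have tight: "tight \<mu>" unfolding tight_def
  proof (intro conjI allI impI rd)
    fix \<epsilon> :: real assume \<epsilon>: "0 < \<epsilon>"
    have "eventually (\<lambda>h. dist (F 0 (e + h)) (F 0 e) < c * \<epsilon> / 4) (at_right 0)"
    proof -
      have "((\<lambda>h. F 0 (e + h)) \<longlongrightarrow> F 0 (e + 0)) (at_right 0)"
        by (rule isCont_tendsto_compose[OF cont[OF order_refl]]) (intro tendsto_intros)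
      then show ?thesis using c \<epsilon> by (intro tendstoD) auto
    qed
    then have "eventually (\<lambda>h. 0 < h \<and> dist (F 0 (e + h)) (F 0 e) < c * \<epsilon> / 4) (at_right 0)"
      by (intro eventually_conj eventually_at_right_less)
    then obtain l where l: "0 < l" "dist (F 0 (e + l)) (F 0 e) < c * \<epsilon> / 4"
      using eventually_happens'[OF trivial_limit_at_right_real] by blast
    \<comment> \<open>Beyond \<open>b\<close> the exponential is at most 1/2. A transform above
      \<open>1 - \<epsilon> / 4\<close> at \<open>l\<close> therefore forces mass above
      \<open>1 - \<epsilon> / 2\<close> on \<open>(- 1, b]\<close>. The left end lies below 0 so
      that the atom at 0 is counted.\<close>
    define b where "b = ln 2 / l"
    have b: "0 < b" "exp (- l * b) = 1 / 2" using l by (auto simp: b_def exp_minus)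
    show "\<exists>a b. a < b \<and> (\<forall>n. 1 - \<epsilon> < measure (\<mu> n) {a<..b})"
    proof (rule exI[of _ "- 1"], rule exI[of _ b], intro conjI allI)
      show "- 1 < b" using b by simp
      fix N
      interpret real_distribution "\<mu> N" by (rule rd)
      have int: "integrable (\<mu> N) (g l)"
        by (rule integrable_const_bound[where B = 1]) (use l in \<open>auto simp: g_def\<close>)
      have int2: "integrable (\<mu> N) (\<lambda>x. indicator {- 1<..b} x / 2 :: real)"
        by (rule integrable_const_bound[where B = 1]) (auto simp: indicator_def)
      have "(\<integral>x. g l x \<partial>\<mu> N) \<le> (\<integral>x. 1 / 2 + indicator {- 1<..b} x / 2 \<partial>\<mu> N)"
      proof (rule integral_mono_AE[OF int])
        show "AE x in \<mu> N. g l x \<le> 1 / 2 + indicator {- 1<..b} x / 2"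
          using ae
        proof eventually_elim
          case (elim x)
          show ?case
          proof (cases "x \<le> b")
            case False
            then have "exp (- l * x) \<le> 1 / 2" unfolding b(2)[symmetric] using l by simp
            then show ?thesis using False elim by (auto simp: g_def)
          qed (use elim l in \<open>auto simp: g_def\<close>)
        qed
      qed (intro Bochner_Integration.integrable_add int2 integrable_const)
      also have "\<dots> = 1 / 2 + measure (\<mu> N) {- 1<..b} / 2"
        by (subst Bochner_Integration.integral_add[OF _ int2]) (auto simp: prob_space[simplified])
      finally have "F 0 (s l N) / c \<le> 1 / 2 + measure (\<mu> N) {- 1<..b} / 2"
        using g_int[of l N] l by simp
      moreover have "F 0 (e + l) / c \<le> F 0 (s l N) / c"
        using l c s_pos[of l N] s_le[of l N] by (intro divide_right_mono cm_sequence_antimono[OF F]) auto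
      moreover have "1 - \<epsilon> / 4 < F 0 (e + l) / c"
      proof -
        have "c - c * \<epsilon> / 4 < F 0 (e + l)"
          using l(2) unfolding dist_real_def c_def by argo
        then have "(1 - \<epsilon> / 4) * c < F 0 (e + l)" by (simp add: algebra_simps)
        then show ?thesis using c by (simp only: pos_less_divide_eq)
      qed
      ultimately show "1 - \<epsilon> < measure (\<mu> N) {- 1<..b}" using \<epsilon> by linarith
    qed
  qed
  obtain r M where r: "strict_mono (r :: nat \<Rightarrow> nat)" and M: "real_distribution M"
    and conv: "weak_conv_m (\<mu> \<circ> id \<circ> r) M"
    using tight_imp_convergent_subsubsequence[OF tight strict_mono_id] by blast
  have rd': "real_distribution ((\<mu> \<circ> id \<circ> r) n)" for n using rd by simp
  interpret M: real_distribution M by (rule M)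
  have M_neg: "emeasure M {..<0} = 0"
  proof -
    \<comment> \<open>A bounded continuous function that is positive exactly on the negative axis:
      its integrals vanish along the sequence, hence in the limit.\<close>
    define f :: "real \<Rightarrow> real" where "f x = min 1 (max 0 (- x))" for x
    have cf: "isCont f x" for x unfolding f_def by (intro continuous_intros)
    have bf: "norm (f x) \<le> 1" for x by (auto simp: f_def)
    have [measurable]: "f \<in> borel_measurable borel" unfolding f_def by measurable
    have "(\<lambda>n. integral\<^sup>L ((\<mu> \<circ> id \<circ> r) n) f) \<longlonglongrightarrow> integral\<^sup>L M f"
      by (rule weak_conv_imp_integral_bdd_continuous_conv[OF rd' M conv cf bf])
    moreover have "integral\<^sup>L ((\<mu> \<circ> id \<circ> r) n) f = 0" for n
    proof (rule integral_eq_zero_AE)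
      have "AE x in \<mu> (r n). f x = 0"
        using ae[of "r n"] by eventually_elim (simp add: f_def)
      then show "AE x in (\<mu> \<circ> id \<circ> r) n. f x = 0" unfolding comp_def id_def .
    qed
    ultimately have "integral\<^sup>L M f = 0" by (simp add: LIMSEQ_const_iff)
    moreover have "integrable M f"
      by (rule M.integrable_const_bound[where B = 1])
        (use bf in auto)
    ultimately have "AE x in M. f x = 0"
      by (subst (asm) integral_nonneg_eq_0_iff_AE) (auto simp: f_def)
    then have "AE x in M. \<not> x < 0"
      by eventually_elim (auto simp: f_def min_def max_def split: if_splits)
    then show ?thesis by (subst (asm) AE_iff_measurable[where N = "{..<0}"]) auto
  qed
  have LT: "(\<integral>\<^sup>+x. ennreal (exp (- l * x)) \<partial>M) = ennreal (F 0 (e + l) / c)" if l: "0 \<le> l" for l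
  proof -
    have cg: "isCont (g l) x" for x unfolding g_def by (intro continuous_intros)
    have bg: "norm (g l x) \<le> 1" for x using l by (auto simp: g_def)
    have "(\<lambda>n. integral\<^sup>L ((\<mu> \<circ> id \<circ> r) n) (g l)) \<longlonglongrightarrow> integral\<^sup>L M (g l)"
      by (rule weak_conv_imp_integral_bdd_continuous_conv[OF rd' M conv cg bg])
    moreover have "(\<lambda>n. integral\<^sup>L ((\<mu> \<circ> id \<circ> r) n) (g l)) \<longlonglongrightarrow> F 0 (e + l) / c"
      using LIMSEQ_subseq_LIMSEQ[OF F_lim[OF l] r] by (simp add: g_int[OF l] comp_def)
    ultimately have "integral\<^sup>L M (g l) = F 0 (e + l) / c" by (rule LIMSEQ_unique)
    moreover have "integrable M (g l)"
      by (rule M.integrable_const_bound[where B = 1]) (use bg in auto)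
    ultimately have "(\<integral>\<^sup>+x. ennreal (g l x) \<partial>M) = ennreal (F 0 (e + l) / c)"
      by (subst nn_integral_eq_integral) (auto simp: g_def)
    moreover have "(\<integral>\<^sup>+x. ennreal (g l x) \<partial>M) = (\<integral>\<^sup>+x. ennreal (exp (- l * x)) \<partial>M)"
    proof (rule nn_integral_cong_AE)
      show "AE x in M. ennreal (g l x) = ennreal (exp (- l * x))"
        using AE_nonneg_of_null[OF M.events_eq_borel M_neg] by eventually_elim (simp add: g_def)
    qed
    ultimately show ?thesis by simp
  qed
  show ?thesis
  proof (intro exI[of _ "density M (\<lambda>_. ennreal c)"] conjI allI impI)
    show "emeasure (density M (\<lambda>_. ennreal c)) {..<0} = 0"
      by (subst emeasure_density) (auto simp: nn_integral_cmult_indicator M_neg)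
    fix l :: real assume l: "0 \<le> l"
    have "(\<integral>\<^sup>+x. ennreal (exp (- l * x)) \<partial>density M (\<lambda>_. ennreal c)) = ennreal c * ennreal (F 0 (e + l) / c)"
      by (subst nn_integral_density) (auto simp: nn_integral_cmult LT[OF l, simplified])
    also have "\<dots> = ennreal (F 0 (e + l))"
      using c F e l by (subst ennreal_mult[symmetric]) (auto simp: cm_sequence_def)
    finally show "(\<integral>\<^sup>+x. ennreal (exp (- l * x)) \<partial>density M (\<lambda>_. ennreal c)) = ennreal (F 0 (e + l))" .
  qed simp
qed

text \<open>The measure for the shift \<open>e\<close> should be \<open>exp (- e * x)\<close> times
  the one sought. Uniqueness shows that removing the tilt gives the same \<open>m'\<close> for every
  \<open>e \<le> 1\<close>, and a given \<open>q\<close> is then reached from some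
  \<open>e \<le> q\<close>. The measure \<open>m'\<close> may have infinite mass.\<close>

theorem bernstein:
  assumes cm: "\<And>n. cm_upto n f"
  obtains m :: "real measure" where "sets m = sets borel" "emeasure m {..<0} = 0"
    "\<And>q. 0 < q \<Longrightarrow> (\<integral>\<^sup>+x. ennreal (exp (- q * x)) \<partial>m) = ennreal (f q)"
proof -
  obtain F where F: "cm_sequence F" "F 0 = f" using cm_sequence_exists[OF cm] .
  define m where "m e = (SOME m::real measure. sets m = sets borel \<and> emeasure m {..<0} = 0 \<and>
    (\<forall>l\<ge>0. (\<integral>\<^sup>+x. ennreal (exp (- l * x)) \<partial>m) = ennreal (F 0 (e + l))))" for e
  have m: "sets (m e) = sets borel" "emeasure (m e) {..<0} = 0"
    "\<And>l. 0 \<le> l \<Longrightarrow> (\<integral>\<^sup>+x. ennreal (exp (- l * x)) \<partial>m e) = ennreal (f (e + l))" if "0 < e" for e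
    using someI_ex[OF bernstein_shifted[OF F(1) that]] F(2) unfolding m_def by auto
  define m' where "m' = density (m 1) (\<lambda>x. ennreal (exp x))"
  note [measurable_cong] = m(1)[OF zero_less_one]
  have m'_eq: "m' = density (m e) (\<lambda>x. ennreal (exp (e * x)))" if e: "0 < e" "e \<le> 1" for e
  proof -
    note [measurable_cong] = m(1)[OF e(1)]
    \<comment> \<open>Both sides have the transform \<open>f (1 + q)\<close>.\<close>
    have "m 1 = density (m e) (\<lambda>x. ennreal (exp (- (1 - e) * x)))"
    proof (rule laplace_unique)
      show "emeasure (density (m e) (\<lambda>x. ennreal (exp (- (1 - e) * x)))) {..<0} = 0"
        using m(2)[OF e(1)]
        AE_nonneg_of_null[OF m(1,2)[OF e(1)]]
        by (subst emeasure_density) (auto simp: nn_integral_0_iff_AE elim!: eventually_mono)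
      fix q :: real assume q: "0 < q"
      have "(\<integral>\<^sup>+x. ennreal (exp (- q * x)) \<partial>density (m e) (\<lambda>x. ennreal (exp (- (1 - e) * x)))) =
          (\<integral>\<^sup>+x. ennreal (exp (- (q + 1 - e) * x)) \<partial>m e)"
        by (subst nn_integral_density)
          (auto intro!: nn_integral_cong simp: exp_add[symmetric] algebra_simps simp flip: ennreal_mult)
      then show "(\<integral>\<^sup>+x. ennreal (exp (- q * x)) \<partial>m 1) =
        (\<integral>\<^sup>+x. ennreal (exp (- q * x)) \<partial>density (m e) (\<lambda>x. ennreal (exp (- (1 - e) * x))))"
        using m(3)[of 1 q] m(3)[OF e(1), of "q + 1 - e"] q e by (simp add: algebra_simps)
      show "(\<integral>\<^sup>+x. ennreal (exp (- q * x)) \<partial>m 1) < \<infinity>" using m(3)[of 1 q] q by simp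
    qed (use m e in auto)
    then have "m' = density (density (m e) (\<lambda>x. ennreal (exp (- (1 - e) * x)))) (\<lambda>x. ennreal (exp x))"
      by (simp add: m'_def)
    also have "\<dots> = density (m e) (\<lambda>x. ennreal (exp (e * x)))"
      by (subst density_density_eq)
        (auto intro!: density_cong simp: exp_add[symmetric] algebra_simps simp flip: ennreal_mult)
    finally show ?thesis .
  qed
  show thesis
  proof (rule that[of m'])
    show "emeasure m' {..<0} = 0" unfolding m'_def
      using AE_nonneg_of_null[OF m(1,2)[of 1]]
      by (subst emeasure_density) (auto simp: nn_integral_0_iff_AE elim!: eventually_mono)
    fix q :: real assume q: "0 < q"
    \<comment> \<open>\<open>e \<le> 1\<close> is the range of \<open>m'_eq\<close>, and
      \<open>e \<le> q\<close> makes the remaining rate \<open>q - e\<close> nonnegative.\<close>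
    define e where "e = min q 1"
    have e: "0 < e" "e \<le> 1" "e \<le> q" using q by (auto simp: e_def)
    note [measurable_cong] = m(1)[OF e(1)]
    have "(\<integral>\<^sup>+x. ennreal (exp (- q * x)) \<partial>m') = (\<integral>\<^sup>+x. ennreal (exp (- (q - e) * x)) \<partial>m e)"
      unfolding m'_eq[OF e(1,2)]
      by (subst nn_integral_density)
        (auto intro!: nn_integral_cong simp: exp_add[symmetric] algebra_simps simp flip: ennreal_mult)
    then show "(\<integral>\<^sup>+x. ennreal (exp (- q * x)) \<partial>m') = ennreal (f q)"
      using m(3)[OF e(1), of "q - e"] e by simp
  qed (simp add: m'_def m(1))
qed

section \<open>The Levy--Khintchine representation\<close>

text \<open>For \<open>\<bar>h\<bar> < q / 2\<close> both rates stay above \<open>q / 2\<close>, so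
  a single function dominates all difference quotients at \<open>q\<close>. The inequality behind it
  is \<open>1 - exp (- y) \<le> y\<close>.\<close>

lemma exp_quotient_bound:
  fixes x q h :: real
  assumes "0 \<le> x" "0 < q" "\<bar>h\<bar> < q / 2" "h \<noteq> 0"
  shows "\<bar>(exp (- q * x) - exp (- (q + h) * x)) / h\<bar> \<le> x * exp (- (q / 2) * x)"
proof -
  have *: "\<bar>exp (- a * x) - exp (- b * x)\<bar> \<le> (b - a) * x * exp (- a * x)" if "a \<le> b" for a b :: real
  proof -
    have "1 + - ((b - a) * x) \<le> exp (- ((b - a) * x))" by (rule exp_ge_add_one_self)
    then have "1 - exp (- ((b - a) * x)) \<le> (b - a) * x" by linarith
    then have "(1 - exp (- ((b - a) * x))) * exp (- a * x) \<le> (b - a) * x * exp (- a * x)"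
      by (intro mult_right_mono) auto
    moreover have "exp (- b * x) = exp (- ((b - a) * x)) * exp (- a * x)"
      by (simp add: exp_add[symmetric] algebra_simps)
    moreover have "exp (- b * x) \<le> exp (- a * x)" using that assms by (simp add: mult_right_mono)
    ultimately show ?thesis by (simp add: algebra_simps)
  qed
  define a b where "a = min q (q + h)" and "b = max q (q + h)"
  have ab: "a \<le> b" "b - a = \<bar>h\<bar>" "q / 2 \<le> a" using assms by (auto simp: a_def b_def min_def max_def)
  have "\<bar>(exp (- q * x) - exp (- (q + h) * x)) / h\<bar> = \<bar>exp (- a * x) - exp (- b * x)\<bar> / \<bar>h\<bar>"
  proof (cases "0 \<le> h")
    case True
    then have "a = q" "b = q + h" by (auto simp: a_def b_def)
    then show ?thesis by (simp add: abs_divide)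
  next
    case False
    then have "a = q + h" "b = q" by (auto simp: a_def b_def)
    then show ?thesis by (simp add: abs_divide abs_minus_commute)
  qed
  also have "\<dots> \<le> (b - a) * x * exp (- a * x) / \<bar>h\<bar>"
    using *[OF ab(1)] by (intro divide_right_mono) auto
  also have "\<dots> = x * exp (- a * x)" using assms ab by simp
  also have "\<dots> \<le> x * exp (- (q / 2) * x)"
    using mult_right_mono[OF ab(3), of x] assms by (intro mult_left_mono) auto
  finally show ?thesis .
qed

text \<open>Differentiation under the integral sign. \<open>F\<close> enters only through its
  differences, because \<open>exp (- q * x)\<close> itself need not be integrable against a Levy
  measure. The weight \<open>w\<close> allows higher powers of \<open>x\<close>.\<close>

lemma laplace_difference_deriv:
  fixes M :: "real measure" and w F :: "real \<Rightarrow> real"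
  assumes sets[measurable_cong]: "sets M = sets borel" and nn: "AE x in M. 0 \<le> x"
    and w[measurable]: "w \<in> borel_measurable borel"
    and int: "\<And>q. 0 < q \<Longrightarrow> integrable M (\<lambda>x. w x * (x * exp (- q * x)))"
    and diff: "\<And>p q. 0 < p \<Longrightarrow> 0 < q \<Longrightarrow> F p - F q = (\<integral>x. w x * (exp (- q * x) - exp (- p * x)) \<partial>M)"
    and q: "0 < q"
  shows "(F has_real_derivative (\<integral>x. w x * (x * exp (- q * x)) \<partial>M)) (at q)"
  unfolding has_field_derivative_iff
proof (subst tendsto_at_iff_sequentially, intro allI impI)
  let ?D = "\<integral>x. w x * (x * exp (- q * x)) \<partial>M"
  have "((\<lambda>h. (F (q + h) - F q) / h) \<longlongrightarrow> ?D) (at 0)"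
  proof (subst tendsto_at_iff_sequentially, intro allI impI)
    fix X :: "nat \<Rightarrow> real" assume X: "\<forall>i. X i \<in> UNIV - {0}" "X \<longlonglongrightarrow> 0"
    \<comment> \<open>The value 0 for the finitely many large \<open>X n\<close> makes the bound by
      the rate \<open>q / 2\<close> hold for every \<open>n\<close>.\<close>
    define s where "s n x = (if \<bar>X n\<bar> < q / 2 then w x * ((exp (- q * x) - exp (- (q + X n) * x)) / X n) else 0)" for n x
    have ev: "eventually (\<lambda>n. \<bar>X n\<bar> < q / 2) sequentially"
      using tendstoD[OF X(2), of "q / 2"] q by simp
    have "(\<lambda>n. \<integral>x. s n x \<partial>M) \<longlonglongrightarrow> ?D"
    proof (rule integral_dominated_convergence[where w = "\<lambda>x. \<bar>w x * (x * exp (- (q / 2) * x))\<bar>"])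
      show "integrable M (\<lambda>x. \<bar>w x * (x * exp (- (q / 2) * x))\<bar>)"
        using int[of "q / 2"] q by (intro integrable_abs) simp
      show "AE x in M. (\<lambda>n. s n x) \<longlonglongrightarrow> w x * (x * exp (- q * x))"
      proof (rule AE_I2)
        fix x
        have "((\<lambda>p. - exp (- p * x)) has_real_derivative x * exp (- q * x)) (at q)"
          by (auto intro!: derivative_eq_intros)
        then have "((\<lambda>h. (exp (- q * x) - exp (- (q + h) * x)) / h) \<longlongrightarrow> x * exp (- q * x)) (at 0)"
          by (simp add: DERIV_def algebra_simps)
        then have "(\<lambda>n. (exp (- q * x) - exp (- (q + X n) * x)) / X n) \<longlonglongrightarrow> x * exp (- q * x)"
          using X by (subst (asm) tendsto_at_iff_sequentially) (auto simp: comp_def)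
        then have "(\<lambda>n. w x * ((exp (- q * x) - exp (- (q + X n) * x)) / X n)) \<longlonglongrightarrow> w x * (x * exp (- q * x))"
          by (rule tendsto_mult_left)
        then show "(\<lambda>n. s n x) \<longlonglongrightarrow> w x * (x * exp (- q * x))"
          by (rule Lim_transform_eventually) (use ev in \<open>eventually_elim, simp add: s_def\<close>)
      qed
      fix n
      show "AE x in M. norm (s n x) \<le> \<bar>w x * (x * exp (- (q / 2) * x))\<bar>"
        using nn
      proof eventually_elim
        case (elim x)
        show ?case
        proof (cases "\<bar>X n\<bar> < q / 2")
          case True
          have "\<bar>w x\<bar> * \<bar>(exp (- q * x) - exp (- (q + X n) * x)) / X n\<bar> \<le> \<bar>w x\<bar> * (x * exp (- (q / 2) * x))"
            using exp_quotient_bound[OF elim q True] X(1) by (intro mult_left_mono) auto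
          then show ?thesis using True elim unfolding s_def by (simp only: if_True real_norm_def abs_mult) simp
        qed (simp add: s_def)
      qed
    qed (auto simp: s_def[abs_def])
    moreover have "eventually (\<lambda>n. (\<integral>x. s n x \<partial>M) = (F (q + X n) - F q) / X n) sequentially"
      using ev
    proof eventually_elim
      case (elim n)
      have "(\<integral>x. s n x \<partial>M) = (\<integral>x. w x * (exp (- q * x) - exp (- (q + X n) * x)) / X n \<partial>M)"
        using elim by (simp add: s_def[abs_def])
      also have "\<dots> = (F (q + X n) - F q) / X n"
        using diff[of "q + X n" q] q elim by (subst integral_divide_zero) auto
      finally show ?case .
    qed
    ultimately show "((\<lambda>h. (F (q + h) - F q) / h) \<circ> X) \<longlonglongrightarrow> ?D"
      unfolding comp_def by (rule Lim_transform_eventually)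
  qed
  then have "((\<lambda>y. (F y - F q) / (y - q)) \<longlongrightarrow> ?D) (at q)"
    by (simp add: DERIV_def[symmetric] has_field_derivative_iff)
  then show "\<And>X. \<forall>i. X i \<in> UNIV - {q} \<Longrightarrow> X \<longlonglongrightarrow> q \<Longrightarrow> ((\<lambda>y. (F y - F q) / (y - q)) \<circ> X) \<longlonglongrightarrow> ?D"
    by (subst (asm) tendsto_at_iff_sequentially) auto
qed

lemma exp_mult_le: "0 \<le> x \<Longrightarrow> 0 < q \<Longrightarrow> x * exp (- q * x) \<le> 1 / (q::real)"
proof -
  assume "0 \<le> x" "0 < q"
  have "q * x \<le> exp (q * x)" using exp_ge_add_one_self[of "q * x"] by linarith
  then have "q * x * exp (- (q * x)) \<le> exp (q * x) * exp (- (q * x))" by (intro mult_right_mono) auto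
  then show ?thesis using \<open>0 < q\<close> by (simp add: exp_add[symmetric] field_simps)
qed

text \<open>By Markov's inequality \<open>f\<close> exceeds \<open>1 / n\<close> only on a set of
  finite measure, and positivity of \<open>f\<close> makes these sets exhaust the space.\<close>

lemma sigma_finite_of_nn_integral:
  assumes [measurable]: "f \<in> borel_measurable M" and pos: "\<And>x. x \<in> space M \<Longrightarrow> 0 < f x"
    and fin: "(\<integral>\<^sup>+x. ennreal (f x) \<partial>M) < \<infinity>"
  shows "sigma_finite_measure M"
proof
  define A where "A n = {x \<in> space M. 1 \<le> ennreal (real n) * ennreal (f x)}" for n :: nat
  have "emeasure M (A n) \<noteq> \<infinity>" for n
  proof -
    have "emeasure M (A n) \<le> ennreal (real n) * (\<integral>\<^sup>+x. ennreal (f x) * indicator (space M) x \<partial>M)"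
      unfolding A_def by (rule nn_integral_Markov_inequality) auto
    also have "(\<integral>\<^sup>+x. ennreal (f x) * indicator (space M) x \<partial>M) = (\<integral>\<^sup>+x. ennreal (f x) \<partial>M)"
      by (rule nn_integral_cong) simp
    also have "ennreal (real n) * \<dots> < \<infinity>" using fin by (simp add: ennreal_mult_less_top)
    finally show ?thesis by simp
  qed
  moreover have "space M \<subseteq> (\<Union>n. A n)"
  proof
    fix x assume x: "x \<in> space M"
    obtain n where "1 / f x \<le> real n" using real_arch_simple by blast
    then have "1 \<le> real n * f x" using pos[OF x] by (simp add: field_simps)
    then have "x \<in> A n" using x pos[OF x] by (simp add: A_def flip: ennreal_mult)
    then show "x \<in> (\<Union>n. A n)" by auto
  qed
  ultimately show "\<exists>A. countable A \<and> A \<subseteq> sets M \<and> \<Union> A = space M \<and> (\<forall>a\<in>A. emeasure M a \<noteq> \<infinity>)"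
    by (intro exI[of _ "range A"]) (auto simp: A_def)
qed

section \<open>Integrability against a Levy measure\<close>

lemma levy_AE_pos: assumes "levy_measure \<mu>" shows "AE x in \<mu>. 0 < x"
proof -
  have "sets \<mu> = sets borel" "emeasure \<mu> {..0} = 0" using assms by (auto simp: levy_measure_def)
  then show ?thesis
    by (subst AE_iff_measurable[where N = "{..0}"]) (use sets_eq_imp_space_eq[of \<mu> borel] in \<open>auto simp: not_less\<close>)
qed

lemma levy_sets: "levy_measure \<mu> \<Longrightarrow> sets \<mu> = sets borel"
  by (simp add: levy_measure_def)

lemma levy_set_integral:
  fixes f :: "real \<Rightarrow> real"
  assumes L: "levy_measure \<mu>" and [measurable]: "f \<in> borel_measurable borel"
  shows "(LINT x:{0<..}|\<mu>. f x) = (LINT x|\<mu>. f x)"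
proof -
  note [measurable_cong] = levy_sets[OF L]
  show ?thesis unfolding set_lebesgue_integral_def
    by (rule integral_cong_AE) (use levy_AE_pos[OF L] in \<open>auto elim!: eventually_mono\<close>)
qed

lemma levy_integrable_min: assumes L: "levy_measure \<mu>" shows "integrable \<mu> (\<lambda>x. min 1 x)"
proof (rule integrableI_bounded)
  note [measurable_cong] = levy_sets[OF L]
  show "(\<lambda>x. min 1 x) \<in> borel_measurable \<mu>" by measurable
  have "(\<integral>\<^sup>+x. ennreal (norm (min 1 x)) \<partial>\<mu>) = (\<integral>\<^sup>+x\<in>{0<..}. ennreal (min 1 x) \<partial>\<mu>)"
    by (rule nn_integral_cong_AE) (use levy_AE_pos[OF L] in eventually_elim, auto)
  then show "(\<integral>\<^sup>+x. ennreal (norm (min 1 x)) \<partial>\<mu>) < \<infinity>" using L by (simp add: levy_measure_def)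
qed

lemma levy_integrable_bound:
  fixes f :: "real \<Rightarrow> real"
  assumes L: "levy_measure \<mu>" and [measurable]: "f \<in> borel_measurable borel"
    and bd: "\<And>x. 0 < x \<Longrightarrow> \<bar>f x\<bar> \<le> C * min 1 x"
  shows "integrable \<mu> f"
proof (rule Bochner_Integration.integrable_bound)
  note [measurable_cong] = levy_sets[OF L]
  show "integrable \<mu> (\<lambda>x. C * min 1 x)" using levy_integrable_min[OF L] by simp
  show "f \<in> borel_measurable \<mu>" by simp
  show "AE x in \<mu>. norm (f x) \<le> norm (C * min 1 x)"
    using levy_AE_pos[OF L]
  proof eventually_elim
    case (elim x) show ?case using bd[OF elim] by simp
  qed
qed

text \<open>One bound for all rates up to \<open>B\<close>, as domination along a convergent
  sequence of rates requires: \<open>B * x\<close> serves for small \<open>x\<close>, and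
  \<open>B \<ge> 1\<close> for large \<open>x\<close>.\<close>

lemma one_minus_exp_le_min:
  assumes "0 < (x::real)" "0 \<le> q" "q \<le> B" "1 \<le> B"
  shows "\<bar>1 - exp (- q * x)\<bar> \<le> B * min 1 x"
proof -
  have "1 + (- q * x) \<le> exp (- q * x)" by (rule exp_ge_add_one_self)
  moreover have "exp (- q * x) \<le> 1" using assms by simp
  moreover have "q * x \<le> B * x" using assms by simp
  moreover have "0 < exp (- q * x)" by simp
  ultimately have "1 - exp (- q * x) \<le> B * x" "1 - exp (- q * x) \<le> B" "0 \<le> 1 - exp (- q * x)"
    using assms by linarith+
  then show ?thesis by (auto simp: min_def)
qed

lemma levy_integrable_one_minus_exp:
  assumes L: "levy_measure \<mu>" and "0 \<le> q" shows "integrable \<mu> (\<lambda>x. 1 - exp (- q * x))"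
  by (rule levy_integrable_bound[OF L, of _ "max 1 q"]) (use one_minus_exp_le_min assms in auto)

lemma levy_integrable_exp:
  assumes L: "levy_measure \<mu>" and q: "0 < q" shows "integrable \<mu> (\<lambda>x. x * exp (- q * x))"
proof (rule levy_integrable_bound[OF L, of _ "max 1 (1 / q)"])
  fix x :: real assume x: "0 < x"
  have "x * exp (- q * x) \<le> x * 1" using x q by (intro mult_left_mono) auto
  moreover have "x * exp (- q * x) \<le> 1 / q" using exp_mult_le[of x q] x q by simp
  moreover have "1 * x \<le> max 1 (1 / q) * x" using x by (intro mult_right_mono) auto
  moreover have "0 \<le> x * exp (- q * x)" using x by simp
  ultimately have "\<bar>x * exp (- q * x)\<bar> \<le> max 1 (1 / q) * x" "\<bar>x * exp (- q * x)\<bar> \<le> max 1 (1 / q) * 1"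
    by auto
  then show "\<bar>x * exp (- q * x)\<bar> \<le> max 1 (1 / q) * min 1 x"
    unfolding min_def by presburger
qed simp

text \<open>Each further factor \<open>x\<close> is absorbed by half of the exponential, as
  \<open>x * exp (- (q / 2) * x) \<le> 2 / q\<close>.\<close>

lemma levy_integrable_power_exp:
  assumes L: "levy_measure \<mu>" and q: "0 < q" shows "integrable \<mu> (\<lambda>x. x ^ Suc n * exp (- q * x))"
  using q
proof (induction n arbitrary: q)
  case 0 then show ?case using levy_integrable_exp[OF L] by simp
next
  case (Suc n)
  note [measurable_cong] = levy_sets[OF L]
  show ?case
  proof (rule Bochner_Integration.integrable_bound)
    show "integrable \<mu> (\<lambda>x. (1 / (q / 2)) * (x ^ Suc n * exp (- (q / 2) * x)))"
      using Suc.IH[of "q / 2"] Suc.prems by simp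
    show "(\<lambda>x. x ^ Suc (Suc n) * exp (- q * x)) \<in> borel_measurable \<mu>" by measurable
    show "AE x in \<mu>. norm (x ^ Suc (Suc n) * exp (- q * x)) \<le> norm ((1 / (q / 2)) * (x ^ Suc n * exp (- (q / 2) * x)))"
      using levy_AE_pos[OF L]
    proof eventually_elim
      case (elim x)
      have "x ^ Suc (Suc n) * exp (- q * x) = (x * exp (- (q / 2) * x)) * (x ^ Suc n * exp (- (q / 2) * x))"
        by (simp add: exp_add[symmetric] field_simps)
      also have "\<dots> \<le> (1 / (q / 2)) * (x ^ Suc n * exp (- (q / 2) * x))"
        using exp_mult_le[of x "q / 2"] elim Suc.prems by (intro mult_right_mono) auto
      finally show ?case using elim Suc.prems by simp
    qed
  qed
qed

section \<open>Regularity of functions with a Levy-Khintchine representation\<close>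

lemma levy_khintchine_eq:
  assumes "levy_khintchine \<psi> k d \<mu>" "0 \<le> q"
  shows "\<psi> q = k + d * q + (\<integral>x. 1 - exp (- q * x) \<partial>\<mu>)"
  using assms levy_set_integral[of \<mu> "\<lambda>x. 1 - exp (- q * x)"] by (simp add: levy_khintchine_def)

lemma levy_khintchine_deriv:
  assumes LK: "levy_khintchine \<psi> k d \<mu>" and q: "0 < q"
  shows "(\<psi> has_real_derivative d + (\<integral>x. x * exp (- q * x) \<partial>\<mu>)) (at q)"
proof -
  have L: "levy_measure \<mu>" using LK by (simp add: levy_khintchine_def)
  have nn: "AE x in \<mu>. 0 \<le> x" using levy_AE_pos[OF L] by eventually_elim simp
  have "((\<lambda>p. \<psi> p - d * p) has_real_derivative (\<integral>x. 1 * (x * exp (- q * x)) \<partial>\<mu>)) (at q)"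
  proof (rule laplace_difference_deriv[OF levy_sets[OF L] nn _ _ _ q])
    fix p q :: real assume "0 < p" "0 < q"
    then show "\<psi> p - d * p - (\<psi> q - d * q) = (\<integral>x. 1 * (exp (- q * x) - exp (- p * x)) \<partial>\<mu>)"
      using Bochner_Integration.integral_diff[OF levy_integrable_one_minus_exp[OF L, of p] levy_integrable_one_minus_exp[OF L, of q]]
      by (simp add: levy_khintchine_eq[OF LK])
  qed (use levy_integrable_exp[OF L] in auto)
  from DERIV_add[OF this DERIV_cmult[OF DERIV_ident, of d]] show ?thesis by (simp add: add.commute)
qed

text \<open>This is the sequence of the derivative of the exponent: member \<open>n\<close> is
  \<open>(-1)^n\<close> times its derivative of order \<open>n + 1\<close>, and the drift survives
  only in the first of them. So the derivative of a Bernstein function is completely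
  monotone.\<close>

lemma levy_cm_sequence:
  assumes L: "levy_measure \<mu>" and d: "0 \<le> d"
  shows "cm_sequence (\<lambda>n q. (if n = 0 then d else 0) + (\<integral>x. x ^ Suc n * exp (- q * x) \<partial>\<mu>))"
  unfolding cm_sequence_def
proof (intro allI impI conjI)
  fix n and q :: real assume q: "0 < q"
  have nn: "AE x in \<mu>. 0 \<le> x" using levy_AE_pos[OF L] by eventually_elim simp
  have "0 \<le> (\<integral>x. x ^ Suc n * exp (- q * x) \<partial>\<mu>)"
    by (rule integral_nonneg_AE) (use nn in eventually_elim, simp)
  then show "0 \<le> (if n = 0 then d else 0) + (\<integral>x. x ^ Suc n * exp (- q * x) \<partial>\<mu>)" using d by simp
  have "((\<lambda>q. - (\<integral>x. x ^ Suc n * exp (- q * x) \<partial>\<mu>)) has_real_derivative (\<integral>x. x ^ Suc n * (x * exp (- q * x)) \<partial>\<mu>)) (at q)"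
  proof (rule laplace_difference_deriv[OF levy_sets[OF L] nn _ _ _ q])
    fix p q :: real assume "0 < p" "0 < q"
    then show "- (\<integral>x. x ^ Suc n * exp (- p * x) \<partial>\<mu>) - - (\<integral>x. x ^ Suc n * exp (- q * x) \<partial>\<mu>) =
        (\<integral>x. x ^ Suc n * (exp (- q * x) - exp (- p * x)) \<partial>\<mu>)"
      using Bochner_Integration.integral_diff[OF levy_integrable_power_exp[OF L, of q n] levy_integrable_power_exp[OF L, of p n]]
      by (simp only: right_diff_distrib)
  next
    fix q :: real assume "0 < q"
    then show "integrable \<mu> (\<lambda>x. x ^ Suc n * (x * exp (- q * x)))"
      using levy_integrable_power_exp[OF L, of q "Suc n"] by (simp add: mult_ac)
  qed simp
  from DERIV_add[OF DERIV_const[of "if n = 0 then d else 0"] DERIV_minus[OF this]]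
  show "((\<lambda>q. (if n = 0 then d else 0) + (\<integral>x. x ^ Suc n * exp (- q * x) \<partial>\<mu>)) has_real_derivative
      - ((if Suc n = 0 then d else 0) + (\<integral>x. x ^ Suc (Suc n) * exp (- q * x) \<partial>\<mu>))) (at q)"
    by (simp add: mult_ac)
qed

text \<open>Differentiability covers only \<open>q > 0\<close>; the end point 0 is included here
  because \<open>primitive\<close> integrates from 0.\<close>

lemma levy_khintchine_continuous:
  assumes LK: "levy_khintchine \<psi> k d \<mu>"
  shows "continuous_on {0..} \<psi>"
proof -
  have L: "levy_measure \<mu>" using LK by (simp add: levy_khintchine_def)
  note [measurable_cong] = levy_sets[OF L]
  have "continuous_on {0..} (\<lambda>q. \<integral>x. 1 - exp (- q * x) \<partial>\<mu>)"
    unfolding continuous_on_sequentially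
  proof (intro allI impI ballI, elim conjE)
    fix X :: "nat \<Rightarrow> real" and a assume X: "\<forall>n. X n \<in> {0..}" "X \<longlonglongrightarrow> a" and a: "a \<in> {0..}"
    obtain B where B: "\<And>n. norm (X n) \<le> B" using X(2) convergent_imp_Bseq[of X] unfolding Bseq_def convergent_def by metis
    define C where "C = max 1 B"
    have C: "X n \<le> C" "1 \<le> C" for n using B[of n] by (auto simp: C_def)
    show "((\<lambda>q. \<integral>x. 1 - exp (- q * x) \<partial>\<mu>) \<circ> X) \<longlonglongrightarrow> (\<integral>x. 1 - exp (- a * x) \<partial>\<mu>)"
      unfolding comp_def
    proof (rule integral_dominated_convergence[where w = "\<lambda>x. C * min 1 x"])
      show "integrable \<mu> (\<lambda>x. C * min 1 x)" using levy_integrable_min[OF L] by simp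
      show "AE x in \<mu>. (\<lambda>n. 1 - exp (- X n * x)) \<longlonglongrightarrow> 1 - exp (- a * x)"
        by (intro AE_I2 tendsto_intros X)
      fix n show "AE x in \<mu>. norm (1 - exp (- X n * x)) \<le> C * min 1 x"
        using levy_AE_pos[OF L]
      proof eventually_elim
        case (elim x)
        then show ?case using one_minus_exp_le_min[OF elim _ C] X(1) by auto
      qed
    qed auto
  qed
  then have "continuous_on {0..} (\<lambda>q. k + d * q + (\<integral>x. 1 - exp (- q * x) \<partial>\<mu>))"
    by (intro continuous_intros)
  then show ?thesis
    by (rule continuous_on_cong[THEN iffD2, rotated 2]) (auto simp: levy_khintchine_eq[OF LK])
qed

lemma levy_khintchine_mono:
  assumes LK: "levy_khintchine \<psi> k d \<mu>" and pq: "0 \<le> p" "p \<le> q"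
  shows "\<psi> p \<le> \<psi> q"
proof -
  have L: "levy_measure \<mu>" and "0 \<le> d" using LK by (auto simp: levy_khintchine_def)
  have "(\<integral>x. 1 - exp (- p * x) \<partial>\<mu>) \<le> (\<integral>x. 1 - exp (- q * x) \<partial>\<mu>)"
    by (intro integral_mono_AE levy_integrable_one_minus_exp L)
      (use pq levy_AE_pos[OF L] in \<open>auto elim!: eventually_mono intro: mult_right_mono\<close>)
  moreover have "d * p \<le> d * q" using pq \<open>0 \<le> d\<close> by (intro mult_left_mono)
  ultimately show ?thesis using pq by (simp add: levy_khintchine_eq[OF LK])
qed

text \<open>Were the integral of the positive function \<open>1 - exp (- q * x)\<close> zero, the
  measure could not charge \<open>(0, \<infinity>)\<close>. This positivity makes the primitive
  strictly increasing, hence invertible.\<close>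

lemma levy_khintchine_pos:
  assumes LK: "levy_khintchine \<psi> k d \<mu>" and nz: "emeasure \<mu> {0<..} > 0" and q: "0 < q"
  shows "0 < \<psi> q"
proof -
  have L: "levy_measure \<mu>" and "0 \<le> d" "0 \<le> k" using LK by (auto simp: levy_khintchine_def)
  note [measurable_cong] = levy_sets[OF L]
  have nn: "AE x in \<mu>. 0 \<le> 1 - exp (- q * x)"
    using levy_AE_pos[OF L] by eventually_elim (use q in simp)
  have "(\<integral>x. 1 - exp (- q * x) \<partial>\<mu>) \<noteq> 0"
  proof
    assume "(\<integral>x. 1 - exp (- q * x) \<partial>\<mu>) = 0"
    then have "AE x in \<mu>. 1 - exp (- q * x) = 0"
      using integral_nonneg_eq_0_iff_AE[OF levy_integrable_one_minus_exp[OF L] nn] q by simp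
    then have "AE x in \<mu>. x \<notin> {0<..}" by eventually_elim (use q in simp)
    then have "emeasure \<mu> {0<..} = 0" by (subst (asm) AE_iff_measurable[where N = "{0<..}"]) (use sets_eq_imp_space_eq[OF levy_sets[OF L]] in auto)
    with nz show False by simp
  qed
  moreover have "0 \<le> (\<integral>x. 1 - exp (- q * x) \<partial>\<mu>)" using nn by (rule integral_nonneg_AE)
  ultimately show ?thesis using q \<open>0 \<le> d\<close> \<open>0 \<le> k\<close> by (simp add: levy_khintchine_eq[OF LK] add_nonneg_pos)
qed

lemma levy_sigma_finite: assumes L: "levy_measure \<mu>" shows "sigma_finite_measure \<mu>"
proof (rule sigma_finite_of_nn_integral)
  note [measurable_cong] = levy_sets[OF L]
  \<comment> \<open>Positivity is required at every point, hence the value 1 on the null set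
    \<open>{..0}\<close>.\<close>
  show "(\<lambda>x. if 0 < x then min 1 x else 1) \<in> borel_measurable \<mu>" by measurable
  have "(\<integral>\<^sup>+x. ennreal (if 0 < x then min 1 x else 1) \<partial>\<mu>) = (\<integral>\<^sup>+x\<in>{0<..}. ennreal (min 1 x) \<partial>\<mu>)"
    by (rule nn_integral_cong_AE) (use levy_AE_pos[OF L] in eventually_elim, auto)
  then show "(\<integral>\<^sup>+x. ennreal (if 0 < x then min 1 x else 1) \<partial>\<mu>) < \<infinity>" using L by (simp add: levy_measure_def)
qed auto

section \<open>The inverse of the primitive of a Laplace exponent\<close>

locale levy_exponent =
  fixes \<phi> :: "real \<Rightarrow> real" and \<kappa> c :: real and \<pi> :: "real measure"
  assumes LK: "levy_khintchine \<phi> \<kappa> c \<pi>" and nz: "emeasure \<pi> {0<..} > 0"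
begin

abbreviation "\<Phi> \<equiv> primitive \<phi>"
abbreviation "\<psi> \<equiv> primitive_inv \<phi>"

lemma phi_pos: "0 < q \<Longrightarrow> 0 < \<phi> q" by (rule levy_khintchine_pos[OF LK nz])
lemma phi_mono: "0 \<le> p \<Longrightarrow> p \<le> q \<Longrightarrow> \<phi> p \<le> \<phi> q" by (rule levy_khintchine_mono[OF LK])
lemma phi_cont: "continuous_on {0..} \<phi>" by (rule levy_khintchine_continuous[OF LK])

lemma phi_isCont: "0 < q \<Longrightarrow> isCont \<phi> q"
  using levy_khintchine_deriv[OF LK] DERIV_isCont by blast

lemma primitive_0: "\<Phi> 0 = 0" by (simp add: primitive_def)

lemma primitive_cont: "continuous_on {0..b} \<Phi>"
  unfolding primitive_def[abs_def]
  by (intro indefinite_integral_continuous_1 integrable_continuous_real continuous_on_subset[OF phi_cont]) auto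

lemma primitive_deriv: assumes "0 < q" shows "(\<Phi> has_real_derivative \<phi> q) (at q)"
proof -
  have "((\<lambda>x. integral {0..x} \<phi>) has_real_derivative \<phi> q) (at q within {0..q + 1})"
    by (rule integral_has_real_derivative[OF continuous_on_subset[OF phi_cont]]) (use assms in auto)
  moreover have "at q within {0..q + 1} = at q" using assms by (intro at_within_interior) auto
  ultimately show ?thesis by (simp add: primitive_def[abs_def])
qed

lemma primitive_less: assumes "0 \<le> p" "p < q" shows "\<Phi> p < \<Phi> q"
proof (rule DERIV_pos_imp_increasing_open[OF assms(2)])
  fix x assume "p < x"
  then show "\<exists>y. (\<Phi> has_real_derivative y) (at x) \<and> 0 < y"
    using assms by (intro exI[of _ "\<phi> x"]) (simp add: primitive_deriv phi_pos)
qed (use assms in \<open>auto intro: continuous_on_subset[OF primitive_cont[of q]]\<close>)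

lemma primitive_nonneg: "0 \<le> q \<Longrightarrow> 0 \<le> \<Phi> q"
  using primitive_less[of 0 q] primitive_0 by (cases "q = 0") auto

text \<open>By the mean value theorem on \<open>[1, q]\<close> and monotonicity of
  \<open>\<phi>\<close>. At least linear growth makes the primitive onto
  \<open>[0, \<infinity>)\<close>.\<close>

lemma primitive_lower: assumes "1 < q" shows "\<phi> 1 * (q - 1) \<le> \<Phi> q"
proof -
  obtain z where z: "1 < z" "z < q" "\<Phi> q - \<Phi> 1 = (q - 1) * \<phi> z"
    using MVT2[of 1 q \<Phi> \<phi>] primitive_deriv assms by auto
  moreover have "\<phi> 1 * (q - 1) \<le> \<phi> z * (q - 1)" using z assms by (intro mult_right_mono phi_mono) auto
  moreover have "(q - 1) * \<phi> z = \<phi> z * (q - 1)" by (rule mult.commute)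
  ultimately show ?thesis using primitive_nonneg[of 1] by linarith
qed

lemma primitive_surj: assumes "0 \<le> y" obtains q where "0 \<le> q" "\<Phi> q = y"
proof -
  \<comment> \<open>Chosen so that \<open>\<phi> 1 * (b - 1) = \<phi> 1 + y\<close>, which exceeds
    \<open>y\<close>.\<close>
  define b where "b = 2 + y / \<phi> 1"
  have b: "1 < b" using divide_nonneg_pos[OF assms phi_pos[of 1]] by (simp add: b_def)
  have "y \<le> \<phi> 1 * (b - 1)" using phi_pos[of 1] by (simp add: b_def field_simps)
  also have "\<dots> \<le> \<Phi> b" by (rule primitive_lower[OF b])
  finally have "\<exists>x\<ge>0. x \<le> b \<and> \<Phi> x = y"
    using assms b primitive_0 by (intro IVT' primitive_cont) auto
  then show thesis using that by auto
qed

lemma primitive_inj: "inj_on \<Phi> {0..}"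
  by (rule linorder_inj_onI') (metis atLeast_iff less_irrefl primitive_less)

lemma psi_primitive: "0 \<le> q \<Longrightarrow> \<psi> (\<Phi> q) = q"
  unfolding primitive_inv_def using primitive_inj by (intro inv_into_f_f) auto

lemma primitive_psi: "0 \<le> y \<Longrightarrow> \<Phi> (\<psi> y) = y"
  by (metis primitive_surj psi_primitive)

lemma psi_nonneg: "0 \<le> y \<Longrightarrow> 0 \<le> \<psi> y"
  by (metis primitive_surj psi_primitive)

lemma psi_0: "\<psi> 0 = 0" using psi_primitive[of 0] primitive_0 by simp

lemma psi_pos: "0 < y \<Longrightarrow> 0 < \<psi> y"
  using psi_nonneg[of y] primitive_psi[of y] primitive_0 by (cases "\<psi> y = 0") auto

lemma primitive_pos: "0 < q \<Longrightarrow> 0 < \<Phi> q" using primitive_less[of 0 q] primitive_0 by simp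

lemma psi_less: "0 \<le> y \<Longrightarrow> 0 \<le> q \<Longrightarrow> y < \<Phi> q \<Longrightarrow> \<psi> y < q"
  by (metis linorder_neqE_linordered_idom less_asym less_irrefl primitive_less primitive_psi)

lemma psi_isCont: assumes "0 < y" shows "isCont \<psi> y"
proof -
  have "isCont \<psi> (\<Phi> (\<psi> y))"
    by (rule isCont_inverse_function2[where a = "\<psi> y / 2" and b = "\<psi> y + 1"])
      (use psi_pos[OF assms] in \<open>auto intro!: psi_primitive DERIV_isCont[OF primitive_deriv]\<close>)
  then show ?thesis using assms by (simp add: primitive_psi)
qed

lemma psi_deriv: assumes "0 < y" shows "(\<psi> has_real_derivative 1 / \<phi> (\<psi> y)) (at y)"
proof -
  have "(\<psi> has_real_derivative inverse (\<phi> (\<psi> y))) (at y)"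
    by (rule DERIV_inverse_function[where a = 0 and b = "y + 1" and f = \<Phi>])
      (use assms psi_pos[OF assms] phi_pos[OF psi_pos[OF assms]] in \<open>auto intro!: primitive_deriv primitive_psi psi_isCont\<close>)
  then show ?thesis by (simp add: divide_inverse)
qed

text \<open>At 0 a derivative may fail to exist, since \<open>\<phi> 0 = \<kappa>\<close> may
  vanish. This limit replaces it, both as the lower end of the integral of \<open>\<psi>'\<close>
  and in showing that the laws of the semigroup have mass 1.\<close>

lemma psi_tendsto_0: "(\<psi> \<longlongrightarrow> 0) (at_right 0)"
proof (rule tendstoI)
  fix e :: real assume e: "0 < e"
  have "eventually (\<lambda>y. y \<in> {0<..<\<Phi> e}) (at_right 0)"
    using primitive_pos[OF e] by (rule eventually_at_right_real)
  then show "eventually (\<lambda>y. dist (\<psi> y) 0 < e) (at_right 0)"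
  proof eventually_elim
    case (elim y)
    then show ?case using psi_less[of y e] psi_nonneg[of y] e by auto
  qed
qed

section \<open>Complete monotonicity of \<open>\<psi>'\<close> and of
  \<open>exp (- t * \<psi>)\<close>\<close>

lemma recip_phi_cm: "cm_upto n (\<lambda>q. 1 / \<phi> q)"
proof -
  have L: "levy_measure \<pi>" and "0 \<le> c" using LK by (auto simp: levy_khintchine_def)
  \<comment> \<open>The derivatives of \<open>1 / x\<close>, with alternating signs removed.\<close>
  have rec: "cm_sequence (\<lambda>k x. fact k * inverse x ^ Suc k)"
    unfolding cm_sequence_def
  proof (intro allI impI conjI)
    fix k and x :: real assume "0 < x"
    then have d: "(inverse has_real_derivative - (inverse x ^ Suc (Suc 0))) (at x)"
      by (intro DERIV_inverse) simp
    show "((\<lambda>x. fact k * inverse x ^ Suc k) has_real_derivative - (fact (Suc k) * inverse x ^ Suc (Suc k))) (at x)"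
      using DERIV_cmult[OF DERIV_power_Suc[OF d, where n = k], where c = "fact k"]
      by (simp add: algebra_simps)
  qed simp
  have "cm_upto n (\<lambda>q. c + (\<integral>x. x ^ Suc 0 * exp (- q * x) \<partial>\<pi>))"
    using cm_sequence_imp_cm_upto[OF levy_cm_sequence[OF L \<open>0 \<le> c\<close>], of n 0] by simp
  from cm_upto_compose[OF rec phi_pos _ this, where k = 0] levy_khintchine_deriv[OF LK]
  have "cm_upto (Suc n) (\<lambda>q. 1 / \<phi> q)" by (simp add: inverse_eq_divide del: cm_upto.simps)
  then show ?thesis by (rule cm_upto_SucD)
qed

text \<open>The equation \<open>\<psi>' = (1 / \<phi>) \<circ> \<psi>\<close> is fed into itself:
  \<open>n\<close> orders for \<open>\<psi>'\<close>, taken as the inner derivative, give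
  \<open>n + 1\<close> orders for the composite, which is \<open>\<psi>'\<close> again.\<close>

lemma psi_deriv_cm: "cm_upto n (\<lambda>y. 1 / \<phi> (\<psi> y))"
proof -
  obtain H where H: "cm_sequence H" "H 0 = (\<lambda>q. 1 / \<phi> q)" using cm_sequence_exists[OF recip_phi_cm] .
  show ?thesis
  proof (induction n)
    case 0
    show ?case using phi_pos[OF psi_pos] by (simp add: less_imp_le)
  next
    case (Suc n)
    from cm_upto_compose[OF H(1) psi_pos psi_deriv Suc, where k = 0] show ?case by (simp add: H(2))
  qed
qed

lemma exp_psi_cm: assumes "0 \<le> t" shows "cm_upto n (\<lambda>y. exp (- t * \<psi> y))"
proof -
  have "cm_sequence (\<lambda>k x. t ^ k * exp (- t * x))"
    unfolding cm_sequence_def using assms by (auto intro!: derivative_eq_intros)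
  from cm_upto_compose[OF this psi_pos psi_deriv psi_deriv_cm, where k = 0]
  have "cm_upto (Suc n) (\<lambda>y. exp (- t * \<psi> y))" by (simp del: cm_upto.simps)
  then show ?thesis by (rule cm_upto_SucD)
qed

text \<open>The integrand may be unbounded at 0, so the fundamental theorem is used in its improper
  form for nonnegative integrands, with \<open>psi_tendsto_0\<close> as the boundary value.\<close>

lemma psi_nn_integral:
  assumes y: "0 < y"
  shows "(\<integral>\<^sup>+s. ennreal (1 / \<phi> (\<psi> s)) * indicator {0<..<y} s \<partial>lborel) = ennreal (\<psi> y)"
proof -
  have cont: "isCont (\<lambda>s. 1 / \<phi> (\<psi> s)) s" if "0 < s" for s
    using that phi_pos[OF psi_pos[OF that]]
    by (intro continuous_intros isCont_o2[OF psi_isCont] phi_isCont psi_pos) auto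
  have 1: "set_integrable lborel (einterval 0 y) (\<lambda>s. 1 / \<phi> (\<psi> s))"
    and 2: "(LBINT s=0..y. 1 / \<phi> (\<psi> s)) = \<psi> y - 0"
  proof -
    have a: "((\<psi> \<circ> real_of_ereal) \<longlongrightarrow> 0) (at_right (0::ereal))"
      using psi_tendsto_0 by (simp add: zero_ereal_def ereal_tendsto_simps)
    have "isCont \<psi> y" by (rule psi_isCont[OF y])
    then have "(\<psi> \<longlongrightarrow> \<psi> y) (at_left y)" unfolding isCont_def by (rule tendsto_within_subset) simp
    then have b: "((\<psi> \<circ> real_of_ereal) \<longlongrightarrow> \<psi> y) (at_left (ereal y))"
      by (simp add: ereal_tendsto_simps)
    show "set_integrable lborel (einterval 0 y) (\<lambda>s. 1 / \<phi> (\<psi> s))" "(LBINT s=0..y. 1 / \<phi> (\<psi> s)) = \<psi> y - 0"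
      using interval_integral_FTC_nonneg[of 0 "ereal y" \<psi> "\<lambda>s. 1 / \<phi> (\<psi> s)", OF _ _ _ _ a b] y psi_deriv cont phi_pos[OF psi_pos]
      by (auto simp: zero_ereal_def less_imp_le)
  qed
  have e: "einterval 0 (ereal y) = {0<..<y}" by (auto simp: einterval_def zero_ereal_def)
  have "(\<integral>\<^sup>+s. ennreal (1 / \<phi> (\<psi> s)) * indicator {0<..<y} s \<partial>lborel) =
      (\<integral>\<^sup>+s. ennreal (indicator {0<..<y} s *\<^sub>R (1 / \<phi> (\<psi> s))) \<partial>lborel)"
    by (intro nn_integral_cong) (auto simp: indicator_def)
  also have "\<dots> = ennreal (LINT s:{0<..<y}|lborel. 1 / \<phi> (\<psi> s))"
    unfolding set_lebesgue_integral_def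
    by (rule nn_integral_eq_integral)
      (use 1 phi_pos[OF psi_pos] in \<open>auto simp: set_integrable_def e indicator_def less_imp_le\<close>)
  also have "\<dots> = ennreal (\<psi> y)" using 2 y by (simp add: interval_lebesgue_integral_def e zero_ereal_def)
  finally show ?thesis .
qed

text \<open>Write \<open>\<psi>'\<close> as the Laplace transform of \<open>m\<close>, integrate
  over \<open>(0, y)\<close> and exchange the integrals. The atom of \<open>m\<close> at 0 yields
  the drift, the rest divided by \<open>x\<close> the Levy measure, and the killing rate is 0
  because \<open>\<psi> 0 = 0\<close>.\<close>

lemma psi_levy_khintchine: "\<exists>d L. levy_khintchine \<psi> 0 d L"
proof -
  obtain m :: "real measure" where m: "sets m = sets borel" "emeasure m {..<0} = 0"
    "\<And>q. 0 < q \<Longrightarrow> (\<integral>\<^sup>+x. ennreal (exp (- q * x)) \<partial>m) = ennreal (1 / \<phi> (\<psi> q))"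
    using bernstein[OF psi_deriv_cm] by metis
  note [measurable_cong] = m(1)
  have nn: "AE x in m. 0 \<le> x" by (rule AE_nonneg_of_null[OF m(1,2)])
  interpret m: sigma_finite_measure m
    by (rule sigma_finite_of_nn_integral[of "\<lambda>x. exp (- x)"]) (use m(3)[of 1] in auto)
  interpret P: pair_sigma_finite m lborel ..
  \<comment> \<open>The integral of \<open>exp (- s * x)\<close> over \<open>s\<close> in
    \<open>(0, y)\<close>; at \<open>x = 0\<close> it equals \<open>y\<close>, which is where the
    linear term comes from.\<close>
  define k where "k y x = (if x = 0 then y else (1 - exp (- y * x)) / x)" for y x :: real
  have [measurable]: "k y \<in> borel_measurable borel" for y unfolding k_def by measurable
  have k_int: "(\<integral>\<^sup>+s. ennreal (exp (- s * x)) * indicator {0<..<y} s \<partial>lborel) = ennreal (k y x)"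
    if y: "0 < y" for x y
  proof -
    have "(\<integral>\<^sup>+s. ennreal (exp (- s * x)) * indicator {0<..<y} s \<partial>lborel) =
        (\<integral>\<^sup>+s. ennreal (exp (- s * x)) * indicator {0..y} s \<partial>lborel)"
      by (rule nn_integral_cong_AE)
        (use AE_lborel_singleton[of 0] AE_lborel_singleton[of y] in \<open>eventually_elim, auto simp: indicator_def\<close>)
    also have "\<dots> = ennreal ((if x = 0 then y else - exp (- y * x) / x) - (if x = 0 then 0 else - exp (- 0 * x) / x))"
    proof (rule nn_integral_FTC_Icc[where F = "\<lambda>s. if x = 0 then s else - exp (- s * x) / x"])
      fix s :: real
      show "((\<lambda>s. if x = 0 then s else - exp (- s * x) / x) has_real_derivative exp (- s * x)) (at s)"
        by (cases "x = 0") (auto intro!: derivative_eq_intros)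
    qed (use y in auto)
    also have "\<dots> = ennreal (k y x)" by (simp add: k_def diff_divide_distrib)
    finally show ?thesis .
  qed
  have k_m: "(\<integral>\<^sup>+x. ennreal (k y x) \<partial>m) = ennreal (\<psi> y)" if y: "0 < y" for y
  proof -
    have "(\<integral>\<^sup>+x. ennreal (k y x) \<partial>m) = (\<integral>\<^sup>+x. \<integral>\<^sup>+s. ennreal (exp (- s * x)) * indicator {0<..<y} s \<partial>lborel \<partial>m)"
      using k_int[OF y] by simp
    also have "\<dots> = (\<integral>\<^sup>+s. \<integral>\<^sup>+x. ennreal (exp (- s * x)) * indicator {0<..<y} s \<partial>m \<partial>lborel)"
      by (rule P.Fubini'[symmetric]) measurable
    also have "\<dots> = (\<integral>\<^sup>+s. ennreal (1 / \<phi> (\<psi> s)) * indicator {0<..<y} s \<partial>lborel)"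
      by (rule nn_integral_cong) (auto simp: m(3)[simplified] nn_integral_multc split: split_indicator)
    finally show ?thesis by (simp add: psi_nn_integral[OF y])
  qed
  define L where "L = density m (\<lambda>x. ennreal (indicator {0<..} x / x))"
  have L_int: "(\<integral>\<^sup>+x. ennreal (1 - exp (- y * x)) \<partial>L) = (\<integral>\<^sup>+x. ennreal (k y x) * indicator {0<..} x \<partial>m)" for y
    unfolding L_def
    by (subst nn_integral_density)
      (auto intro!: nn_integral_cong simp: k_def indicator_def field_simps simp flip: ennreal_mult')
  have split: "ennreal (\<psi> y) = ennreal y * emeasure m {0} + (\<integral>\<^sup>+x. ennreal (1 - exp (- y * x)) \<partial>L)" if y: "0 < y" for y
  proof -
    have "ennreal (\<psi> y) = (\<integral>\<^sup>+x. ennreal y * indicator {0} x + ennreal (k y x) * indicator {0<..} x \<partial>m)"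
      unfolding k_m[OF y, symmetric]
      by (rule nn_integral_cong_AE) (use nn in \<open>eventually_elim, auto simp: k_def indicator_def\<close>)
    also have "\<dots> = ennreal y * emeasure m {0} + (\<integral>\<^sup>+x. ennreal (1 - exp (- y * x)) \<partial>L)"
      unfolding L_int by (subst nn_integral_add) (auto simp: nn_integral_cmult_indicator)
    finally show ?thesis .
  qed
  \<comment> \<open>Integrability follows from \<open>min 1 x \<le> 2 * (1 - exp (- x))\<close>,
    since the integral of \<open>1 - exp (- x)\<close> is at most the finite number
    \<open>\<psi> 1\<close> by \<open>split\<close>.\<close>
  have "levy_measure L" unfolding levy_measure_def
  proof (intro conjI)
    show "sets L = sets borel" by (simp add: L_def m(1))
    show "emeasure L {..0} = 0" unfolding L_def
      by (subst emeasure_density) (auto simp: nn_integral_0_iff_AE indicator_def)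
    have "(\<integral>\<^sup>+x\<in>{0<..}. ennreal (min 1 x) \<partial>L) \<le> (\<integral>\<^sup>+x. 2 * ennreal (1 - exp (- 1 * x)) \<partial>L)"
    proof (rule nn_integral_mono)
      fix x :: real
      show "ennreal (min 1 x) * indicator {0<..} x \<le> 2 * ennreal (1 - exp (- 1 * x))"
      proof (cases "0 < x")
        case True
        have "exp (- x) \<le> 1 / (1 + x)" using exp_ge_add_one_self[of x] True by (simp add: exp_minus field_simps)
        then have "x / (1 + x) \<le> 1 - exp (- x)" using True by (simp add: field_simps)
        moreover have "min 1 x \<le> 2 * (x / (1 + x))" using True by (auto simp: min_def field_simps)
        ultimately have "min 1 x \<le> 2 * (1 - exp (- x))"
          by (meson mult_left_mono order_trans zero_le_numeral)
        then have "ennreal (min 1 x) \<le> ennreal (2 * (1 - exp (- x)))" by (rule ennreal_leI)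
        also have "\<dots> = 2 * ennreal (1 - exp (- x))" using True by (subst ennreal_mult) auto
        finally show ?thesis using True by simp
      qed simp
    qed
    also have "\<dots> = 2 * (\<integral>\<^sup>+x. ennreal (1 - exp (- 1 * x)) \<partial>L)"
      by (rule nn_integral_cmult) (simp add: L_def)
    also have "\<dots> < \<infinity>"
    proof -
      have "(\<integral>\<^sup>+x. ennreal (1 - exp (- 1 * x)) \<partial>L) \<le> ennreal (\<psi> 1)" using split[of 1] by simp
      then show ?thesis by (simp add: ennreal_mult_less_top le_less_trans[OF _ ennreal_less_top])
    qed
    finally show "(\<integral>\<^sup>+x\<in>{0<..}. ennreal (min 1 x) \<partial>L) < \<infinity>" .
  qed
  have "levy_khintchine \<psi> 0 (measure m {0}) L" unfolding levy_khintchine_def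
  proof (intro conjI allI impI)
    fix y :: real assume y: "0 \<le> y"
    show "\<psi> y = 0 + measure m {0} * y + (LINT x:{0<..}|L. 1 - exp (- y * x))"
    proof (cases "y = 0")
      case True
      then show ?thesis by (simp add: psi_0 set_lebesgue_integral_def)
    next
      case False
      with y have y': "0 < y" by simp
      have fin: "emeasure m {0} < \<infinity>"
        using split[OF y'] y' by (metis ennreal_add_eq_top ennreal_eq_0_iff ennreal_mult_eq_top_iff ennreal_neq_top infinity_ennreal_def not_le top.not_eq_extremum)
      have int: "integrable L (\<lambda>x. 1 - exp (- y * x))"
        by (rule levy_integrable_one_minus_exp[OF \<open>levy_measure L\<close> y])
      have nnL: "AE x in L. 0 \<le> 1 - exp (- y * x)"
        using levy_AE_pos[OF \<open>levy_measure L\<close>] by eventually_elim (use y in simp)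
      have "ennreal (\<psi> y) = ennreal (y * measure m {0} + (\<integral>x. 1 - exp (- y * x) \<partial>L))"
        unfolding split[OF y'] nn_integral_eq_integral[OF int nnL]
        using fin y integral_nonneg_AE[OF nnL]
        by (simp add: emeasure_eq_ennreal_measure ennreal_plus ennreal_mult'')
      then have "\<psi> y = y * measure m {0} + (\<integral>x. 1 - exp (- y * x) \<partial>L)"
        using psi_nonneg[OF y] y integral_nonneg_AE[OF nnL] by (subst (asm) ennreal_inj) auto
      then show ?thesis by (simp add: levy_set_integral[OF \<open>levy_measure L\<close>] mult.commute)
    qed
  qed (use \<open>levy_measure L\<close> in auto)
  then show ?thesis by blast
qed

end

section \<open>Joint Laplace transforms\<close>

text \<open>Exponentials are replaced by indicators one coordinate at a time: \<open>f S A q\<close>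
  has indicators on \<open>S\<close> and exponentials on the rest of \<open>J\<close>. Each
  replacement needs only one-dimensional uniqueness, and \<open>S = J\<close> compares the measures
  of boxes.\<close>

lemma PiM_laplace_unique:
  fixes P Q :: "('i \<Rightarrow> real) measure"
  assumes J: "finite J" and sP: "sets P = sets (PiM J (\<lambda>_. borel))" and sQ: "sets Q = sets (PiM J (\<lambda>_. borel))"
    and fP: "finite_measure P"
    and nP: "AE \<omega> in P. \<forall>j\<in>J. 0 \<le> \<omega> j" and nQ: "AE \<omega> in Q. \<forall>j\<in>J. 0 \<le> \<omega> j"
    and eq: "\<And>q. (\<And>j. j \<in> J \<Longrightarrow> 0 < q j) \<Longrightarrow>
      (\<integral>\<^sup>+\<omega>. ennreal (exp (- (\<Sum>j\<in>J. q j * \<omega> j))) \<partial>P) = (\<integral>\<^sup>+\<omega>. ennreal (exp (- (\<Sum>j\<in>J. q j * \<omega> j))) \<partial>Q)"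
  shows "P = Q"
proof -
  note [measurable_cong] = sP sQ
  interpret fP: finite_measure P by (rule fP)
  define f where "f S A q \<omega> = (\<Prod>j\<in>S. indicator (A j) (\<omega> j)) * (\<Prod>j\<in>J - S. ennreal (exp (- (q j * \<omega> j))))"
    for S and A :: "'i \<Rightarrow> real set" and q \<omega>
  have claim: "(\<integral>\<^sup>+\<omega>. f S A q \<omega> \<partial>P) = (\<integral>\<^sup>+\<omega>. f S A q \<omega> \<partial>Q)"
    if "S \<subseteq> J" "\<And>j. j \<in> J \<Longrightarrow> A j \<in> sets borel" "\<And>j. j \<in> J \<Longrightarrow> 0 < q j" for S A q
  proof -
    have "finite S" using that(1) J by (rule finite_subset)
    then show ?thesis using that
    proof (induction S arbitrary: q)
      case empty
      have "f {} A q \<omega> = ennreal (exp (- (\<Sum>j\<in>J. q j * \<omega> j)))" for \<omega>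
        using J by (simp add: f_def prod_ennreal exp_sum[symmetric] sum_negf)
      then show ?case using eq[OF empty(3)] by simp
    next
      case (insert i S)
      have i: "i \<in> J" "S \<subseteq> J" using insert.prems by auto
      have [measurable]: "A i \<in> sets borel" using insert.prems i by auto
      have A[measurable]: "A j \<in> sets borel" if "j \<in> S" for j using insert.prems i that by auto
      define g where "g \<omega> = (\<Prod>j\<in>S. indicator (A j) (\<omega> j)) * (\<Prod>j\<in>J - insert i S. ennreal (exp (- (q j * \<omega> j))))" for \<omega>
      have g_meas: "g \<in> borel_measurable (PiM J (\<lambda>_. borel))"
        unfolding g_def
      proof (intro borel_measurable_times_ennreal borel_measurable_prod_ennreal)
        fix j assume "j \<in> S"
        then have [measurable]: "A j \<in> sets borel" "j \<in> J" using A i by auto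
        show "(\<lambda>\<omega>. indicator (A j) (\<omega> j)) \<in> borel_measurable (PiM J (\<lambda>_. borel))" by measurable
      next
        fix j assume "j \<in> J - insert i S"
        then have [measurable]: "j \<in> J" by auto
        show "(\<lambda>\<omega>. ennreal (exp (- (q j * \<omega> j)))) \<in> borel_measurable (PiM J (\<lambda>_. borel))" by measurable
      qed
      then have [measurable]: "g \<in> borel_measurable P" "g \<in> borel_measurable Q" by (simp_all add: measurable_cong_sets[OF sP refl] measurable_cong_sets[OF sQ refl])
      have [measurable]: "i \<in> J" by (rule i)
      have comp[measurable]: "(\<lambda>\<omega>. \<omega> i) \<in> borel_measurable P" "(\<lambda>\<omega>. \<omega> i) \<in> borel_measurable Q" by measurable
      \<comment> \<open>The law of coordinate \<open>i\<close> when all other factors are frozen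
        into the weight \<open>g\<close>; its transform at \<open>r\<close> is the previous stage
        with \<open>q i\<close> changed to \<open>r\<close>.\<close>
      define D where "D R = distr (density R g) borel (\<lambda>\<omega>. \<omega> i)" for R :: "('i \<Rightarrow> real) measure"
      have LT: "(\<integral>\<^sup>+x. ennreal (exp (- r * x)) \<partial>D R) = (\<integral>\<^sup>+\<omega>. f S A (q(i := r)) \<omega> \<partial>R)"
        if R: "sets R = sets (PiM J (\<lambda>_. borel))" for R r
      proof -
        note [measurable_cong] = R
        have [measurable]: "g \<in> borel_measurable R" using g_meas by (simp add: measurable_cong_sets[OF R refl])
        have "(\<integral>\<^sup>+x. ennreal (exp (- r * x)) \<partial>D R) = (\<integral>\<^sup>+\<omega>. g \<omega> * ennreal (exp (- r * \<omega> i)) \<partial>R)"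
          unfolding D_def by (subst nn_integral_distr) (auto simp: nn_integral_density)
        moreover have "g \<omega> * ennreal (exp (- r * \<omega> i)) = f S A (q(i := r)) \<omega>" for \<omega>
        proof -
          have "(\<Prod>j\<in>J - S. ennreal (exp (- ((q(i := r)) j * \<omega> j)))) =
              ennreal (exp (- (r * \<omega> i))) * (\<Prod>j\<in>J - S - {i}. ennreal (exp (- ((q(i := r)) j * \<omega> j))))"
            using i insert.hyps J by (subst prod.remove[of "J - S" i]) auto
          also have "J - S - {i} = J - insert i S" by auto
          also have "(\<Prod>j\<in>J - insert i S. ennreal (exp (- ((q(i := r)) j * \<omega> j)))) =
              (\<Prod>j\<in>J - insert i S. ennreal (exp (- (q j * \<omega> j))))"
            by (intro prod.cong) auto
          finally show ?thesis unfolding f_def g_def by (simp add: mult_ac)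
        qed
        ultimately show ?thesis by simp
      qed
      have eqLT: "(\<integral>\<^sup>+\<omega>. f S A (q(i := r)) \<omega> \<partial>P) = (\<integral>\<^sup>+\<omega>. f S A (q(i := r)) \<omega> \<partial>Q)" if "0 < r" for r
        using insert.prems i that by (intro insert.IH) auto
      have em: "emeasure (D R) B = (\<integral>\<^sup>+\<omega>. g \<omega> * indicator B (\<omega> i) \<partial>R)"
        if R: "sets R = sets (PiM J (\<lambda>_. borel))" and B[measurable]: "B \<in> sets borel" for R B
      proof -
        note [measurable_cong] = R
        have [measurable]: "g \<in> borel_measurable R" using g_meas by (simp add: measurable_cong_sets[OF R refl])
        show ?thesis unfolding D_def
          by (simp add: emeasure_distr emeasure_density)
            (auto intro!: nn_integral_cong simp: indicator_def)
      qed
      have "D P = D Q"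
      proof (rule laplace_unique)
        show "emeasure (D P) {..<0} = 0"
          by (subst em[OF sP]) (use nP i in \<open>auto simp: nn_integral_0_iff_AE elim!: eventually_mono\<close>)
        show "emeasure (D Q) {..<0} = 0"
          by (subst em[OF sQ]) (use nQ i in \<open>auto simp: nn_integral_0_iff_AE elim!: eventually_mono\<close>)
        fix r :: real assume r: "0 < r"
        show "(\<integral>\<^sup>+x. ennreal (exp (- r * x)) \<partial>D P) = (\<integral>\<^sup>+x. ennreal (exp (- r * x)) \<partial>D Q)"
          unfolding LT[OF sP] LT[OF sQ] by (rule eqLT[OF r])
        have "(\<integral>\<^sup>+\<omega>. f S A (q(i := r)) \<omega> \<partial>P) \<le> (\<integral>\<^sup>+\<omega>. 1 \<partial>P)"
        proof (rule nn_integral_mono_AE, use nP in eventually_elim)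
          case (elim \<omega>)
          show ?case unfolding f_def
            by (intro mult_le_one prod_le_1 conjI)
              (use elim insert.prems r i in \<open>auto simp: indicator_def mult_nonneg_nonneg less_imp_le\<close>)
        qed
        also have "\<dots> < \<infinity>" using fP.emeasure_finite[of "space P"] by (simp add: less_top[symmetric])
        finally show "(\<integral>\<^sup>+x. ennreal (exp (- r * x)) \<partial>D P) < \<infinity>" unfolding LT[OF sP] .
      qed (simp_all add: D_def)
      moreover have "f (insert i S) A q \<omega> = g \<omega> * indicator (A i) (\<omega> i)" for \<omega>
        unfolding f_def g_def using insert.hyps by (simp add: mult_ac)
      ultimately show ?case using em[OF sP, of "A i"] em[OF sQ, of "A i"] by simp
    qed
  qed
  show ?thesis
  proof (rule measure_eqI_PiM_finite[OF J sP sQ, where A = "\<lambda>_. Pi\<^sub>E J (\<lambda>_. UNIV)"])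
    fix A :: "'i \<Rightarrow> real set" assume A: "\<And>i. i \<in> J \<Longrightarrow> A i \<in> sets borel"
    have "emeasure R (Pi\<^sub>E J A) = (\<integral>\<^sup>+\<omega>. f J A (\<lambda>_. 1) \<omega> \<partial>R)" if R: "sets R = sets (PiM J (\<lambda>_. borel))" for R
    proof -
      have "Pi\<^sub>E J A \<in> sets R" using A J by (auto simp: R)
      then have "emeasure R (Pi\<^sub>E J A) = (\<integral>\<^sup>+\<omega>. indicator (Pi\<^sub>E J A) \<omega> \<partial>R)" by simp
      also have "\<dots> = (\<integral>\<^sup>+\<omega>. f J A (\<lambda>_. 1) \<omega> \<partial>R)"
      proof (rule nn_integral_cong)
        fix \<omega> assume "\<omega> \<in> space R"
        then have "\<omega> \<in> extensional J" using sets_eq_imp_space_eq[OF R] by (auto simp: space_PiM PiE_def)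
        then show "indicator (Pi\<^sub>E J A) \<omega> = f J A (\<lambda>_. 1) \<omega>"
          using J by (auto simp: f_def indicator_def PiE_def Pi_def)
      qed
      finally show ?thesis .
    qed
    then show "emeasure P (Pi\<^sub>E J A) = emeasure Q (Pi\<^sub>E J A)"
      using claim[of J A "\<lambda>_. 1"] A sP sQ by simp
  qed (auto simp: J fP.emeasure_finite space_PiM intro!: prod_algebraI_finite)
qed

text \<open>A joint transform that factorises is the transform of the product of the marginals, so
  the joint law is that product.\<close>

lemma (in prob_space) indep_vars_laplace:
  fixes X :: "'i \<Rightarrow> 'a \<Rightarrow> real"
  assumes I: "finite I" and X[measurable]: "\<And>i. i \<in> I \<Longrightarrow> X i \<in> borel_measurable M"
    and nn: "\<And>i. i \<in> I \<Longrightarrow> AE \<omega> in M. 0 \<le> X i \<omega>"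
    and eq: "\<And>q. (\<And>i. i \<in> I \<Longrightarrow> 0 < q i) \<Longrightarrow>
      (\<integral>\<^sup>+\<omega>. ennreal (exp (- (\<Sum>i\<in>I. q i * X i \<omega>))) \<partial>M) = (\<Prod>i\<in>I. \<integral>\<^sup>+\<omega>. ennreal (exp (- (q i * X i \<omega>))) \<partial>M)"
  shows "indep_vars (\<lambda>_. borel) X I"
proof (cases "I = {}")
  case True
  then show ?thesis by (simp add: indep_vars_def indep_sets_def)
next
  case False
  \<comment> \<open>The product construction asks for a probability measure at every index; outside
    \<open>I\<close>, where \<open>X i\<close> is arbitrary, a Dirac mass supplies it.\<close>
  let ?D = "\<lambda>i. if i \<in> I then distr M borel (X i) else return borel (0::real)"
  have "prob_space (?D i)" for i by (auto intro!: prob_space_distr prob_space_return)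
  then interpret D: product_prob_space ?D I by (rule product_prob_spaceI)
  have XX: "(\<lambda>\<omega>. \<lambda>i\<in>I. X i \<omega>) \<in> measurable M (PiM I (\<lambda>_. borel))"
    by (rule measurable_restrict) (rule X)
  have comp: "(\<lambda>\<omega>. \<omega> j) \<in> borel_measurable (PiM I (\<lambda>_. borel :: real measure))" if "j \<in> I" for j :: 'i
    using that by (rule measurable_component_singleton)
  have sD: "sets (PiM I ?D) = sets (PiM I (\<lambda>_. borel))" by (intro sets_PiM_cong) auto
  have compD: "(\<lambda>\<omega>. \<omega> j) \<in> borel_measurable (PiM I ?D)" if "j \<in> I" for j :: 'i
    using comp[OF that] by (simp add: measurable_cong_sets[OF sD refl])
  have "distr M (PiM I (\<lambda>_. borel)) (\<lambda>\<omega>. \<lambda>i\<in>I. X i \<omega>) = PiM I ?D"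
  proof (rule PiM_laplace_unique[OF I])
    show "AE \<omega> in distr M (PiM I (\<lambda>_. borel)) (\<lambda>\<omega>. \<lambda>i\<in>I. X i \<omega>). \<forall>j\<in>I. 0 \<le> \<omega> j"
    proof (subst AE_distr_iff[OF XX])
      show "{\<omega> \<in> space (PiM I (\<lambda>_. borel :: real measure)). \<forall>j\<in>I. 0 \<le> \<omega> j} \<in> sets (PiM I (\<lambda>_. borel))"
      proof (rule sets.sets_Collect_finite_All[OF _ I])
        fix j assume "j \<in> I"
        note [measurable] = comp[OF this]
        show "{\<omega> \<in> space (PiM I (\<lambda>_. borel :: real measure)). 0 \<le> \<omega> j} \<in> sets (PiM I (\<lambda>_. borel))" by measurable
      qed
      show "AE \<omega> in M. \<forall>j\<in>I. 0 \<le> (\<lambda>i\<in>I. X i \<omega>) j"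
        using I nn by (subst AE_ball_countable) (auto simp: countable_finite)
    qed
    show "AE \<omega> in PiM I ?D. \<forall>j\<in>I. 0 \<le> \<omega> j"
    proof (subst AE_ball_countable[OF countable_finite[OF I]], intro ballI)
      fix j assume j: "j \<in> I"
      have "AE x in ?D j. 0 \<le> x" using nn[OF j] X[OF j] j by (simp add: AE_distr_iff)
      then show "AE \<omega> in PiM I ?D. 0 \<le> \<omega> j"
        using D.AE_component[OF j] by blast
    qed
    fix q :: "'i \<Rightarrow> real" assume q: "\<And>j. j \<in> I \<Longrightarrow> 0 < q j"
    have [measurable]: "(\<lambda>\<omega>. \<Sum>j\<in>I. q j * \<omega> j) \<in> borel_measurable (PiM I (\<lambda>_. borel :: real measure))"
      by (rule borel_measurable_sum, rule borel_measurable_times[OF borel_measurable_const], rule comp)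
    have m: "(\<lambda>\<omega>. ennreal (exp (- (\<Sum>j\<in>I. q j * \<omega> j)))) \<in> borel_measurable (PiM I (\<lambda>_. borel :: real measure))"
      by measurable
    have "(\<integral>\<^sup>+\<omega>. ennreal (exp (- (\<Sum>j\<in>I. q j * \<omega> j))) \<partial>distr M (PiM I (\<lambda>_. borel)) (\<lambda>\<omega>. \<lambda>i\<in>I. X i \<omega>)) =
        (\<integral>\<^sup>+\<omega>. ennreal (exp (- (\<Sum>i\<in>I. q i * X i \<omega>))) \<partial>M)"
      by (subst nn_integral_distr[OF XX]) (use m in \<open>auto intro!: nn_integral_cong\<close>)
    also have "\<dots> = (\<Prod>i\<in>I. \<integral>\<^sup>+x. ennreal (exp (- (q i * x))) \<partial>?D i)"
      by (subst eq[of q]) (auto intro!: q prod.cong simp: nn_integral_distr)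
    also have "\<dots> = (\<integral>\<^sup>+\<omega>. (\<Prod>i\<in>I. ennreal (exp (- (q i * \<omega> i)))) \<partial>PiM I ?D)"
      by (rule D.product_nn_integral_prod[symmetric]) (auto intro: I)
    also have "\<dots> = (\<integral>\<^sup>+\<omega>. ennreal (exp (- (\<Sum>j\<in>I. q j * \<omega> j))) \<partial>PiM I ?D)"
      using I by (simp add: prod_ennreal exp_sum[symmetric] sum_negf)
    finally show "(\<integral>\<^sup>+\<omega>. ennreal (exp (- (\<Sum>j\<in>I. q j * \<omega> j))) \<partial>distr M (PiM I (\<lambda>_. borel)) (\<lambda>\<omega>. \<lambda>i\<in>I. X i \<omega>)) =
        (\<integral>\<^sup>+\<omega>. ennreal (exp (- (\<Sum>j\<in>I. q j * \<omega> j))) \<partial>PiM I ?D)" .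
  next
    show "finite_measure (distr M (PiM I (\<lambda>_. borel)) (\<lambda>\<omega>. \<lambda>i\<in>I. X i \<omega>))"
      using prob_space_distr[OF XX] by (rule prob_space.finite_measure)
  qed (simp_all add: sD)
  also have "PiM I ?D = PiM I (\<lambda>i. distr M borel (X i))" by (rule PiM_cong) auto
  finally show ?thesis
    using False by (subst indep_vars_iff_distr_eq_PiM') auto
qed

section \<open>The subordinator with a given convolution semigroup\<close>

text \<open>Left end of the step of the grid \<open>J\<close> that ends at \<open>t\<close>.
  Inserting 0 makes the first step start at time 0 and keeps \<open>Max\<close> away from the empty
  set.\<close>

definition pred_time :: "real set \<Rightarrow> real \<Rightarrow> real" where
  "pred_time J t = Max (insert 0 {s \<in> J. s < t})"

lemma pred_time_bounds:
  assumes "finite J" "0 \<le> t" shows "0 \<le> pred_time J t" "pred_time J t \<le> t"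
  using assms by (auto simp: pred_time_def)

lemma pred_time_ge: "finite J \<Longrightarrow> s \<in> J \<Longrightarrow> s < t \<Longrightarrow> s \<le> pred_time J t"
  by (auto simp: pred_time_def)

lemma pred_time_less: "finite J \<Longrightarrow> 0 < u \<Longrightarrow> (\<And>s. s \<in> J \<Longrightarrow> s < t \<Longrightarrow> s < u) \<Longrightarrow> pred_time J t < u"
  by (auto simp: pred_time_def)

lemma integrable_indicator_Ioc: "integrable lborel (indicat_real {a<..b::real})"
proof (rule integrable_real_indicator)
  show "emeasure lborel {a<..b} < \<infinity>" by (rule emeasure_bounded_finite) simp
qed simp

locale laplace_semigroup =
  fixes \<psi> :: "real \<Rightarrow> real"
  assumes psi_nonneg: "0 \<le> y \<Longrightarrow> 0 \<le> \<psi> y" and psi_0: "\<psi> 0 = 0"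
    and psi_tendsto_0: "(\<psi> \<longlongrightarrow> 0) (at_right 0)"
    and exp_psi_cm: "0 \<le> t \<Longrightarrow> cm_upto n (\<lambda>y. exp (- t * \<psi> y))"
begin

text \<open>The law of the process at time \<open>t\<close>. The Dirac mass for \<open>t < 0\<close>
  makes every \<open>\<mu> t\<close> a probability measure, since a product family also has indices
  at which \<open>t - pred_time J t\<close> is negative.\<close>

definition \<mu> :: "real \<Rightarrow> real measure" where
  "\<mu> t = (if 0 \<le> t then (SOME m. sets m = sets borel \<and> emeasure m {..<0} = 0 \<and>
      (\<forall>q>0. (\<integral>\<^sup>+x. ennreal (exp (- q * x)) \<partial>m) = ennreal (exp (- t * \<psi> q)))) else return borel 0)"

lemma mu:
  assumes "0 \<le> t"
  shows "sets (\<mu> t) = sets borel" "emeasure (\<mu> t) {..<0} = 0"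
    "0 < q \<Longrightarrow> (\<integral>\<^sup>+x. ennreal (exp (- q * x)) \<partial>\<mu> t) = ennreal (exp (- t * \<psi> q))"
proof -
  have "\<exists>m::real measure. sets m = sets borel \<and> emeasure m {..<0} = 0 \<and>
      (\<forall>q>0. (\<integral>\<^sup>+x. ennreal (exp (- q * x)) \<partial>m) = ennreal (exp (- t * \<psi> q)))"
    using bernstein[OF exp_psi_cm[OF assms]] by metis
  from someI_ex[OF this] show "sets (\<mu> t) = sets borel" "emeasure (\<mu> t) {..<0} = 0"
    "0 < q \<Longrightarrow> (\<integral>\<^sup>+x. ennreal (exp (- q * x)) \<partial>\<mu> t) = ennreal (exp (- t * \<psi> q))"
    using assms unfolding \<mu>_def by auto
qed

lemma mu_AE: "0 \<le> t \<Longrightarrow> AE x in \<mu> t. 0 \<le> x"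
  by (rule AE_nonneg_of_null[OF mu(1,2)])

text \<open>The total mass is the increasing limit of the transforms at \<open>1 / (n + 1)\<close>,
  that is of \<open>exp (- t * \<psi> (1 / (n + 1)))\<close>, which tends to 1.\<close>

lemma mu_prob: "prob_space (\<mu> t)"
proof (cases "0 \<le> t")
  case t: True
  note [measurable_cong] = mu(1)[OF t]
  define f where "f n x = ennreal (exp (- (1 / real (Suc n)) * max 0 x))" for n x
  have lim: "(\<lambda>n. 1 / real (Suc n)) \<longlonglongrightarrow> 0" by (rule LIMSEQ_Suc[OF lim_const_over_n])
  have "(\<lambda>n. \<integral>\<^sup>+x. f n x \<partial>\<mu> t) \<longlonglongrightarrow> (\<integral>\<^sup>+x. 1 \<partial>\<mu> t)"
  proof (rule nn_integral_LIMSEQ)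
    show "incseq f"
      by (auto simp: incseq_def le_fun_def f_def intro!: ennreal_leI divide_left_mono mult_right_mono frac_le)
    fix x :: real
    have "(\<lambda>n. exp (- (1 / real (Suc n)) * max 0 x)) \<longlonglongrightarrow> exp (- 0 * max 0 x)"
      by (intro tendsto_intros lim)
    then show "(\<lambda>n. f n x) \<longlonglongrightarrow> 1" unfolding f_def using tendsto_ennrealI by fastforce
  qed (simp add: f_def[abs_def])
  moreover have "(\<integral>\<^sup>+x. f n x \<partial>\<mu> t) = ennreal (exp (- t * \<psi> (1 / real (Suc n))))" for n
  proof -
    have "(\<integral>\<^sup>+x. f n x \<partial>\<mu> t) = (\<integral>\<^sup>+x. ennreal (exp (- (1 / real (Suc n)) * x)) \<partial>\<mu> t)"
      by (rule nn_integral_cong_AE) (use mu_AE[OF t] in \<open>eventually_elim, simp add: f_def\<close>)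
    also have "\<dots> = ennreal (exp (- t * \<psi> (1 / real (Suc n))))" by (rule mu(3)[OF t]) simp
    finally show ?thesis .
  qed
  moreover have "(\<lambda>n. ennreal (exp (- t * \<psi> (1 / real (Suc n))))) \<longlonglongrightarrow> ennreal (exp (- t * 0))"
  proof (intro tendsto_intros tendsto_ennrealI)
    have "filterlim (\<lambda>n. 1 / real (Suc n)) (at_right 0) sequentially"
      using lim by (auto simp: filterlim_at intro!: always_eventually)
    then show "(\<lambda>n. \<psi> (1 / real (Suc n))) \<longlonglongrightarrow> 0" by (rule filterlim_compose[OF psi_tendsto_0])
  qed
  ultimately have "(\<integral>\<^sup>+x. 1 \<partial>\<mu> t) = 1" using LIMSEQ_unique by fastforce
  then show ?thesis by (intro prob_spaceI) simp
qed (simp add: \<mu>_def prob_space_return)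

lemma mu_sets: "sets (\<mu> t) = sets borel"
  using mu(1)[of t] by (cases "0 \<le> t") (auto simp: \<mu>_def)

lemma mu_laplace: assumes "0 \<le> t" "0 \<le> q"
  shows "(\<integral>\<^sup>+x. ennreal (exp (- (q * x))) \<partial>\<mu> t) = ennreal (exp (- t * \<psi> q))"
proof (cases "q = 0")
  case True
  interpret prob_space "\<mu> t" by (rule mu_prob)
  show ?thesis using True by (simp add: psi_0 emeasure_space_1)
qed (use mu(3)[OF assms(1), of q] assms in simp)

abbreviation step_space :: "real set \<Rightarrow> (real \<Rightarrow> real) measure" where
  "step_space J \<equiv> PiM J (\<lambda>t. \<mu> (t - pred_time J t))"

text \<open>\<open>d s\<close> is the increment from \<open>pred_time J s\<close> to
  \<open>s\<close>, so under \<open>step_space J\<close> the path at the times of \<open>J\<close>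
  has independent increments with the prescribed laws.\<close>

definition path_of_steps :: "real set \<Rightarrow> (real \<Rightarrow> real) \<Rightarrow> real \<Rightarrow> real" where
  "path_of_steps J d = (\<lambda>t\<in>J. \<Sum>s\<in>{s\<in>J. s \<le> t}. d s)"

definition fdd :: "real set \<Rightarrow> (real \<Rightarrow> real) measure" where
  "fdd J = distr (step_space J) (PiM J (\<lambda>_. borel)) (path_of_steps J)"

lemma steps_prob: "product_prob_space (\<lambda>t. \<mu> (t - pred_time J t))"
  by (rule product_prob_spaceI) (rule mu_prob)

lemma step_measurable: "j \<in> J \<Longrightarrow> (\<lambda>d. d j) \<in> borel_measurable (step_space J)"
  using measurable_component_singleton[of j J "\<lambda>t. \<mu> (t - pred_time J t)"]
  by (simp add: measurable_cong_sets[OF refl mu_sets])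

lemma path_measurable: "path_of_steps J \<in> measurable (step_space J) (PiM J (\<lambda>_. borel))"
  unfolding path_of_steps_def
  by (rule measurable_restrict, rule borel_measurable_sum) (auto intro: step_measurable)

lemma fdd_sets: "sets (fdd J) = sets (PiM J (\<lambda>_. borel))" by (simp add: fdd_def)

lemma fdd_prob: "prob_space (fdd J)"
proof -
  interpret product_prob_space "\<lambda>t. \<mu> (t - pred_time J t)" J by (rule steps_prob)
  show ?thesis unfolding fdd_def by (rule prob_space_distr[OF path_measurable])
qed

lemma coordinate_measurable: "j \<in> J \<Longrightarrow> (\<lambda>\<omega>. \<omega> j) \<in> borel_measurable (PiM J (\<lambda>_. borel :: real measure))"
  by (rule measurable_component_singleton)

lemma fdd_AE:
  assumes J: "finite J" "J \<subseteq> {0..}"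
  shows "AE \<omega> in fdd J. \<forall>s\<in>J. 0 \<le> \<omega> s \<and> (\<forall>t\<in>J. s \<le> t \<longrightarrow> \<omega> s \<le> \<omega> t)"
proof -
  interpret product_prob_space "\<lambda>t. \<mu> (t - pred_time J t)" J by (rule steps_prob)
  have "AE d in step_space J. \<forall>j\<in>J. 0 \<le> d j"
  proof (subst AE_ball_countable[OF countable_finite[OF J(1)]], intro ballI)
    fix j assume j: "j \<in> J"
    have "AE x in \<mu> (j - pred_time J j). 0 \<le> x"
      using pred_time_bounds(2)[OF J(1), of j] J j by (intro mu_AE) auto
    then show "AE d in step_space J. 0 \<le> d j" using AE_component[OF j] by blast
  qed
  then have "AE d in step_space J. \<forall>s\<in>J. 0 \<le> path_of_steps J d s \<and>
      (\<forall>t\<in>J. s \<le> t \<longrightarrow> path_of_steps J d s \<le> path_of_steps J d t)"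
  proof eventually_elim
    case (elim d)
    then show ?case
      using J by (auto simp: path_of_steps_def intro!: sum_nonneg sum_mono2)
  qed
  moreover have "{\<omega> \<in> space (PiM J (\<lambda>_. borel :: real measure)). \<forall>s\<in>J. 0 \<le> \<omega> s \<and> (\<forall>t\<in>J. s \<le> t \<longrightarrow> \<omega> s \<le> \<omega> t)} \<in> sets (PiM J (\<lambda>_. borel))"
  proof (intro sets.sets_Collect_finite_All[OF _ J(1)] sets.sets_Collect_conj sets.sets_Collect_imp)
    fix s assume s: "s \<in> J"
    note [measurable] = coordinate_measurable[OF s]
    show "{\<omega> \<in> space (PiM J (\<lambda>_. borel :: real measure)). 0 \<le> \<omega> s} \<in> sets (PiM J (\<lambda>_. borel))" by measurable
    fix t assume t: "t \<in> J"
    note [measurable] = coordinate_measurable[OF t]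
    show "{\<omega> \<in> space (PiM J (\<lambda>_. borel :: real measure)). \<omega> s \<le> \<omega> t} \<in> sets (PiM J (\<lambda>_. borel))" by measurable
    show "{\<omega> \<in> space (PiM J (\<lambda>_. borel :: real measure)). s \<le> t} \<in> sets (PiM J (\<lambda>_. borel))"
      by (rule sets.sets_Collect_const)
  qed
  ultimately show ?thesis unfolding fdd_def by (subst AE_distr_iff[OF path_measurable])
qed

text \<open>Exponent of the joint transform with coefficients \<open>c\<close>, as an integral over
  time: at time \<open>u\<close> the process still contributes to all coordinates
  \<open>t \<ge> u\<close>. In this form the grid enters only through \<open>c\<close>, so times of
  coefficient 0 may be added freely.\<close>

definition path_exponent :: "real set \<Rightarrow> (real \<Rightarrow> real) \<Rightarrow> real" where
  "path_exponent J c = (\<integral>u. (if 0 < u then \<psi> (\<Sum>t\<in>{t\<in>J. u \<le> t}. c t) else 0) \<partial>lborel)"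

text \<open>The tail sum is constant on each step \<open>(pred_time J s, s]\<close>; beyond the last
  time it is empty and contributes \<open>\<psi> 0 = 0\<close>.\<close>

lemma path_exponent_eq:
  assumes J: "finite J" "J \<subseteq> {0..}"
  shows "(\<Sum>s\<in>J. (s - pred_time J s) * \<psi> (\<Sum>t\<in>{t\<in>J. s \<le> t}. c t)) = path_exponent J c"
proof -
  let ?C = "\<lambda>u. \<Sum>t\<in>{t\<in>J. u \<le> t}. c t"
  have pw: "(if 0 < u then \<psi> (?C u) else 0) = (\<Sum>s\<in>J. \<psi> (?C s) * indicator {pred_time J s<..s} u)" for u
  proof (cases "0 < u \<and> (\<exists>t\<in>J. u \<le> t)")
    case True
    \<comment> \<open>The step containing \<open>u\<close> is the one that ends at the first time of
      \<open>J\<close> not before \<open>u\<close>.\<close>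
    define s0 where "s0 = Min {t\<in>J. u \<le> t}"
    have s0: "s0 \<in> J" "u \<le> s0" "\<And>t. t \<in> J \<Longrightarrow> u \<le> t \<Longrightarrow> s0 \<le> t"
    proof -
      have "finite {t\<in>J. u \<le> t}" "{t\<in>J. u \<le> t} \<noteq> {}" using True J by auto
      then have "s0 \<in> {t\<in>J. u \<le> t}" unfolding s0_def by (rule Min_in)
      moreover have le: "s0 \<le> t" if "t \<in> {t\<in>J. u \<le> t}" for t
        unfolding s0_def by (rule Min_le) (use that J in auto)
      ultimately show "s0 \<in> J" "u \<le> s0" by auto
      show "\<And>t. t \<in> J \<Longrightarrow> u \<le> t \<Longrightarrow> s0 \<le> t" using le by auto
    qed
    have "pred_time J s0 < u"
      using s0(3) True J by (intro pred_time_less) (auto simp: not_le[symmetric])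
    then have in0: "u \<in> {pred_time J s0<..s0}" using s0 by auto
    have notin: "u \<notin> {pred_time J s<..s}" if "s \<in> J" "s \<noteq> s0" for s
    proof
      assume "u \<in> {pred_time J s<..s}"
      then have "s0 < s" "pred_time J s < u" using s0(3)[of s] that by auto
      then show False using pred_time_ge[OF J(1) s0(1), of s] s0(2) by linarith
    qed
    have "(\<Sum>s\<in>J. \<psi> (?C s) * indicator {pred_time J s<..s} u) = (\<Sum>s\<in>J. if s = s0 then \<psi> (?C s0) else 0)"
      using in0 notin by (intro sum.cong) (auto simp: indicator_def)
    also have "\<dots> = \<psi> (?C s0)" using s0(1) J(1) by simp
    also have "{t\<in>J. s0 \<le> t} = {t\<in>J. u \<le> t}" using s0 by (auto intro: order_trans)
    finally show ?thesis using True by simp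
  next
    case False
    have "(\<Sum>s\<in>J. \<psi> (?C s) * indicator {pred_time J s<..s} u) = 0"
    proof (intro sum.neutral ballI)
      fix s assume s: "s \<in> J"
      then have "0 \<le> pred_time J s" using pred_time_bounds(1)[OF J(1), of s] J by auto
      then show "\<psi> (?C s) * indicator {pred_time J s<..s} u = 0" using False s by (auto simp: indicator_def)
    qed
    moreover have "\<psi> (?C u) = 0" if "0 < u"
    proof -
      have "{t\<in>J. u \<le> t} = {}" using False that by auto
      then show ?thesis using psi_0 by (simp only: sum.empty)
    qed
    ultimately show ?thesis by auto
  qed
  have "path_exponent J c = (\<integral>u. (\<Sum>s\<in>J. \<psi> (?C s) * indicator {pred_time J s<..s} u) \<partial>lborel)"
    unfolding path_exponent_def pw ..
  also have "\<dots> = (\<Sum>s\<in>J. \<integral>u. \<psi> (?C s) * indicator {pred_time J s<..s} u \<partial>lborel)"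
    by (intro Bochner_Integration.integral_sum integrable_mult_right integrable_indicator_Ioc)
  also have "\<dots> = (\<Sum>s\<in>J. (s - pred_time J s) * \<psi> (?C s))"
    using J pred_time_bounds(2)[OF J(1)] by (intro sum.cong refl) auto
  finally show ?thesis by simp
qed

text \<open>Nonnegativity is required of the tail sums and not of the coefficients, because
  increments produce coefficients of both signs. The tail sums are the rates at which the laws of
  the steps are evaluated.\<close>

lemma fdd_laplace:
  assumes J: "finite J" "J \<subseteq> {0..}" and c: "\<And>s. s \<in> J \<Longrightarrow> 0 \<le> (\<Sum>t\<in>{t\<in>J. s \<le> t}. c t)"
  shows "(\<integral>\<^sup>+\<omega>. ennreal (exp (- (\<Sum>t\<in>J. c t * \<omega> t))) \<partial>fdd J) = ennreal (exp (- path_exponent J c))"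
proof -
  interpret product_prob_space "\<lambda>t. \<mu> (t - pred_time J t)" J by (rule steps_prob)
  let ?C = "\<lambda>u. \<Sum>t\<in>{t\<in>J. u \<le> t}. c t"
  have [measurable]: "(\<lambda>\<omega>. \<Sum>t\<in>J. c t * \<omega> t) \<in> borel_measurable (PiM J (\<lambda>_. borel :: real measure))"
    by (rule borel_measurable_sum, rule borel_measurable_times[OF borel_measurable_const], rule coordinate_measurable)
  \<comment> \<open>Summation by parts: the step ending at \<open>s\<close> enters every later
    coordinate, so its total coefficient is the tail sum.\<close>
  have sw: "(\<Sum>t\<in>J. c t * path_of_steps J d t) = (\<Sum>s\<in>J. ?C s * d s)" for d
  proof -
    have "(\<Sum>t\<in>J. c t * path_of_steps J d t) = (\<Sum>t\<in>J. \<Sum>s\<in>J. if s \<le> t then c t * d s else 0)"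
      using J(1) by (intro sum.cong refl) (auto simp: path_of_steps_def sum_distrib_left sum.inter_filter intro!: sum.cong)
    also have "\<dots> = (\<Sum>s\<in>J. \<Sum>t\<in>J. if s \<le> t then c t * d s else 0)" by (rule sum.swap)
    also have "\<dots> = (\<Sum>s\<in>J. ?C s * d s)"
      using J(1) by (intro sum.cong refl) (auto simp: sum_distrib_right sum.inter_filter intro!: sum.cong)
    finally show ?thesis .
  qed
  have "(\<integral>\<^sup>+\<omega>. ennreal (exp (- (\<Sum>t\<in>J. c t * \<omega> t))) \<partial>fdd J) =
      (\<integral>\<^sup>+d. ennreal (exp (- (\<Sum>s\<in>J. ?C s * d s))) \<partial>step_space J)"
    unfolding fdd_def by (subst nn_integral_distr[OF path_measurable]) (simp_all add: sw)
  also have "\<dots> = (\<integral>\<^sup>+d. (\<Prod>s\<in>J. ennreal (exp (- (?C s * d s)))) \<partial>step_space J)"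
    using J(1) by (simp add: prod_ennreal exp_sum[symmetric] sum_negf)
  also have "\<dots> = (\<Prod>s\<in>J. \<integral>\<^sup>+x. ennreal (exp (- (?C s * x))) \<partial>\<mu> (s - pred_time J s))"
    by (rule product_nn_integral_prod[OF J(1)]) (simp add: measurable_cong_sets[OF mu_sets refl])
  also have "\<dots> = (\<Prod>s\<in>J. ennreal (exp (- (s - pred_time J s) * \<psi> (?C s))))"
  proof (intro prod.cong refl)
    fix s assume "s \<in> J"
    then show "(\<integral>\<^sup>+x. ennreal (exp (- (?C s * x))) \<partial>\<mu> (s - pred_time J s)) =
        ennreal (exp (- (s - pred_time J s) * \<psi> (?C s)))"
      using pred_time_bounds(2)[OF J(1), of s] J c by (intro mu_laplace) auto
  qed
  also have "\<dots> = ennreal (exp (- (\<Sum>s\<in>J. (s - pred_time J s) * \<psi> (?C s))))"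
    using J(1) by (simp add: prod_ennreal exp_sum[symmetric] sum_negf[symmetric] algebra_simps)
  finally show ?thesis by (simp only: path_exponent_eq[OF J])
qed

text \<open>Restricting to \<open>J\<close> means giving coefficient 0 to the times in
  \<open>H - J\<close>, and \<open>path_exponent\<close> does not notice such times.\<close>

lemma fdd_projective:
  assumes JH: "J \<subseteq> H" and H: "finite H" "H \<subseteq> {0..}"
  shows "fdd J = distr (fdd H) (PiM J (\<lambda>_. borel)) (\<lambda>f. restrict f J)"
proof -
  have J: "finite J" "J \<subseteq> {0..}" using assms by (auto intro: finite_subset)
  have r: "(\<lambda>f. restrict f J) \<in> measurable (fdd H) (PiM J (\<lambda>_. borel))"
    unfolding measurable_cong_sets[OF fdd_sets refl] by (rule measurable_restrict_subset[OF JH])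
  have mJ[measurable]: "(\<lambda>\<omega>. \<Sum>t\<in>J. c t * \<omega> t) \<in> borel_measurable (PiM J (\<lambda>_. borel :: real measure))" for c
    by (rule borel_measurable_sum, rule borel_measurable_times[OF borel_measurable_const], rule coordinate_measurable)
  show ?thesis
  proof (rule PiM_laplace_unique[OF J(1)])
    show "finite_measure (fdd J)" using fdd_prob by (rule prob_space.finite_measure)
    show "AE \<omega> in fdd J. \<forall>j\<in>J. 0 \<le> \<omega> j" using fdd_AE[OF J] by eventually_elim auto
    show "AE \<omega> in distr (fdd H) (PiM J (\<lambda>_. borel)) (\<lambda>f. restrict f J). \<forall>j\<in>J. 0 \<le> \<omega> j"
    proof (subst AE_distr_iff[OF r])
      show "AE \<omega> in fdd H. \<forall>j\<in>J. 0 \<le> (restrict \<omega> J) j"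
        using fdd_AE[OF H] by eventually_elim (use JH in auto)
      show "{\<omega> \<in> space (PiM J (\<lambda>_. borel :: real measure)). \<forall>j\<in>J. 0 \<le> \<omega> j} \<in> sets (PiM J (\<lambda>_. borel))"
      proof (rule sets.sets_Collect_finite_All[OF _ J(1)])
        fix j assume "j \<in> J"
        note [measurable] = coordinate_measurable[OF this]
        show "{\<omega> \<in> space (PiM J (\<lambda>_. borel :: real measure)). 0 \<le> \<omega> j} \<in> sets (PiM J (\<lambda>_. borel))" by measurable
      qed
    qed
    fix q :: "real \<Rightarrow> real" assume q: "\<And>j. j \<in> J \<Longrightarrow> 0 < q j"
    define q' where "q' t = (if t \<in> J then q t else 0)" for t
    have q': "0 \<le> q' t" for t using q by (simp add: q'_def less_imp_le)
    have s_eq: "(\<Sum>t\<in>H. q' t * w t) = (\<Sum>t\<in>J. q t * w t)" for w :: "real \<Rightarrow> real"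
      using JH H(1) by (intro sum.mono_neutral_cong_right) (auto simp: q'_def)
    have t_eq: "(\<Sum>t\<in>{t\<in>H. u \<le> t}. q' t) = (\<Sum>t\<in>{t\<in>J. u \<le> t}. q t)" for u
      using JH H(1) by (intro sum.mono_neutral_cong_right) (auto simp: q'_def)
    have "(\<integral>\<^sup>+\<omega>. ennreal (exp (- (\<Sum>j\<in>J. q j * \<omega> j))) \<partial>distr (fdd H) (PiM J (\<lambda>_. borel)) (\<lambda>f. restrict f J)) =
        (\<integral>\<^sup>+\<omega>. ennreal (exp (- (\<Sum>j\<in>H. q' j * \<omega> j))) \<partial>fdd H)"
      by (subst nn_integral_distr[OF r]) (simp_all add: s_eq)
    also have "\<dots> = ennreal (exp (- path_exponent H q'))"
      by (rule fdd_laplace[OF H]) (intro sum_nonneg q')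
    also have "path_exponent H q' = path_exponent J q" unfolding path_exponent_def t_eq ..
    also have "ennreal (exp (- path_exponent J q)) = (\<integral>\<^sup>+\<omega>. ennreal (exp (- (\<Sum>j\<in>J. q j * \<omega> j))) \<partial>fdd J)"
      by (rule fdd_laplace[OF J, symmetric]) (intro sum_nonneg, use q in \<open>auto intro: less_imp_le\<close>)
    finally show "(\<integral>\<^sup>+\<omega>. ennreal (exp (- (\<Sum>j\<in>J. q j * \<omega> j))) \<partial>fdd J) =
      (\<integral>\<^sup>+\<omega>. ennreal (exp (- (\<Sum>j\<in>J. q j * \<omega> j))) \<partial>distr (fdd H) (PiM J (\<lambda>_. borel)) (\<lambda>f. restrict f J))" ..
  qed (simp_all add: fdd_sets)
qed

text \<open>Kolmogorov's extension theorem; \<open>lim\<close> is the resulting measure on functions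
  on \<open>[0, \<infinity>)\<close>.\<close>

sublocale polish_projective "{0..}" fdd
  unfolding polish_projective_def
  by (rule projective_family.intro) (simp_all only: fdd_projective fdd_prob)

lemma path_prob: "prob_space lim"
proof (rule prob_spaceI)
  interpret E: prob_space "fdd {}" by (rule fdd_prob)
  have "emeasure lim (emb {0..} {} (space (PiM {} (\<lambda>_. borel)))) = emeasure (fdd {}) (space (PiM {} (\<lambda>_. borel)))"
    by (rule emeasure_lim_emb) auto
  moreover have "emb {0..} {} (space (PiM {} (\<lambda>_. borel))) = space lim"
    by (auto simp: prod_emb_def space_PiM)
  moreover have "space (PiM {} (\<lambda>_. borel)) = space (fdd {})" by (simp add: fdd_def)
  ultimately show "emeasure lim (space lim) = 1" by (simp only: E.emeasure_space_1)
qed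

lemma lim_restrict:
  assumes J: "finite J" "J \<subseteq> {0..}"
  shows "(\<lambda>\<omega>. restrict \<omega> J) \<in> measurable lim (PiM J (\<lambda>_. borel))"
    "distr lim (PiM J (\<lambda>_. borel)) (\<lambda>\<omega>. restrict \<omega> J) = fdd J"
proof -
  show r: "(\<lambda>\<omega>. restrict \<omega> J) \<in> measurable lim (PiM J (\<lambda>_. borel))"
    unfolding measurable_cong_sets[OF sets_lim refl] by (rule measurable_restrict_subset[OF J(2)])
  show "distr lim (PiM J (\<lambda>_. borel)) (\<lambda>\<omega>. restrict \<omega> J) = fdd J"
  proof (rule measure_eqI)
    fix A assume "A \<in> sets (distr lim (PiM J (\<lambda>_. borel)) (\<lambda>\<omega>. restrict \<omega> J))"
    then have A: "A \<in> sets (PiM J (\<lambda>_. borel))" by simp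
    have "emeasure (distr lim (PiM J (\<lambda>_. borel)) (\<lambda>\<omega>. restrict \<omega> J)) A = emeasure lim (emb {0..} J A)"
      using A by (subst emeasure_distr[OF r]) (auto simp: prod_emb_def space_PiM)
    then show "emeasure (distr lim (PiM J (\<lambda>_. borel)) (\<lambda>\<omega>. restrict \<omega> J)) A = emeasure (fdd J) A"
      using emeasure_lim_emb[OF J(2,1) A] by simp
  qed (simp add: fdd_sets)
qed

lemma lim_coordinate: "0 \<le> t \<Longrightarrow> (\<lambda>\<omega>. \<omega> t) \<in> borel_measurable lim"
  unfolding measurable_cong_sets[OF sets_lim refl] by (rule coordinate_measurable) simp

lemma lim_AE_mono:
  assumes "0 \<le> s" "s \<le> t"
  shows "AE \<omega> in lim. 0 \<le> \<omega> s \<and> \<omega> s \<le> \<omega> t"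
proof -
  have J: "finite {s, t}" "{s, t} \<subseteq> {0..}" using assms by auto
  have "AE \<omega> in distr lim (PiM {s, t} (\<lambda>_. borel)) (\<lambda>\<omega>. restrict \<omega> {s, t}). 0 \<le> \<omega> s \<and> \<omega> s \<le> \<omega> t"
    unfolding lim_restrict(2)[OF J] using fdd_AE[OF J] by eventually_elim (use assms in auto)
  then have "AE \<omega> in lim. 0 \<le> (restrict \<omega> {s, t}) s \<and> (restrict \<omega> {s, t}) s \<le> (restrict \<omega> {s, t}) t"
    by (rule AE_distrD[OF lim_restrict(1)[OF J]])
  then show ?thesis by simp
qed

lemma lim_laplace:
  assumes J: "finite J" "J \<subseteq> {0..}" and c: "\<And>s. s \<in> J \<Longrightarrow> 0 \<le> (\<Sum>t\<in>{t\<in>J. s \<le> t}. c t)"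
  shows "(\<integral>\<^sup>+\<omega>. ennreal (exp (- (\<Sum>t\<in>J. c t * \<omega> t))) \<partial>lim) = ennreal (exp (- path_exponent J c))"
proof -
  have [measurable]: "(\<lambda>\<omega>. \<Sum>t\<in>J. c t * \<omega> t) \<in> borel_measurable (PiM J (\<lambda>_. borel :: real measure))"
    by (rule borel_measurable_sum, rule borel_measurable_times[OF borel_measurable_const], rule coordinate_measurable)
  have "(\<integral>\<^sup>+\<omega>. ennreal (exp (- (\<Sum>t\<in>J. c t * \<omega> t))) \<partial>lim) = (\<integral>\<^sup>+\<omega>. ennreal (exp (- (\<Sum>t\<in>J. c t * \<omega> t))) \<partial>fdd J)"
    unfolding lim_restrict(2)[OF J, symmetric]
    by (subst nn_integral_distr[OF lim_restrict(1)[OF J]]) simp_all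
  then show ?thesis using fdd_laplace[OF J, of c] c by simp
qed

text \<open>Here \<open>\<tau>\<close> may repeat values. The tail sums of the coefficients reduce
  to \<open>q i\<close> on \<open>(\<tau> i, \<tau> (Suc i)]\<close>, and since these intervals are
  disjoint, \<open>\<psi>\<close> of the sum is the sum of the \<open>\<psi> (q i)\<close>.\<close>

lemma lim_increments_laplace:
  fixes \<tau> q :: "nat \<Rightarrow> real"
  assumes \<tau>: "mono \<tau>" "0 \<le> \<tau> 0" and q: "\<And>i. i < n \<Longrightarrow> 0 \<le> q i"
  shows "(\<integral>\<^sup>+\<omega>. ennreal (exp (- (\<Sum>i<n. q i * (\<omega> (\<tau> (Suc i)) - \<omega> (\<tau> i))))) \<partial>lim) =
    ennreal (\<Prod>i<n. exp (- (\<tau> (Suc i) - \<tau> i) * \<psi> (q i)))"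
proof -
  define J where "J = \<tau> ` {..n}"
  \<comment> \<open>Each increment puts \<open>+ q i\<close> at its right end and
    \<open>- q i\<close> at its left end; summing over \<open>i\<close> treats shared and coinciding
    times correctly.\<close>
  define c where "c t = (\<Sum>i<n. q i * ((if t = \<tau> (Suc i) then 1 else 0) - (if t = \<tau> i then 1 else 0)))" for t
  have J: "finite J" "J \<subseteq> {0..}" using \<tau> by (auto simp: J_def monoD order_trans[OF \<tau>(2)])
  have c_sum: "(\<Sum>t\<in>J. c t * w t) = (\<Sum>i<n. q i * (w (\<tau> (Suc i)) - w (\<tau> i)))" for w
  proof -
    have "(\<Sum>t\<in>J. c t * w t) = (\<Sum>i<n. \<Sum>t\<in>J. q i * ((if t = \<tau> (Suc i) then w t else 0) - (if t = \<tau> i then w t else 0)))"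
      unfolding c_def sum_distrib_right by (subst sum.swap) (auto intro!: sum.cong)
    also have "\<dots> = (\<Sum>i<n. q i * (w (\<tau> (Suc i)) - w (\<tau> i)))"
    proof (intro sum.cong refl)
      fix i assume "i \<in> {..<n}"
      then have "\<tau> i \<in> J" "\<tau> (Suc i) \<in> J" by (auto simp: J_def)
      then show "(\<Sum>t\<in>J. q i * ((if t = \<tau> (Suc i) then w t else 0) - (if t = \<tau> i then w t else 0))) =
          q i * (w (\<tau> (Suc i)) - w (\<tau> i))"
        using J(1) by (simp add: sum_distrib_left[symmetric] sum_subtractf)
    qed
    finally show ?thesis .
  qed
  have tail: "(\<Sum>t\<in>{t\<in>J. u \<le> t}. c t) = (\<Sum>i<n. q i * indicator {\<tau> i<..\<tau> (Suc i)} u)" for u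
  proof -
    have "(\<Sum>t\<in>{t\<in>J. u \<le> t}. c t) = (\<Sum>t\<in>J. c t * (if u \<le> t then 1 else 0))"
      using J(1) by (simp add: sum.inter_filter if_distrib cong: if_cong)
    also have "\<dots> = (\<Sum>i<n. q i * indicator {\<tau> i<..\<tau> (Suc i)} u)"
      unfolding c_sum
    proof (intro sum.cong refl arg_cong2[where f = "(*)"])
      fix i show "(if u \<le> \<tau> (Suc i) then 1 else 0) - (if u \<le> \<tau> i then 1 else 0) = (indicator {\<tau> i<..\<tau> (Suc i)} u :: real)"
        using monoD[OF \<tau>(1), of i "Suc i"] by (auto simp: indicator_def)
    qed
    finally show ?thesis .
  qed
  have "path_exponent J c = (\<integral>u. (\<Sum>i<n. \<psi> (q i) * indicator {\<tau> i<..\<tau> (Suc i)} u) \<partial>lborel)"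
    unfolding path_exponent_def tail
  proof (intro Bochner_Integration.integral_cong refl)
    fix u
    show "(if 0 < u then \<psi> (\<Sum>i<n. q i * indicator {\<tau> i<..\<tau> (Suc i)} u) else 0) =
      (\<Sum>i<n. \<psi> (q i) * indicator {\<tau> i<..\<tau> (Suc i)} u)"
    proof (cases "\<exists>i<n. u \<in> {\<tau> i<..\<tau> (Suc i)}")
      case True
      then obtain k where k: "k < n" "u \<in> {\<tau> k<..\<tau> (Suc k)}" by auto
      have ind: "indicator {\<tau> i<..\<tau> (Suc i)} u = (if i = k then 1 else 0 :: real)" for i
      proof (cases i k rule: linorder_cases)
        case less
        then have "\<tau> (Suc i) \<le> \<tau> k" by (intro monoD[OF \<tau>(1)]) auto
        then show ?thesis using k less by (auto simp: indicator_def)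
      next
        case greater
        then have "\<tau> (Suc k) \<le> \<tau> i" by (intro monoD[OF \<tau>(1)]) auto
        then show ?thesis using k greater by (auto simp: indicator_def)
      next
        case equal
        then show ?thesis using k by (auto simp: indicator_def)
      qed
      have sums: "(\<Sum>i<n. a i * indicator {\<tau> i<..\<tau> (Suc i)} u) = a k" for a :: "nat \<Rightarrow> real"
      proof -
        have "(\<Sum>i<n. a i * indicator {\<tau> i<..\<tau> (Suc i)} u) = (\<Sum>i<n. if i = k then a i else 0)"
          by (intro sum.cong refl) (simp add: ind)
        then show ?thesis using k by simp
      qed
      have "0 < u" using k monoD[OF \<tau>(1), of 0 k] \<tau>(2) by auto
      then show ?thesis unfolding sums by simp
    next
      case False
      then have "indicator {\<tau> i<..\<tau> (Suc i)} u = (0 :: real)" if "i < n" for i using that by (auto simp: indicator_def)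
      then show ?thesis by (simp add: psi_0)
    qed
  qed
  also have "\<dots> = (\<Sum>i<n. \<integral>u. \<psi> (q i) * indicator {\<tau> i<..\<tau> (Suc i)} u \<partial>lborel)"
    by (intro Bochner_Integration.integral_sum integrable_mult_right integrable_indicator_Ioc)
  also have "\<dots> = (\<Sum>i<n. (\<tau> (Suc i) - \<tau> i) * \<psi> (q i))"
    using monoD[OF \<tau>(1)] by (intro sum.cong refl) auto
  finally have "exp (- path_exponent J c) = (\<Prod>i<n. exp (- (\<tau> (Suc i) - \<tau> i) * \<psi> (q i)))"
    by (simp add: exp_sum[symmetric] sum_negf[symmetric] algebra_simps)
  moreover have "(\<integral>\<^sup>+\<omega>. ennreal (exp (- (\<Sum>t\<in>J. c t * \<omega> t))) \<partial>lim) = ennreal (exp (- path_exponent J c))"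
    by (rule lim_laplace[OF J], unfold tail, intro sum_nonneg mult_nonneg_nonneg q) auto
  ultimately show ?thesis unfolding c_sum by simp
qed

end

section \<open>A right-continuous version of the coordinate process\<close>

lemma right_regularization:
  fixes f :: "real \<Rightarrow> real"
  assumes nn: "\<And>r. r \<in> \<rat> \<Longrightarrow> 0 \<le> r \<Longrightarrow> 0 \<le> f r"
    and mono: "\<And>r s. r \<in> \<rat> \<Longrightarrow> s \<in> \<rat> \<Longrightarrow> 0 \<le> r \<Longrightarrow> r \<le> s \<Longrightarrow> f r \<le> f s"
  defines "g \<equiv> \<lambda>t. Inf (f ` {r \<in> \<rat>. t < r})"
  shows "\<And>t. 0 \<le> t \<Longrightarrow> 0 \<le> g t" and "mono_on {0..} g" and "cadlag g"
    and "\<And>X t. 0 \<le> t \<Longrightarrow> (\<And>n. X n \<in> \<rat>) \<Longrightarrow> (\<And>n. t < X n) \<Longrightarrow> X \<longlonglongrightarrow> t \<Longrightarrow> (\<lambda>n. f (X n)) \<longlonglongrightarrow> g t"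
proof -
  have ne: "f ` {r \<in> \<rat>. t < r} \<noteq> {}" for t :: real
    using Rats_dense_in_real[of t "t + 1"] by auto
  have bdd: "bdd_below (f ` {r \<in> \<rat>. t < r})" if "0 \<le> t" for t
    by (rule bdd_belowI[of _ 0]) (use nn that in auto)
  have g_le: "g t \<le> f r" if "0 \<le> t" "r \<in> \<rat>" "t < r" for t r
    unfolding g_def by (rule cInf_lower[OF _ bdd[OF that(1)]]) (use that in auto)
  have g_ge: "y \<le> g t" if "\<And>r. r \<in> \<rat> \<Longrightarrow> t < r \<Longrightarrow> y \<le> f r" for t y
    unfolding g_def by (rule cInf_greatest[OF ne]) (use that in auto)
  have g_app: "\<exists>r\<in>\<rat>. t < r \<and> f r < y" if "g t < y" for t y
    using cInf_lessD[OF ne, of t y] that unfolding g_def by auto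
  show g0: "0 \<le> g t" if "0 \<le> t" for t
    by (rule g_ge) (use nn that in auto)
  show g_mono: "mono_on {0..} g"
  proof (rule mono_onI)
    fix s t :: real assume "s \<in> {0..}" "t \<in> {0..}" "s \<le> t"
    then show "g s \<le> g t" by (intro g_ge g_le) auto
  qed
  have gm: "g s \<le> g t" if "0 \<le> s" "s \<le> t" for s t
    using mono_onD[OF g_mono, of s t] that by auto
  show "cadlag g" unfolding cadlag_def
  proof (intro conjI allI impI)
    fix t :: real assume t: "0 \<le> t"
    \<comment> \<open>A rational \<open>r > t\<close> with \<open>f r < g t + e\<close> bounds
      \<open>g\<close> on all of \<open>(t, r)\<close>, because the infimum defining
      \<open>g s\<close> includes \<open>f r\<close>.\<close>
    show "continuous (at_right t) g" unfolding continuous_within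
    proof (rule tendstoI)
      fix e :: real assume e: "0 < e"
      then obtain r where r: "r \<in> \<rat>" "t < r" "f r < g t + e" using g_app[of t "g t + e"] by auto
      have "eventually (\<lambda>s. s \<in> {t<..<r}) (at_right t)" using r(2) by (rule eventually_at_right_real)
      then show "eventually (\<lambda>s. dist (g s) (g t) < e) (at_right t)"
      proof eventually_elim
        case (elim s)
        then have "g t \<le> g s" "g s \<le> f r" using gm[of t s] g_le[of s r] r t by auto
        then show ?case using r by (auto simp: dist_real_def)
      qed
    qed
  next
    fix t :: real assume t: "0 < t"
    define l where "l = Sup (g ` {0..<t})"
    have bA: "bdd_above (g ` {0..<t})" by (rule bdd_aboveI[of _ "g t"]) (auto intro: gm)
    have ub: "g s \<le> l" if "0 \<le> s" "s < t" for s
      unfolding l_def by (rule cSup_upper[OF _ bA]) (use that in auto)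
    have "(g \<longlongrightarrow> l) (at_left t)"
    proof (rule tendstoI)
      fix e :: real assume e: "0 < e"
      have "g ` {0..<t} \<noteq> {}" using t by auto
      then obtain s where s: "0 \<le> s" "s < t" "l - e < g s"
        using less_cSup_iff[OF _ bA, of "l - e"] e unfolding l_def[symmetric] by auto
      have "eventually (\<lambda>u. u \<in> {s<..<t}) (at_left t)" using s(2) by (rule eventually_at_left_real)
      then show "eventually (\<lambda>u. dist (g u) l < e) (at_left t)"
      proof eventually_elim
        case (elim u)
        then have "g s \<le> g u" "g u \<le> l" using gm[of s u] ub[of u] s by auto
        then show ?case using s by (auto simp: dist_real_def)
      qed
    qed
    then show "\<exists>l. (g \<longlongrightarrow> l) (at_left t)" by blast
  qed
  show "(\<lambda>n. f (X n)) \<longlonglongrightarrow> g t"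
    if t: "0 \<le> t" and X: "\<And>n. X n \<in> \<rat>" "\<And>n. t < X n" "X \<longlonglongrightarrow> t" for X t
  proof (rule tendstoI)
    fix e :: real assume e: "0 < e"
    then obtain r where r: "r \<in> \<rat>" "t < r" "f r < g t + e" using g_app[of t "g t + e"] by auto
    have "eventually (\<lambda>n. X n < r) sequentially" using X(3) r(2) by (rule order_tendstoD)
    then show "eventually (\<lambda>n. dist (f (X n)) (g t) < e) sequentially"
    proof eventually_elim
      case (elim n)
      have "g t \<le> f (X n)" "f (X n) \<le> f r"
        using g_le[OF t X(1,2)] mono[OF X(1) r(1)] t X(2)[of n] elim by auto
      then show ?case using r by (auto simp: dist_real_def)
    qed
  qed
qed

text \<open>The first multiple of \<open>1 / (m + 1)\<close> strictly after \<open>t\<close>. It is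
  rational and monotone in \<open>t\<close>, and adding 1 to the floor keeps it off \<open>t\<close>
  even when \<open>t\<close> is itself on the grid.\<close>

definition right_grid :: "nat \<Rightarrow> real \<Rightarrow> real" where
  "right_grid m t = (of_int \<lfloor>t * real (Suc m)\<rfloor> + 1) / real (Suc m)"

lemma right_grid_gt: "t < right_grid m t"
  unfolding right_grid_def by (simp add: pos_less_divide_eq del: of_nat_Suc)

lemma right_grid_le: "right_grid m t \<le> t + 1 / real (Suc m)"
proof -
  have "of_int \<lfloor>t * real (Suc m)\<rfloor> / real (Suc m) \<le> t"
    by (simp only: pos_divide_le_eq of_nat_0_less_iff zero_less_Suc of_int_floor_le)
  then show ?thesis unfolding right_grid_def add_divide_distrib by simp
qed

lemma right_grid_mono: "mono (right_grid m)"
  unfolding right_grid_def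
  by (intro monoI divide_right_mono add_right_mono of_int_le_iff[THEN iffD2] floor_mono mult_right_mono) auto

lemma right_grid_Rats: "right_grid m t \<in> \<rat>"
  unfolding right_grid_def by (intro Rats_divide Rats_add Rats_of_int Rats_of_nat Rats_1)

lemma right_grid_tendsto: "(\<lambda>m. right_grid m t) \<longlonglongrightarrow> t"
proof (rule tendsto_sandwich[of "\<lambda>_. t" _ _ "\<lambda>m. t + 1 / real (Suc m)"])
  have "(\<lambda>m. t + 1 / real (Suc m)) \<longlonglongrightarrow> t + 0"
    by (intro tendsto_intros LIMSEQ_Suc[OF lim_const_over_n])
  then show "(\<lambda>m. t + 1 / real (Suc m)) \<longlonglongrightarrow> t" by simp
qed (intro always_eventually allI tendsto_const right_grid_le less_imp_le[OF right_grid_gt])+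

context laplace_semigroup
begin

text \<open>Only rational times are constrained: countably many conditions, hence an event, and of
  probability 1.\<close>

definition good_paths :: "(real \<Rightarrow> real) set" where
  "good_paths = {\<omega> \<in> space lim. \<forall>r\<in>\<rat> \<inter> {0..}. \<forall>s\<in>\<rat> \<inter> {r..}. 0 \<le> \<omega> r \<and> \<omega> r \<le> \<omega> s}"

lemma countable_Rats_Int: "countable (\<rat> \<inter> A :: real set)"
  using countable_rat by (rule countable_Int1)

lemma good_paths_sets: "good_paths \<in> sets lim"
  unfolding good_paths_def
proof (intro sets.sets_Collect_countable_All' countable_Rats_Int sets.sets_Collect_conj)
  fix r s :: real assume rs: "r \<in> \<rat> \<inter> {0..}" "s \<in> \<rat> \<inter> {r..}"
  then have [measurable]: "(\<lambda>\<omega>. \<omega> r) \<in> borel_measurable lim" "(\<lambda>\<omega>. \<omega> s) \<in> borel_measurable lim"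
    by (auto intro: lim_coordinate)
  show "{\<omega> \<in> space lim. 0 \<le> \<omega> r} \<in> sets lim" "{\<omega> \<in> space lim. \<omega> r \<le> \<omega> s} \<in> sets lim" by measurable
qed

lemma good_paths_AE: "AE \<omega> in lim. \<omega> \<in> good_paths"
proof -
  have "AE \<omega> in lim. \<forall>r\<in>\<rat> \<inter> {0..}. \<forall>s\<in>\<rat> \<inter> {r..}. 0 \<le> \<omega> r \<and> \<omega> r \<le> \<omega> s"
    by (intro AE_ball_countable[THEN iffD2] countable_Rats_Int ballI lim_AE_mono) auto
  then show ?thesis using AE_space by eventually_elim (simp add: good_paths_def)
qed

definition Z :: "real \<Rightarrow> (real \<Rightarrow> real) \<Rightarrow> real" where
  "Z t \<omega> = (if \<omega> \<in> good_paths then Inf (\<omega> ` {r \<in> \<rat>. t < r}) else 0)"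

lemma good_path_props:
  assumes "\<omega> \<in> good_paths"
  shows "0 \<le> t \<Longrightarrow> 0 \<le> Z t \<omega>" "mono_on {0..} (\<lambda>t. Z t \<omega>)" "cadlag (\<lambda>t. Z t \<omega>)"
    "0 \<le> t \<Longrightarrow> (\<lambda>m. \<omega> (right_grid m t)) \<longlonglongrightarrow> Z t \<omega>"
proof -
  have 1: "0 \<le> \<omega> r" if "r \<in> \<rat>" "0 \<le> r" for r using assms that by (auto simp: good_paths_def)
  have 2: "\<omega> r \<le> \<omega> s" if "r \<in> \<rat>" "s \<in> \<rat>" "0 \<le> r" "r \<le> s" for r s
    using assms that by (auto simp: good_paths_def)
  note R = right_regularization[of \<omega>, OF 1 2]
  have Z: "(\<lambda>t. Z t \<omega>) = (\<lambda>t. Inf (\<omega> ` {r \<in> \<rat>. t < r}))" using assms by (simp add: Z_def)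
  show "0 \<le> t \<Longrightarrow> 0 \<le> Z t \<omega>" using R(1)[of t] Z by (simp add: fun_eq_iff)
  show "mono_on {0..} (\<lambda>t. Z t \<omega>)" "cadlag (\<lambda>t. Z t \<omega>)" unfolding Z using R(2,3) by auto
  show "0 \<le> t \<Longrightarrow> (\<lambda>m. \<omega> (right_grid m t)) \<longlonglongrightarrow> Z t \<omega>"
    using R(4)[of t "\<lambda>m. right_grid m t"] right_grid_Rats right_grid_gt right_grid_tendsto Z by (simp add: fun_eq_iff)
qed

lemma grid_path_mono:
  assumes "\<omega> \<in> good_paths" "0 \<le> s" "s \<le> t"
  shows "\<omega> (right_grid m s) \<le> \<omega> (right_grid m t)"
  using assms monoD[OF right_grid_mono, of s t m] right_grid_Rats right_grid_gt[of s m]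
  by (auto simp: good_paths_def)

lemma Z_measurable: assumes "0 \<le> t" shows "Z t \<in> borel_measurable lim"
proof (rule borel_measurable_LIMSEQ_real)
  fix m
  have "0 \<le> right_grid m t" using right_grid_gt[of t m] assms by simp
  then have [measurable]: "(\<lambda>\<omega>. \<omega> (right_grid m t)) \<in> borel_measurable lim" by (rule lim_coordinate)
  note [measurable] = good_paths_sets
  show "(\<lambda>\<omega>. if \<omega> \<in> good_paths then \<omega> (right_grid m t) else 0) \<in> borel_measurable lim" by measurable
next
  fix \<omega> show "(\<lambda>m. if \<omega> \<in> good_paths then \<omega> (right_grid m t) else 0) \<longlonglongrightarrow> Z t \<omega>"
    using good_path_props(4)[of \<omega> t] assms by (cases "\<omega> \<in> good_paths") (auto simp: Z_def)
qed

text \<open>The transform passes to the limit along the grid times decreasing to \<open>t\<close>.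
  The law of \<open>Z t\<close> follows without comparing \<open>Z t\<close> with the coordinate at
  \<open>t\<close>.\<close>

lemma Z_laplace: assumes t: "0 \<le> t" and q: "0 \<le> q"
  shows "(\<integral>\<^sup>+\<omega>. ennreal (exp (- (q * Z t \<omega>))) \<partial>lim) = ennreal (exp (- t * \<psi> q))"
proof -
  have g0: "0 \<le> right_grid m t" for m using right_grid_gt[of t m] t by simp
  have "(\<lambda>m. \<integral>\<^sup>+\<omega>. ennreal (exp (- (q * \<omega> (right_grid m t)))) \<partial>lim) \<longlonglongrightarrow> (\<integral>\<^sup>+\<omega>. ennreal (exp (- (q * Z t \<omega>))) \<partial>lim)"
  proof (rule nn_integral_dominated_convergence[where w = "\<lambda>_. 1"])
    show "(\<lambda>\<omega>. ennreal (exp (- (q * \<omega> (right_grid m t))))) \<in> borel_measurable lim" for m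
      using lim_coordinate[OF g0[of m]] by measurable
    show "(\<lambda>\<omega>. ennreal (exp (- (q * Z t \<omega>)))) \<in> borel_measurable lim"
      using Z_measurable[OF t] by measurable
    show "AE \<omega> in lim. ennreal (exp (- (q * \<omega> (right_grid m t)))) \<le> 1" for m
      using good_paths_AE
    proof eventually_elim
      case (elim \<omega>)
      then have "0 \<le> \<omega> (right_grid m t)" using g0[of m] right_grid_Rats by (auto simp: good_paths_def)
      then show ?case using q by simp
    qed
    show "AE \<omega> in lim. (\<lambda>m. ennreal (exp (- (q * \<omega> (right_grid m t))))) \<longlonglongrightarrow> ennreal (exp (- (q * Z t \<omega>)))"
      using good_paths_AE by eventually_elim (intro tendsto_intros tendsto_ennrealI good_path_props t)
  qed (auto simp: P.emeasure_space_1[simplified])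
  moreover have "(\<integral>\<^sup>+\<omega>. ennreal (exp (- (q * \<omega> (right_grid m t)))) \<partial>lim) = ennreal (exp (- (right_grid m t * \<psi> q)))" for m
  proof -
    have J: "finite {right_grid m t}" "{right_grid m t} \<subseteq> {0..}" using g0 by auto
    have s: "{u. u = right_grid m t \<and> right_grid m t \<le> u} = {right_grid m t}" by auto
    have "{u \<in> {right_grid m t}. u < right_grid m t} = {}" by auto
    then have "pred_time {right_grid m t} (right_grid m t) = 0" unfolding pred_time_def by (simp only: Max_singleton)
    then have "path_exponent {right_grid m t} (\<lambda>_. q) = right_grid m t * \<psi> q"
      unfolding path_exponent_eq[OF J, symmetric] by (simp add: s)
    then show ?thesis using lim_laplace[OF J, of "\<lambda>_. q"] q by (simp add: sum_nonneg)
  qed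
  moreover have "(\<lambda>m. ennreal (exp (- (right_grid m t * \<psi> q)))) \<longlonglongrightarrow> ennreal (exp (- (t * \<psi> q)))"
    by (intro tendsto_intros tendsto_ennrealI right_grid_tendsto)
  ultimately show ?thesis by (simp add: LIMSEQ_unique)
qed

lemma Z_increments_laplace:
  fixes \<tau> q :: "nat \<Rightarrow> real"
  assumes \<tau>: "mono \<tau>" "0 \<le> \<tau> 0" and q: "\<And>i. i < n \<Longrightarrow> 0 \<le> q i"
  shows "(\<integral>\<^sup>+\<omega>. ennreal (exp (- (\<Sum>i<n. q i * (Z (\<tau> (Suc i)) \<omega> - Z (\<tau> i) \<omega>)))) \<partial>lim) =
    ennreal (\<Prod>i<n. exp (- (\<tau> (Suc i) - \<tau> i) * \<psi> (q i)))"
proof -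
  have \<tau>0: "0 \<le> \<tau> i" for i using monoD[OF \<tau>(1), of 0 i] \<tau>(2) by simp
  have g0: "0 \<le> right_grid m (\<tau> i)" for m i using right_grid_gt[of "\<tau> i" m] \<tau>0[of i] by simp
  have "(\<lambda>m. \<integral>\<^sup>+\<omega>. ennreal (exp (- (\<Sum>i<n. q i * (\<omega> (right_grid m (\<tau> (Suc i))) - \<omega> (right_grid m (\<tau> i)))))) \<partial>lim) \<longlonglongrightarrow>
      (\<integral>\<^sup>+\<omega>. ennreal (exp (- (\<Sum>i<n. q i * (Z (\<tau> (Suc i)) \<omega> - Z (\<tau> i) \<omega>)))) \<partial>lim)"
  proof (rule nn_integral_dominated_convergence[where w = "\<lambda>_. 1"])
    fix m
    note [measurable] = lim_coordinate[OF g0] Z_measurable[OF \<tau>0]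
    show "(\<lambda>\<omega>. ennreal (exp (- (\<Sum>i<n. q i * (\<omega> (right_grid m (\<tau> (Suc i))) - \<omega> (right_grid m (\<tau> i))))))) \<in> borel_measurable lim"
      by measurable
    show "(\<lambda>\<omega>. ennreal (exp (- (\<Sum>i<n. q i * (Z (\<tau> (Suc i)) \<omega> - Z (\<tau> i) \<omega>))))) \<in> borel_measurable lim"
      by measurable
    show "AE \<omega> in lim. ennreal (exp (- (\<Sum>i<n. q i * (\<omega> (right_grid m (\<tau> (Suc i))) - \<omega> (right_grid m (\<tau> i)))))) \<le> 1"
      using good_paths_AE
    proof eventually_elim
      case (elim \<omega>)
      have "0 \<le> (\<Sum>i<n. q i * (\<omega> (right_grid m (\<tau> (Suc i))) - \<omega> (right_grid m (\<tau> i))))"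
        using grid_path_mono[OF elim \<tau>0 monoD[OF \<tau>(1)]] q by (intro sum_nonneg mult_nonneg_nonneg) auto
      then show ?case by simp
    qed
  next
    show "AE \<omega> in lim. (\<lambda>m. ennreal (exp (- (\<Sum>i<n. q i * (\<omega> (right_grid m (\<tau> (Suc i))) - \<omega> (right_grid m (\<tau> i))))))) \<longlonglongrightarrow>
        ennreal (exp (- (\<Sum>i<n. q i * (Z (\<tau> (Suc i)) \<omega> - Z (\<tau> i) \<omega>))))"
      using good_paths_AE by eventually_elim (intro tendsto_intros tendsto_ennrealI good_path_props \<tau>0)
  qed (auto simp: P.emeasure_space_1[simplified])
  moreover have "(\<integral>\<^sup>+\<omega>. ennreal (exp (- (\<Sum>i<n. q i * (\<omega> (right_grid m (\<tau> (Suc i))) - \<omega> (right_grid m (\<tau> i)))))) \<partial>lim) =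
      ennreal (\<Prod>i<n. exp (- (right_grid m (\<tau> (Suc i)) - right_grid m (\<tau> i)) * \<psi> (q i)))" for m
  proof (rule lim_increments_laplace[of "\<lambda>i. right_grid m (\<tau> i)"])
    show "mono (\<lambda>i. right_grid m (\<tau> i))"
      by (intro monoI monoD[OF right_grid_mono] monoD[OF \<tau>(1)])
  qed (use g0 q in auto)
  moreover have "(\<lambda>m. ennreal (\<Prod>i<n. exp (- (right_grid m (\<tau> (Suc i)) - right_grid m (\<tau> i)) * \<psi> (q i)))) \<longlonglongrightarrow>
      ennreal (\<Prod>i<n. exp (- (\<tau> (Suc i) - \<tau> i) * \<psi> (q i)))"
    by (intro tendsto_intros tendsto_ennrealI right_grid_tendsto)
  ultimately show ?thesis by (simp add: LIMSEQ_unique)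
qed

text \<open>At time 0 the transform at rate 1 equals 1, so the nonnegative variable
  \<open>1 - exp (- Z 0)\<close> has mean 0.\<close>

lemma Z_0_AE: "AE \<omega> in lim. Z 0 \<omega> = 0"
proof -
  note [measurable] = Z_measurable[of 0, simplified]
  have nn: "AE \<omega> in lim. 0 \<le> Z 0 \<omega>"
    using good_paths_AE by eventually_elim (simp add: good_path_props)
  have "integrable lim (\<lambda>\<omega>. exp (- Z 0 \<omega>))"
    by (rule P.integrable_const_bound[where B = 1]) (use nn in \<open>auto elim!: eventually_mono\<close>)
  then have int: "integrable lim (\<lambda>\<omega>. 1 - exp (- Z 0 \<omega>))" by simp
  have "ennreal (P.expectation (\<lambda>\<omega>. exp (- Z 0 \<omega>))) = ennreal 1"
    using Z_laplace[of 0 1] \<open>integrable lim (\<lambda>\<omega>. exp (- Z 0 \<omega>))\<close> by (simp add: nn_integral_eq_integral)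
  then have "P.expectation (\<lambda>\<omega>. exp (- Z 0 \<omega>)) = 1" by (subst (asm) ennreal_inj) auto
  then have "P.expectation (\<lambda>\<omega>. 1 - exp (- Z 0 \<omega>)) = 0"
    using \<open>integrable lim (\<lambda>\<omega>. exp (- Z 0 \<omega>))\<close> by (simp add: P.prob_space[simplified])
  then have "AE \<omega> in lim. 1 - exp (- Z 0 \<omega>) = 0"
    using nn by (subst (asm) integral_nonneg_eq_0_iff_AE[OF int]) (auto elim!: eventually_mono)
  then show ?thesis by eventually_elim simp
qed

text \<open>A subordinator has to start from 0 on every path, whereas \<open>Z 0\<close> vanishes
  only almost surely; the exceptional paths are replaced by the zero path.\<close>

definition Y :: "real \<Rightarrow> (real \<Rightarrow> real) \<Rightarrow> real" where
  "Y t \<omega> = (if Z 0 \<omega> = 0 then Z t \<omega> else 0)"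

lemma Y_AE: "AE \<omega> in lim. \<forall>t. Y t \<omega> = Z t \<omega>"
  using Z_0_AE by eventually_elim (simp add: Y_def)

lemma Y_measurable: "0 \<le> t \<Longrightarrow> Y t \<in> borel_measurable lim"
  using Z_measurable[of t] Z_measurable[of 0] unfolding Y_def[abs_def] by measurable

lemma Y_paths: "Y 0 \<omega> = 0" "mono_on {0..} (\<lambda>t. Y t \<omega>)" "cadlag (\<lambda>t. Y t \<omega>)"
proof -
  have c0: "cadlag (\<lambda>_. 0)" by (auto simp: cadlag_def)
  show "Y 0 \<omega> = 0" by (simp add: Y_def)
  have "mono_on {0..} (\<lambda>t. Y t \<omega>) \<and> cadlag (\<lambda>t. Y t \<omega>)"
  proof (cases "\<omega> \<in> good_paths \<and> Z 0 \<omega> = 0")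
    case True
    then show ?thesis using good_path_props(2,3)[of \<omega>] by (simp add: Y_def)
  next
    case False
    then have "(\<lambda>t. Y t \<omega>) = (\<lambda>_. 0)" by (auto simp: Y_def Z_def)
    then show ?thesis using c0 by (simp add: mono_on_def)
  qed
  then show "mono_on {0..} (\<lambda>t. Y t \<omega>)" "cadlag (\<lambda>t. Y t \<omega>)" by auto
qed

lemma Y_mono: "0 \<le> s \<Longrightarrow> s \<le> t \<Longrightarrow> Y s \<omega> \<le> Y t \<omega>"
  using mono_onD[OF Y_paths(2), of s t] by simp

lemma Y_laplace: "0 \<le> t \<Longrightarrow> 0 \<le> q \<Longrightarrow> (\<integral>\<^sup>+\<omega>. ennreal (exp (- (q * Y t \<omega>))) \<partial>lim) = ennreal (exp (- t * \<psi> q))"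
  unfolding Z_laplace[symmetric] by (rule nn_integral_cong_AE) (use Y_AE in eventually_elim, simp)

lemma Y_increments_laplace:
  fixes \<tau> q :: "nat \<Rightarrow> real"
  assumes "mono \<tau>" "0 \<le> \<tau> 0" and q: "\<And>i. i < n \<Longrightarrow> 0 \<le> q i"
  shows "(\<integral>\<^sup>+\<omega>. ennreal (exp (- (\<Sum>i<n. q i * (Y (\<tau> (Suc i)) \<omega> - Y (\<tau> i) \<omega>)))) \<partial>lim) =
    ennreal (\<Prod>i<n. exp (- (\<tau> (Suc i) - \<tau> i) * \<psi> (q i)))"
proof -
  have "(\<integral>\<^sup>+\<omega>. ennreal (exp (- (\<Sum>i<n. q i * (Y (\<tau> (Suc i)) \<omega> - Y (\<tau> i) \<omega>)))) \<partial>lim) =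
      (\<integral>\<^sup>+\<omega>. ennreal (exp (- (\<Sum>i<n. q i * (Z (\<tau> (Suc i)) \<omega> - Z (\<tau> i) \<omega>)))) \<partial>lim)"
    by (rule nn_integral_cong_AE) (use Y_AE in eventually_elim, simp)
  then show ?thesis using Z_increments_laplace[of \<tau> n q] assms by simp
qed

lemma Y_increment_laplace:
  assumes "0 \<le> s" "s \<le> t" "0 \<le> q"
  shows "(\<integral>\<^sup>+\<omega>. ennreal (exp (- (q * (Y t \<omega> - Y s \<omega>)))) \<partial>lim) = ennreal (exp (- (t - s) * \<psi> q))"
proof -
  have "mono (\<lambda>i::nat. if i = 0 then s else t)" using assms by (auto intro!: monoI)
  from Y_increments_laplace[OF this, of 1 "\<lambda>_. q"] assms show ?thesis by simp
qed

lemma Y_subordinator: "unkilled_subordinator lim Y"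
  unfolding unkilled_subordinator_def
proof (intro conjI allI impI ballI path_prob Y_measurable Y_paths)
  fix s t :: real assume st: "0 \<le> s" "0 \<le> t"
  have [measurable]: "Y (s + t) \<in> borel_measurable lim" "Y s \<in> borel_measurable lim" "Y t \<in> borel_measurable lim"
    using st by (auto intro: Y_measurable)
  show "distr lim borel (\<lambda>\<omega>. Y (s + t) \<omega> - Y s \<omega>) = distr lim borel (Y t)"
  proof (rule laplace_unique)
    show "emeasure (distr lim borel (\<lambda>\<omega>. Y (s + t) \<omega> - Y s \<omega>)) {..<0} = 0"
    proof -
      have "(\<lambda>\<omega>. Y (s + t) \<omega> - Y s \<omega>) -` {..<0} \<inter> space lim = {}"
        using Y_mono[of s "s + t"] st by (auto simp flip: not_le)
      then show ?thesis by (subst emeasure_distr) auto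
    qed
    show "emeasure (distr lim borel (Y t)) {..<0} = 0"
    proof -
      have "Y t -` {..<0} \<inter> space lim = {}"
        using Y_mono[of 0 t] Y_paths(1) st by (auto simp flip: not_le)
      then show ?thesis by (subst emeasure_distr) auto
    qed
    fix q :: real assume q: "0 < q"
    have 1: "(\<integral>\<^sup>+x. ennreal (exp (- q * x)) \<partial>distr lim borel (\<lambda>\<omega>. Y (s + t) \<omega> - Y s \<omega>)) = ennreal (exp (- t * \<psi> q))"
      using Y_increment_laplace[of s "s + t" q] st q by (subst nn_integral_distr) auto
    moreover have "(\<integral>\<^sup>+x. ennreal (exp (- q * x)) \<partial>distr lim borel (Y t)) = ennreal (exp (- t * \<psi> q))"
      using Y_laplace[of t q] st q by (subst nn_integral_distr) auto
    ultimately show "(\<integral>\<^sup>+x. ennreal (exp (- q * x)) \<partial>distr lim borel (\<lambda>\<omega>. Y (s + t) \<omega> - Y s \<omega>)) =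
      (\<integral>\<^sup>+x. ennreal (exp (- q * x)) \<partial>distr lim borel (Y t))" by simp
    show "(\<integral>\<^sup>+x. ennreal (exp (- q * x)) \<partial>distr lim borel (\<lambda>\<omega>. Y (s + t) \<omega> - Y s \<omega>)) < \<infinity>"
      unfolding 1 by simp
  qed simp_all
next
  fix n :: nat and \<tau> :: "nat \<Rightarrow> real" assume \<tau>: "0 \<le> \<tau> 0 \<and> mono \<tau>"
  have \<tau>0: "0 \<le> \<tau> i" "\<tau> i \<le> \<tau> (Suc i)" for i
    using monoD[of \<tau> 0 i] monoD[of \<tau> i "Suc i"] \<tau> by auto
  show "P.indep_vars (\<lambda>_. borel) (\<lambda>i \<omega>. Y (\<tau> (Suc i)) \<omega> - Y (\<tau> i) \<omega>) {..<n}"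
  proof (rule P.indep_vars_laplace)
    show "(\<lambda>\<omega>. Y (\<tau> (Suc i)) \<omega> - Y (\<tau> i) \<omega>) \<in> borel_measurable lim" for i
      using Y_measurable[OF \<tau>0(1)] by measurable
    show "AE \<omega> in lim. 0 \<le> Y (\<tau> (Suc i)) \<omega> - Y (\<tau> i) \<omega>" for i
      using Y_mono[OF \<tau>0] by simp
    fix q :: "nat \<Rightarrow> real" assume q: "\<And>i. i \<in> {..<n} \<Longrightarrow> 0 < q i"
    have "(\<integral>\<^sup>+\<omega>. ennreal (exp (- (\<Sum>i<n. q i * (Y (\<tau> (Suc i)) \<omega> - Y (\<tau> i) \<omega>)))) \<partial>lim) =
        (\<Prod>i<n. ennreal (exp (- (\<tau> (Suc i) - \<tau> i) * \<psi> (q i))))"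
      using \<tau> q by (subst Y_increments_laplace) (auto simp: prod_ennreal less_imp_le)
    also have "\<dots> = (\<Prod>i<n. \<integral>\<^sup>+\<omega>. ennreal (exp (- (q i * (Y (\<tau> (Suc i)) \<omega> - Y (\<tau> i) \<omega>)))) \<partial>lim)"
      using q by (intro prod.cong refl Y_increment_laplace[symmetric] \<tau>0) (auto simp: less_imp_le)
    finally show "(\<integral>\<^sup>+\<omega>. ennreal (exp (- (\<Sum>i<n. q i * (Y (\<tau> (Suc i)) \<omega> - Y (\<tau> i) \<omega>)))) \<partial>lim) =
        (\<Prod>i<n. \<integral>\<^sup>+\<omega>. ennreal (exp (- (q i * (Y (\<tau> (Suc i)) \<omega> - Y (\<tau> i) \<omega>)))) \<partial>lim)" .
  qed simp
qed

text \<open>The killing rate is 0, so the killing time is constantly \<infinity>. It generates only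
  the empty set and the whole space, which are independent of everything.\<close>

lemma subordinator_exists:
  "subordinator lim 0 (kill_at (\<lambda>_. \<infinity>) Y) \<and> has_laplace_exponent lim (kill_at (\<lambda>_. \<infinity>) Y) \<psi>"
proof
  let ?P = "vimage_algebra (space lim) (\<lambda>\<omega>. \<lambda>t\<in>{0..}. Y t \<omega>) (PiM {0..} (\<lambda>_. borel))"
  have "(\<lambda>\<omega>. \<lambda>t\<in>{0..}. Y t \<omega>) \<in> measurable lim (PiM {0..} (\<lambda>_. borel))"
    by (rule measurable_restrict) (auto intro: Y_measurable)
  then have P: "sets ?P \<subseteq> P.events" by (rule sets_image_in_sets[OF refl])
  have "sets (vimage_algebra (space lim) (\<lambda>_. \<infinity> :: ennreal) borel) \<subseteq> {{}, space lim}"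
    by (subst sets_vimage_algebra2) auto
  then have "P.indep_set (sets ?P) (sets (vimage_algebra (space lim) (\<lambda>_. \<infinity> :: ennreal) borel))"
  proof (intro P.indep_setI P)
    assume B: "sets (vimage_algebra (space lim) (\<lambda>_. \<infinity> :: ennreal) borel) \<subseteq> {{}, space lim}"
    then show "sets (vimage_algebra (space lim) (\<lambda>_. \<infinity> :: ennreal) borel) \<subseteq> P.events" by blast
    fix a b assume "a \<in> sets ?P" "b \<in> sets (vimage_algebra (space lim) (\<lambda>_. \<infinity> :: ennreal) borel)"
    then have "a \<subseteq> space lim" "b = {} \<or> b = space lim"
      using sets.sets_into_space[of a lim] P B by auto
    then show "P.prob (a \<inter> b) = P.prob a * P.prob b"
      using P.prob_space by (elim disjE) (simp_all add: Int_absorb2 del: space_lim)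
  qed
  then have "(\<lambda>_. \<infinity> :: ennreal) \<in> borel_measurable lim \<and> (\<forall>\<omega>\<in>space lim. 0 < (\<infinity> :: ennreal)) \<and>
      (\<forall>t\<ge>0. P.prob {\<omega> \<in> space lim. ennreal t < \<infinity>} = exp (- 0 * t)) \<and>
      P.indep_set (sets ?P) (sets (vimage_algebra (space lim) (\<lambda>_. \<infinity> :: ennreal) borel))"
    by (simp add: P.prob_space[simplified])
  then show "subordinator lim 0 (kill_at (\<lambda>_. \<infinity>) Y)"
    unfolding subordinator_def using Y_subordinator
    by (intro conjI order_refl exI[of _ Y] exI[of _ "\<lambda>_. \<infinity>"]) auto
  show "has_laplace_exponent lim (kill_at (\<lambda>_. \<infinity>) Y) \<psi>"
    unfolding has_laplace_exponent_def
  proof (intro allI impI)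
    fix q :: real assume q: "0 \<le> q"
    have [measurable]: "Y 1 \<in> borel_measurable lim" by (rule Y_measurable) simp
    have Y0: "0 \<le> Y 1 \<omega>" for \<omega> using Y_mono[of 0 1 \<omega>] Y_paths(1)[of \<omega>] by simp
    have "exp_neg q (kill_at (\<lambda>_. \<infinity>) Y 1 \<omega>) = exp (- (q * Y 1 \<omega>))" for \<omega>
      using Y0 by (simp add: exp_neg_def kill_at_def)
    then have "(\<integral>\<omega>. exp_neg q (kill_at (\<lambda>_. \<infinity>) Y 1 \<omega>) \<partial>lim) = (\<integral>\<omega>. exp (- (q * Y 1 \<omega>)) \<partial>lim)" by simp
    also have "\<dots> = exp (- \<psi> q)"
      using Y_laplace[of 1 q] q by (subst integral_eq_nn_integral) auto
    finally show "\<psi> q = - ln (\<integral>\<omega>. exp_neg q (kill_at (\<lambda>_. \<infinity>) Y 1 \<omega>) \<partial>lim)" by simp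
  qed
qed

end

lemma (in levy_exponent) psi_subordinator_exponent: "subordinator_exponent \<psi>"
proof -
  interpret laplace_semigroup \<psi>
    by unfold_locales (erule psi_nonneg | rule psi_0 | rule psi_tendsto_0 | erule exp_psi_cm)+
  obtain d L where "levy_khintchine \<psi> 0 d L" using psi_levy_khintchine by auto
  then show ?thesis
    using subordinator_exists unfolding subordinator_exponent_def subordinator_with_def by blast
qed

section \<open>The area under a killed subordinator\<close>

lemma mono_integral_bounds:
  fixes f :: "real \<Rightarrow> real"
  assumes f: "mono_on {0..} f" and "0 \<le> s" "s \<le> r"
  shows "(r - s) * f s \<le> integral {0..r} f - integral {0..s} f"
    "integral {0..r} f - integral {0..s} f \<le> (r - s) * f r"
proof -
  have int: "f integrable_on {a..b}" if "0 \<le> a" for a b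
    by (rule integrable_on_mono_on) (rule mono_on_subset[OF f], use that in auto)
  have eq: "integral {0..r} f - integral {0..s} f = integral {s..r} f"
    using Henstock_Kurzweil_Integration.integral_combine[where a = 0 and c = s and b = r and f = f] assms int[of 0 r] by simp
  have "integral {s..r} (\<lambda>_. f s) \<le> integral {s..r} f"
    by (rule integral_le) (use assms int in \<open>auto intro: mono_onD[OF f]\<close>)
  moreover have "integral {s..r} f \<le> integral {s..r} (\<lambda>_. f r)"
    by (rule integral_le) (use assms int in \<open>auto intro: mono_onD[OF f]\<close>)
  ultimately show "(r - s) * f s \<le> integral {0..r} f - integral {0..s} f"
    "integral {0..r} f - integral {0..s} f \<le> (r - s) * f r"
    unfolding eq using assms by simp_all
qed

text \<open>On each cell the upper sum exceeds the integral by at most \<open>h\<close> times the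
  increase of \<open>f\<close>, and these errors telescope. No continuity of \<open>f\<close>
  enters.\<close>

lemma mono_riemann_sum:
  fixes f :: "real \<Rightarrow> real"
  assumes f: "mono_on {0..} f" and h: "0 \<le> h"
  shows "integral {0..real m * h} f \<le> h * (\<Sum>k<m. f (real (Suc k) * h)) \<and>
    h * (\<Sum>k<m. f (real (Suc k) * h)) \<le> integral {0..real m * h} f + h * (f (real m * h) - f 0)"
proof (induction m)
  case (Suc m)
  have le: "real m * h \<le> real (Suc m) * h" using h by (intro mult_right_mono) auto
  have "real (Suc m) * h - real m * h = h" by (simp add: algebra_simps)
  then have "h * f (real m * h) \<le> integral {0..real (Suc m) * h} f - integral {0..real m * h} f"
    "integral {0..real (Suc m) * h} f - integral {0..real m * h} f \<le> h * f (real (Suc m) * h)"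
    using mono_integral_bounds[OF f _ le] h by auto
  with Suc show ?case by (simp add: algebra_simps del: of_nat_Suc)
qed simp

lemma mono_riemann_tendsto:
  fixes f :: "real \<Rightarrow> real"
  assumes f: "mono_on {0..} f" and r: "0 \<le> r"
  shows "(\<lambda>n. r / real (Suc n) * (\<Sum>k<Suc n. f (real (Suc k) * (r / real (Suc n))))) \<longlonglongrightarrow> integral {0..r} f"
proof (rule tendsto_sandwich)
  have e: "real (Suc n) * (r / real (Suc n)) = r" for n by (simp del: of_nat_Suc)
  have b: "integral {0..r} f \<le> r / real (Suc n) * (\<Sum>k<Suc n. f (real (Suc k) * (r / real (Suc n)))) \<and>
    r / real (Suc n) * (\<Sum>k<Suc n. f (real (Suc k) * (r / real (Suc n)))) \<le> integral {0..r} f + r / real (Suc n) * (f r - f 0)" for n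
    using mono_riemann_sum[OF f, of "r / real (Suc n)" "Suc n"] r unfolding e by simp
  show "eventually (\<lambda>n. integral {0..r} f \<le> r / real (Suc n) * (\<Sum>k<Suc n. f (real (Suc k) * (r / real (Suc n))))) sequentially"
    using b by (intro always_eventually) blast
  show "eventually (\<lambda>n. r / real (Suc n) * (\<Sum>k<Suc n. f (real (Suc k) * (r / real (Suc n)))) \<le> integral {0..r} f + r / real (Suc n) * (f r - f 0)) sequentially"
    using b by (intro always_eventually) blast
  have "(\<lambda>n. integral {0..r} f + r / real (Suc n) * (f r - f 0)) \<longlonglongrightarrow> integral {0..r} f + 0 * (f r - f 0)"
    by (intro tendsto_intros LIMSEQ_Suc[OF lim_const_over_n])
  then show "(\<lambda>n. integral {0..r} f + r / real (Suc n) * (f r - f 0)) \<longlonglongrightarrow> integral {0..r} f" by simp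
qed simp

text \<open>Cauchy's functional equation: additivity settles integer multiples, and monotonicity
  squeezes the rest between consecutive integers.\<close>

lemma additive_mono_linear:
  fixes f :: "real \<Rightarrow> real"
  assumes add: "\<And>s t. 0 \<le> s \<Longrightarrow> 0 \<le> t \<Longrightarrow> f (s + t) = f s + f t"
    and mono: "\<And>s t. 0 \<le> s \<Longrightarrow> s \<le> t \<Longrightarrow> f s \<le> f t" and t: "0 \<le> t"
  shows "f t = t * f 1"
proof -
  have f0: "f 0 = 0" using add[of 0 0] by simp
  have mult: "f (real n * s) = real n * f s" if "0 \<le> s" for n s
  proof (induction n)
    case (Suc n)
    have "f (real (Suc n) * s) = f (real n * s + s)" by (simp add: algebra_simps)
    then show ?case using add[of "real n * s" s] Suc that by (simp add: algebra_simps)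
  qed (simp add: f0)
  have f1: "0 \<le> f 1" using mono[of 0 1] f0 by simp
  have bound: "\<bar>f t - t * f 1\<bar> \<le> f 1 / real (Suc n)" for n
  proof -
    let ?N = "real (Suc n)"
    \<comment> \<open>\<open>k \<le> t * (n + 1) \<le> k + 1\<close> confines both
      \<open>(n + 1) * f t\<close> and \<open>(n + 1) * t * f 1\<close> to an interval of length
      \<open>f 1\<close>.\<close>
    define k where "k = nat \<lfloor>t * ?N\<rfloor>"
    have "0 \<le> \<lfloor>t * ?N\<rfloor>" using t by simp
    then have k: "real k \<le> t * ?N" "t * ?N \<le> real (Suc k)" unfolding k_def by linarith+
    have "real k * f 1 \<le> ?N * f t" "?N * f t \<le> real (Suc k) * f 1"
      using mono[of "real k * 1" "?N * t"] mono[of "?N * t" "real (Suc k) * 1"] k t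
        mult[of 1 k] mult[of 1 "Suc k"] mult[of t "Suc n"]
      by (simp_all add: mult.commute[of t] del: of_nat_Suc)
    moreover have "real k * f 1 \<le> t * ?N * f 1" "t * ?N * f 1 \<le> real (Suc k) * f 1"
      using k f1 by (auto intro: mult_right_mono)
    ultimately have "\<bar>?N * f t - ?N * (t * f 1)\<bar> \<le> f 1"
      by (simp add: abs_le_iff algebra_simps)
    then have "?N * \<bar>f t - t * f 1\<bar> \<le> f 1"
      by (simp add: right_diff_distrib[symmetric] abs_mult del: of_nat_Suc)
    then show ?thesis by (simp add: pos_le_divide_eq mult.commute del: of_nat_Suc)
  qed
  have "(\<lambda>n. f 1 / real (Suc n)) \<longlonglongrightarrow> 0" by (rule LIMSEQ_Suc[OF lim_const_over_n])
  then have "\<bar>f t - t * f 1\<bar> \<le> 0" using bound by (intro LIMSEQ_le_const) auto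
  then show ?thesis by simp
qed

lemma sigma_sets_vimage_subset:
  assumes f: "f \<in> measurable A N" and "space A = \<Omega>"
  shows "sigma_sets \<Omega> {f -` S \<inter> \<Omega> | S. S \<in> sets N} \<subseteq> sets A"
  unfolding assms(2)[symmetric]
  by (rule sets.sigma_sets_subset) (auto intro: measurable_sets[OF f])

text \<open>Fixes the unkilled path \<open>\<eta>\<close> and the killing time
  \<open>\<zeta>\<close> that \<open>subordinator\<close> only asserts to exist.
  \<open>\<phi>\<close> belongs to the killed process, so the exponent of \<open>\<eta>\<close> is
  \<open>\<phi> - \<kappa>\<close>.\<close>

locale killed_subordinator = prob_space M + levy_exponent \<phi> \<kappa> c \<pi>
  for M :: "'a measure" and \<eta> :: "real \<Rightarrow> 'a \<Rightarrow> real" and \<zeta> :: "'a \<Rightarrow> ennreal"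
    and \<phi> :: "real \<Rightarrow> real" and \<kappa> c :: real and \<pi> :: "real measure" +
  assumes unk: "unkilled_subordinator M \<eta>"
    and zeta_measurable[measurable]: "\<zeta> \<in> borel_measurable M"
    and zeta_pos: "\<omega> \<in> space M \<Longrightarrow> 0 < \<zeta> \<omega>"
    and survival: "0 \<le> t \<Longrightarrow> prob {\<omega> \<in> space M. ennreal t < \<zeta> \<omega>} = exp (- \<kappa> * t)"
    and indep_killing: "indep_set
          (sets (vimage_algebra (space M) (\<lambda>\<omega>. \<lambda>t\<in>{0..}. \<eta> t \<omega>) (PiM {0..} (\<lambda>_. borel))))
          (sets (vimage_algebra (space M) \<zeta> borel))"
    and laplace: "has_laplace_exponent M (kill_at \<zeta> \<eta>) \<phi>"
begin

lemma eta_measurable: "0 \<le> t \<Longrightarrow> \<eta> t \<in> borel_measurable M"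
  using unk by (simp add: unkilled_subordinator_def)

lemma eta_paths: assumes "\<omega> \<in> space M"
  shows "\<eta> 0 \<omega> = 0" "mono_on {0..} (\<lambda>t. \<eta> t \<omega>)" "cadlag (\<lambda>t. \<eta> t \<omega>)"
  using unk assms by (auto simp: unkilled_subordinator_def)

lemma eta_mono: "\<omega> \<in> space M \<Longrightarrow> 0 \<le> s \<Longrightarrow> s \<le> t \<Longrightarrow> \<eta> s \<omega> \<le> \<eta> t \<omega>"
  using mono_onD[OF eta_paths(2)] by simp

lemma eta_nonneg: "\<omega> \<in> space M \<Longrightarrow> 0 \<le> t \<Longrightarrow> 0 \<le> \<eta> t \<omega>"
  using eta_mono[of \<omega> 0 t] eta_paths(1) by simp

text \<open>Survival depends on \<open>\<zeta>\<close> alone and \<open>F\<close> on the path alone,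
  so the expectation factorises. The bound on \<open>F\<close> is asked for on all functions, paths
  or not; this is why \<open>max 0\<close> appears wherever the lemma is applied.\<close>

lemma expectation_killed:
  assumes F[measurable]: "F \<in> borel_measurable (PiM {0..} (\<lambda>_. borel))" and B: "\<And>x. \<bar>F x\<bar> \<le> B" and r: "0 \<le> r"
  shows "(\<integral>\<omega>. indicator {r<..} (\<zeta> \<omega>) * F (\<lambda>t\<in>{0..}. \<eta> t \<omega>) \<partial>M) =
    exp (- \<kappa> * r) * (\<integral>\<omega>. F (\<lambda>t\<in>{0..}. \<eta> t \<omega>) \<partial>M)"
proof -
  let ?X = "\<lambda>\<omega>. \<lambda>t\<in>{0..}. \<eta> t \<omega>"
  have X[measurable]: "?X \<in> measurable M (PiM {0..} (\<lambda>_. borel))"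
    by (rule measurable_restrict) (auto intro: eta_measurable)
  let ?A = "vimage_algebra (space M) ?X (PiM {0..} (\<lambda>_. borel))" and ?B = "vimage_algebra (space M) \<zeta> borel"
  let ?I = "\<lambda>z. indicat_real {ennreal r<..} z"
  have "F \<circ> ?X \<in> borel_measurable ?A"
    by (rule measurable_comp[OF measurable_vimage_algebra1 F]) (use measurable_space[OF X] in auto)
  then have sA: "sigma_sets (space M) {(F \<circ> ?X) -` S \<inter> space M | S. S \<in> sets borel} \<subseteq> sets ?A"
    by (rule sigma_sets_vimage_subset) simp
  have "?I \<circ> \<zeta> \<in> borel_measurable ?B"
    by (rule measurable_comp[OF measurable_vimage_algebra1]) auto
  then have sB: "sigma_sets (space M) {(?I \<circ> \<zeta>) -` S \<inter> space M | S. S \<in> sets borel} \<subseteq> sets ?B"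
    by (rule sigma_sets_vimage_subset) simp
  have "indep_var borel (F \<circ> ?X) borel (?I \<circ> \<zeta>)"
    unfolding indep_var_eq
  proof (intro conjI indep_setI)
    fix a b assume "a \<in> sigma_sets (space M) {(F \<circ> ?X) -` S \<inter> space M | S. S \<in> sets borel}"
      and "b \<in> sigma_sets (space M) {(?I \<circ> \<zeta>) -` S \<inter> space M | S. S \<in> sets borel}"
    then show "prob (a \<inter> b) = prob a * prob b" using sA sB by (intro indep_setD[OF indep_killing]) auto
  qed (use sA sB indep_setD_ev1[OF indep_killing] indep_setD_ev2[OF indep_killing] X in \<open>auto simp: comp_def\<close>)
  then have "(\<integral>\<omega>. (F \<circ> ?X) \<omega> * ((\<lambda>z. indicat_real {ennreal r<..} z) \<circ> \<zeta>) \<omega> \<partial>M) =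
      (\<integral>\<omega>. (F \<circ> ?X) \<omega> \<partial>M) * (\<integral>\<omega>. ((\<lambda>z. indicat_real {ennreal r<..} z) \<circ> \<zeta>) \<omega> \<partial>M)"
  proof (rule indep_var_lebesgue_integral)
    show "integrable M (F \<circ> ?X)"
      by (rule integrable_const_bound[where B = B]) (use B in \<open>auto simp: comp_def\<close>)
    show "integrable M ((\<lambda>z. indicat_real {ennreal r<..} z) \<circ> \<zeta>)"
      by (rule integrable_const_bound[where B = 1]) (auto simp: comp_def)
  qed
  also have "(\<integral>\<omega>. ((\<lambda>z. indicat_real {ennreal r<..} z) \<circ> \<zeta>) \<omega> \<partial>M) = prob {\<omega> \<in> space M. ennreal r < \<zeta> \<omega>}"
  proof -
    have "(\<integral>\<omega>. indicat_real {ennreal r<..} (\<zeta> \<omega>) \<partial>M) = (\<integral>\<omega>. indicator {\<omega> \<in> space M. ennreal r < \<zeta> \<omega>} \<omega> \<partial>M)"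
      by (intro Bochner_Integration.integral_cong) (auto simp: indicator_def)
    also have "\<dots> = prob {\<omega> \<in> space M. ennreal r < \<zeta> \<omega>}"
      by (simp add: Int_def cong: conj_cong)
    finally show ?thesis by (simp add: comp_def)
  qed
  also have "\<dots> = exp (- \<kappa> * r)" by (rule survival[OF r])
  finally show ?thesis unfolding comp_def by (simp only: mult.commute)
qed

lemma path_coordinate: "0 \<le> t \<Longrightarrow> (\<lambda>x. x t) \<in> borel_measurable (PiM {0..} (\<lambda>_. borel :: real measure))"
  by (rule measurable_component_singleton) simp

lemma exp_eta_integrable: assumes "0 \<le> t" "0 \<le> q" shows "integrable M (\<lambda>\<omega>. exp (- q * \<eta> t \<omega>))"
proof (rule integrable_const_bound[where B = 1])
  note [measurable] = eta_measurable[OF assms(1)]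
  show "(\<lambda>\<omega>. exp (- q * \<eta> t \<omega>)) \<in> borel_measurable M" by measurable
qed (use assms in \<open>auto simp: eta_nonneg\<close>)

lemma exp_eta_pos: assumes "0 \<le> t" "0 \<le> q" shows "0 < (\<integral>\<omega>. exp (- q * \<eta> t \<omega>) \<partial>M)"
proof -
  have "(\<integral>\<omega>. exp (- q * \<eta> t \<omega>) \<partial>M) \<noteq> 0"
  proof
    assume "(\<integral>\<omega>. exp (- q * \<eta> t \<omega>) \<partial>M) = 0"
    then have "AE \<omega> in M. exp (- q * \<eta> t \<omega>) = 0"
      using integral_nonneg_eq_0_iff_AE[OF exp_eta_integrable[OF assms]] by simp
    then have "AE \<omega> in M. False" by eventually_elim simp
    then show False by simp
  qed
  then show ?thesis by (simp add: less_le integral_nonneg_AE)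
qed

lemma exp_eta_1: assumes q: "0 \<le> q" shows "(\<integral>\<omega>. exp (- q * \<eta> 1 \<omega>) \<partial>M) = exp (- (\<phi> q - \<kappa>))"
proof -
  note [measurable] = path_coordinate[of 1, simplified]
  have "(\<integral>\<omega>. exp_neg q (kill_at \<zeta> \<eta> 1 \<omega>) \<partial>M) = (\<integral>\<omega>. indicator {ennreal 1<..} (\<zeta> \<omega>) * exp (- q * max 0 ((\<lambda>t\<in>{0..}. \<eta> t \<omega>) 1)) \<partial>M)"
    by (intro Bochner_Integration.integral_cong)
      (auto simp: exp_neg_def kill_at_def indicator_def eta_nonneg)
  also have "\<dots> = exp (- \<kappa> * 1) * (\<integral>\<omega>. exp (- q * max 0 ((\<lambda>t\<in>{0..}. \<eta> t \<omega>) 1)) \<partial>M)"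
    by (rule expectation_killed[where B = 1]) (use q in auto)
  also have "(\<integral>\<omega>. exp (- q * max 0 ((\<lambda>t\<in>{0..}. \<eta> t \<omega>) 1)) \<partial>M) = (\<integral>\<omega>. exp (- q * \<eta> 1 \<omega>) \<partial>M)"
    by (intro Bochner_Integration.integral_cong) (auto simp: eta_nonneg)
  finally have "\<phi> q = - ln (exp (- \<kappa>) * (\<integral>\<omega>. exp (- q * \<eta> 1 \<omega>) \<partial>M))"
    using laplace q by (simp add: has_laplace_exponent_def)
  also have "\<dots> = \<kappa> - ln (\<integral>\<omega>. exp (- q * \<eta> 1 \<omega>) \<partial>M)"
    using exp_eta_pos[of 1 q] q by (simp add: ln_mult)
  finally have "ln (\<integral>\<omega>. exp (- q * \<eta> 1 \<omega>) \<partial>M) = - (\<phi> q - \<kappa>)" by simp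
  then show ?thesis using exp_eta_pos[of 1 q] q by (metis exp_ln zero_le_one)
qed

lemma eta_increments:
  assumes \<tau>: "0 \<le> \<tau> 0" "mono \<tau>" and p: "\<And>i. i < n \<Longrightarrow> 0 \<le> p i"
  shows "(\<integral>\<omega>. exp (- (\<Sum>i<n. p i * (\<eta> (\<tau> (Suc i)) \<omega> - \<eta> (\<tau> i) \<omega>))) \<partial>M) =
    (\<Prod>i<n. \<integral>\<omega>. exp (- p i * \<eta> (\<tau> (Suc i) - \<tau> i) \<omega>) \<partial>M)"
proof -
  have \<tau>0: "0 \<le> \<tau> i" "\<tau> i \<le> \<tau> (Suc i)" for i
    using monoD[OF \<tau>(2), of 0 i] monoD[OF \<tau>(2), of i "Suc i"] \<tau>(1) by auto
  have "indep_vars (\<lambda>_. borel) (\<lambda>i \<omega>. \<eta> (\<tau> (Suc i)) \<omega> - \<eta> (\<tau> i) \<omega>) {..<n}"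
    using unk \<tau> by (auto simp: unkilled_subordinator_def)
  then have "indep_vars (\<lambda>_. borel) (\<lambda>i \<omega>. ennreal (exp (- p i * (\<eta> (\<tau> (Suc i)) \<omega> - \<eta> (\<tau> i) \<omega>)))) {..<n}"
    by (rule indep_vars_compose2) simp
  then have nn: "(\<integral>\<^sup>+\<omega>. (\<Prod>i<n. ennreal (exp (- p i * (\<eta> (\<tau> (Suc i)) \<omega> - \<eta> (\<tau> i) \<omega>)))) \<partial>M) =
      (\<Prod>i<n. \<integral>\<^sup>+\<omega>. ennreal (exp (- p i * (\<eta> (\<tau> (Suc i)) \<omega> - \<eta> (\<tau> i) \<omega>))) \<partial>M)"
    by (intro indep_vars_nn_integral) auto
  have m: "(\<lambda>\<omega>. \<eta> (\<tau> (Suc i)) \<omega> - \<eta> (\<tau> i) \<omega>) \<in> borel_measurable M" for i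
    using eta_measurable \<tau>0 by measurable
  have single: "(\<integral>\<^sup>+\<omega>. ennreal (exp (- p i * (\<eta> (\<tau> (Suc i)) \<omega> - \<eta> (\<tau> i) \<omega>))) \<partial>M) =
      ennreal (\<integral>\<omega>. exp (- p i * \<eta> (\<tau> (Suc i) - \<tau> i) \<omega>) \<partial>M)" if "i < n" for i
  proof -
    have "distr M borel (\<lambda>\<omega>. \<eta> (\<tau> i + (\<tau> (Suc i) - \<tau> i)) \<omega> - \<eta> (\<tau> i) \<omega>) = distr M borel (\<eta> (\<tau> (Suc i) - \<tau> i))"
    proof -
      have "\<forall>s\<ge>0. \<forall>t\<ge>0. distr M borel (\<lambda>\<omega>. \<eta> (s + t) \<omega> - \<eta> s \<omega>) = distr M borel (\<eta> t)"
        using unk by (simp add: unkilled_subordinator_def)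
      from this[rule_format, of "\<tau> i" "\<tau> (Suc i) - \<tau> i"] show ?thesis using \<tau>0[of i] by simp
    qed
    then have d: "distr M borel (\<lambda>\<omega>. \<eta> (\<tau> (Suc i)) \<omega> - \<eta> (\<tau> i) \<omega>) = distr M borel (\<eta> (\<tau> (Suc i) - \<tau> i))" by simp
    have "(\<integral>\<^sup>+\<omega>. ennreal (exp (- p i * (\<eta> (\<tau> (Suc i)) \<omega> - \<eta> (\<tau> i) \<omega>))) \<partial>M) =
        (\<integral>\<^sup>+x. ennreal (exp (- p i * x)) \<partial>distr M borel (\<lambda>\<omega>. \<eta> (\<tau> (Suc i)) \<omega> - \<eta> (\<tau> i) \<omega>))"
      by (subst nn_integral_distr[OF m]) auto
    also have "\<dots> = (\<integral>\<^sup>+\<omega>. ennreal (exp (- p i * \<eta> (\<tau> (Suc i) - \<tau> i) \<omega>)) \<partial>M)"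
      unfolding d using \<tau>0[of i] by (subst nn_integral_distr) (auto intro: eta_measurable)
    also have "\<dots> = ennreal (\<integral>\<omega>. exp (- p i * \<eta> (\<tau> (Suc i) - \<tau> i) \<omega>) \<partial>M)"
      using \<tau>0[of i] p[OF that] by (intro nn_integral_eq_integral exp_eta_integrable) auto
    finally show ?thesis .
  qed
  have "(\<integral>\<^sup>+\<omega>. ennreal (exp (- (\<Sum>i<n. p i * (\<eta> (\<tau> (Suc i)) \<omega> - \<eta> (\<tau> i) \<omega>)))) \<partial>M) =
      ennreal (\<Prod>i<n. \<integral>\<omega>. exp (- p i * \<eta> (\<tau> (Suc i) - \<tau> i) \<omega>) \<partial>M)"
  proof -
    have "(\<integral>\<^sup>+\<omega>. ennreal (exp (- (\<Sum>i<n. p i * (\<eta> (\<tau> (Suc i)) \<omega> - \<eta> (\<tau> i) \<omega>)))) \<partial>M) =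
        (\<integral>\<^sup>+\<omega>. (\<Prod>i<n. ennreal (exp (- p i * (\<eta> (\<tau> (Suc i)) \<omega> - \<eta> (\<tau> i) \<omega>)))) \<partial>M)"
      by (simp add: prod_ennreal exp_sum[symmetric] sum_negf)
    also have "\<dots> = (\<Prod>i<n. ennreal (\<integral>\<omega>. exp (- p i * \<eta> (\<tau> (Suc i) - \<tau> i) \<omega>) \<partial>M))"
      unfolding nn by (intro prod.cong refl single) simp
    also have "\<dots> = ennreal (\<Prod>i<n. \<integral>\<omega>. exp (- p i * \<eta> (\<tau> (Suc i) - \<tau> i) \<omega>) \<partial>M)"
      by (intro prod_ennreal integral_nonneg_AE) auto
    finally show ?thesis .
  qed
  moreover have "0 \<le> (\<Prod>i<n. \<integral>\<omega>. exp (- p i * \<eta> (\<tau> (Suc i) - \<tau> i) \<omega>) \<partial>M)"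
    by (intro prod_nonneg ballI integral_nonneg_AE AE_I2) simp
  ultimately show ?thesis using m by (subst integral_eq_nn_integral) auto
qed

text \<open>Independent stationary increments make \<open>- ln\<close> of the transform additive in
  time, and monotone paths make it monotone, hence linear; its slope was found at time 1.\<close>

lemma exp_eta: assumes q: "0 \<le> q" and t: "0 \<le> t"
  shows "(\<integral>\<omega>. exp (- q * \<eta> t \<omega>) \<partial>M) = exp (- t * (\<phi> q - \<kappa>))"
proof -
  define g where "g t = (\<integral>\<omega>. exp (- q * \<eta> t \<omega>) \<partial>M)" for t
  have g_pos: "0 < g t" if "0 \<le> t" for t unfolding g_def by (rule exp_eta_pos[OF that q])
  have g_add: "g (s + t) = g s * g t" if "0 \<le> s" "0 \<le> t" for s t
  proof -
    define \<tau> where "\<tau> i = (if i = 0 then 0 else if i = 1 then s else s + t)" for i :: nat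
    have m: "mono \<tau>" unfolding mono_def \<tau>_def using that by auto
    have "(\<integral>\<omega>. exp (- (\<Sum>i<2. q * (\<eta> (\<tau> (Suc i)) \<omega> - \<eta> (\<tau> i) \<omega>))) \<partial>M) =
        (\<Prod>i<2. g (\<tau> (Suc i) - \<tau> i))"
      unfolding g_def using q by (intro eta_increments m) (simp_all add: \<tau>_def)
    moreover have "(\<integral>\<omega>. exp (- (\<Sum>i<2. q * (\<eta> (\<tau> (Suc i)) \<omega> - \<eta> (\<tau> i) \<omega>))) \<partial>M) = g (s + t)"
      unfolding g_def
      by (intro Bochner_Integration.integral_cong) (auto simp: numeral_2_eq_2 \<tau>_def eta_paths algebra_simps)
    ultimately show ?thesis by (simp add: numeral_2_eq_2 \<tau>_def)
  qed
  have "- ln (g t) = t * (- ln (g 1))"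
  proof (rule additive_mono_linear[OF _ _ t])
    fix s t :: real assume s: "0 \<le> s"
    show "- ln (g (s + t)) = - ln (g s) + - ln (g t)" if "0 \<le> t"
      using g_pos[OF s] g_pos[OF that] by (simp add: g_add[OF s that] ln_mult)
    show "- ln (g s) \<le> - ln (g t)" if "s \<le> t"
    proof -
      have "g t \<le> g s" unfolding g_def
        using s that q by (intro integral_mono exp_eta_integrable) (auto intro!: mult_left_mono eta_mono)
      then show ?thesis using g_pos[of t] s that by simp
    qed
  qed
  moreover have "ln (g 1) = - (\<phi> q - \<kappa>)" unfolding g_def exp_eta_1[OF q] by simp
  ultimately have "ln (g t) = - t * (\<phi> q - \<kappa>)" by simp
  then show ?thesis using g_pos[OF t] by (metis exp_ln g_def)
qed

definition area :: "real \<Rightarrow> 'a \<Rightarrow> real" where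
  "area r \<omega> = integral {0..r} (\<lambda>u. \<eta> u \<omega>)"

lemma area_riemann:
  assumes "\<omega> \<in> space M" "0 \<le> r"
  shows "(\<lambda>n. r / real (Suc n) * (\<Sum>k<Suc n. \<eta> (real (Suc k) * (r / real (Suc n))) \<omega>)) \<longlonglongrightarrow> area r \<omega>"
  unfolding area_def by (rule mono_riemann_tendsto[OF eta_paths(2)[OF assms(1)] assms(2)])

lemma area_measurable: assumes r: "0 \<le> r" shows "area r \<in> borel_measurable M"
proof (rule borel_measurable_LIMSEQ_real[OF area_riemann[OF _ r]])
  fix n
  have "(\<lambda>\<omega>. \<eta> (real (Suc k) * (r / real (Suc n))) \<omega>) \<in> borel_measurable M" for k
    by (rule eta_measurable) (use r in simp)
  then show "(\<lambda>\<omega>. r / real (Suc n) * (\<Sum>k<Suc n. \<eta> (real (Suc k) * (r / real (Suc n))) \<omega>)) \<in> borel_measurable M"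
    by measurable
qed simp

lemma area_nonneg: assumes "\<omega> \<in> space M" "0 \<le> r" shows "0 \<le> area r \<omega>"
  using mono_integral_bounds(1)[OF eta_paths(2)[OF assms(1)], of 0 r] assms eta_paths(1)
  by (simp add: area_def)

lemma sum_by_parts:
  fixes a :: "nat \<Rightarrow> real"
  shows "(\<Sum>j<n. (real n - real j) * (a (Suc j) - a j)) = (\<Sum>k<n. a (Suc k)) - real n * a 0"
proof (induction n)
  case (Suc n)
  have "(\<Sum>j<Suc n. (real (Suc n) - real j) * (a (Suc j) - a j)) =
      (\<Sum>j<n. (real n - real j) * (a (Suc j) - a j)) + (\<Sum>j<Suc n. a (Suc j) - a j)"
    by (simp add: sum.distrib[symmetric] algebra_simps)
  also have "(\<Sum>j<Suc n. a (Suc j) - a j) = a (Suc n) - a 0" by (rule sum_lessThan_telescope)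
  finally show ?case using Suc by (simp add: algebra_simps)
qed simp

text \<open>By parts, \<open>q * \<eta> r\<close> plus \<open>l\<close> times the Riemann sum of the
  area becomes a combination of independent increments. The one starting at \<open>j * h\<close>
  lies below the path at \<open>n - j\<close> grid points, whence its rate
  \<open>q + l * h * (n - j)\<close>.\<close>

lemma area_laplace_discrete:
  assumes q: "0 \<le> q" and l: "0 \<le> l" and r: "0 \<le> r" and n: "0 < n"
  defines "h \<equiv> r / real n"
  shows "(\<integral>\<omega>. indicator {r<..} (\<zeta> \<omega>) * exp (- q * \<eta> r \<omega> - l * (h * (\<Sum>k<n. \<eta> (real (Suc k) * h) \<omega>))) \<partial>M) =
    exp (- (h * (\<Sum>k<n. \<phi> (q + l * (real (Suc k) * h)))))"
proof -
  have h: "0 \<le> h" "real n * h = r" using r n by (auto simp: h_def)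
  let ?S = "\<lambda>x. q * max 0 (x r) + l * (h * (\<Sum>k<n. max 0 (x (real (Suc k) * h))))"
  have S_eta: "?S (\<lambda>t\<in>{0..}. \<eta> t \<omega>) = q * \<eta> r \<omega> + l * (h * (\<Sum>k<n. \<eta> (real (Suc k) * h) \<omega>))" if "\<omega> \<in> space M" for \<omega>
    using that h r by (simp add: eta_nonneg)
  have S_meas: "?S \<in> borel_measurable (PiM {0..} (\<lambda>_. borel))"
  proof -
    have [measurable]: "(\<lambda>x. x r) \<in> borel_measurable (PiM {0..} (\<lambda>_. borel :: real measure))" by (rule path_coordinate[OF r])
    have [measurable]: "(\<lambda>x. x (real (Suc k) * h)) \<in> borel_measurable (PiM {0..} (\<lambda>_. borel :: real measure))" for k
      by (rule path_coordinate) (use h in simp)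
    show ?thesis by measurable
  qed
  have S_nn: "0 \<le> ?S x" for x using q l h by (intro add_nonneg_nonneg mult_nonneg_nonneg sum_nonneg) auto
  have "(\<integral>\<omega>. indicator {r<..} (\<zeta> \<omega>) * exp (- q * \<eta> r \<omega> - l * (h * (\<Sum>k<n. \<eta> (real (Suc k) * h) \<omega>))) \<partial>M) =
      (\<integral>\<omega>. indicator {r<..} (\<zeta> \<omega>) * exp (- ?S (\<lambda>t\<in>{0..}. \<eta> t \<omega>)) \<partial>M)"
  proof (intro Bochner_Integration.integral_cong refl)
    fix \<omega> assume w: "\<omega> \<in> space M"
    have "- q * \<eta> r \<omega> - l * (h * (\<Sum>k<n. \<eta> (real (Suc k) * h) \<omega>)) = - ?S (\<lambda>t\<in>{0..}. \<eta> t \<omega>)"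
      unfolding S_eta[OF w] by simp
    then show "indicator {r<..} (\<zeta> \<omega>) * exp (- q * \<eta> r \<omega> - l * (h * (\<Sum>k<n. \<eta> (real (Suc k) * h) \<omega>))) =
        indicator {r<..} (\<zeta> \<omega>) * exp (- ?S (\<lambda>t\<in>{0..}. \<eta> t \<omega>))" by (simp only:)
  qed
  also have "\<dots> = exp (- \<kappa> * r) * (\<integral>\<omega>. exp (- ?S (\<lambda>t\<in>{0..}. \<eta> t \<omega>)) \<partial>M)"
  proof (rule expectation_killed[where B = 1 and F = "\<lambda>x. exp (- ?S x)", OF _ _ r])
    show "(\<lambda>x. exp (- ?S x)) \<in> borel_measurable (PiM {0..} (\<lambda>_. borel))"
      using measurable_compose[OF S_meas, of "\<lambda>s. exp (- s)" borel] by simp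
    show "\<bar>exp (- ?S x)\<bar> \<le> 1" for x by (simp only: abs_exp_cancel exp_le_one_iff neg_le_0_iff_le S_nn)
  qed
  also have "(\<integral>\<omega>. exp (- ?S (\<lambda>t\<in>{0..}. \<eta> t \<omega>)) \<partial>M) =
      (\<integral>\<omega>. exp (- (\<Sum>j<n. (q + l * (h * (real n - real j))) * (\<eta> (real (Suc j) * h) \<omega> - \<eta> (real j * h) \<omega>))) \<partial>M)"
  proof (intro Bochner_Integration.integral_cong refl)
    fix \<omega> assume w: "\<omega> \<in> space M"
    have "(\<Sum>j<n. (q + l * (h * (real n - real j))) * (\<eta> (real (Suc j) * h) \<omega> - \<eta> (real j * h) \<omega>)) =
        q * (\<Sum>j<n. \<eta> (real (Suc j) * h) \<omega> - \<eta> (real j * h) \<omega>) +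
        l * h * (\<Sum>j<n. (real n - real j) * (\<eta> (real (Suc j) * h) \<omega> - \<eta> (real j * h) \<omega>))"
      by (simp add: sum_distrib_left sum.distrib[symmetric] algebra_simps)
    also have "\<dots> = q * \<eta> r \<omega> + l * h * (\<Sum>k<n. \<eta> (real (Suc k) * h) \<omega>)"
      using sum_by_parts[where a = "\<lambda>k. \<eta> (real k * h) \<omega>" and n = n]
        sum_lessThan_telescope[of "\<lambda>k. \<eta> (real k * h) \<omega>" n] eta_paths(1)[OF w] h(2) by simp
    finally show "exp (- ?S (\<lambda>t\<in>{0..}. \<eta> t \<omega>)) =
        exp (- (\<Sum>j<n. (q + l * (h * (real n - real j))) * (\<eta> (real (Suc j) * h) \<omega> - \<eta> (real j * h) \<omega>)))"
      unfolding S_eta[OF w] by (simp add: mult.assoc)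
  qed
  also have "\<dots> = (\<Prod>j<n. \<integral>\<omega>. exp (- (q + l * (h * (real n - real j))) * \<eta> (real (Suc j) * h - real j * h) \<omega>) \<partial>M)"
  proof (rule eta_increments)
    show "mono (\<lambda>i. real i * h)" using h by (auto intro!: monoI mult_right_mono)
    show "0 \<le> q + l * (h * (real n - real i))" if "i < n" for i
      using q l h that by (intro add_nonneg_nonneg mult_nonneg_nonneg) auto
  qed simp
  also have "\<dots> = (\<Prod>j<n. exp (- h * (\<phi> (q + l * (h * (real n - real j))) - \<kappa>)))"
  proof (intro prod.cong refl)
    fix j assume j: "j \<in> {..<n}"
    have "real (Suc j) * h - real j * h = h" by (simp add: algebra_simps)
    then show "(\<integral>\<omega>. exp (- (q + l * (h * (real n - real j))) * \<eta> (real (Suc j) * h - real j * h) \<omega>) \<partial>M) =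
        exp (- h * (\<phi> (q + l * (h * (real n - real j))) - \<kappa>))"
      using j q l h by (simp only:) (rule exp_eta, auto intro!: add_nonneg_nonneg mult_nonneg_nonneg)
  qed
  \<comment> \<open>The \<open>n\<close> terms \<open>h * \<kappa>\<close> add up to
    \<open>\<kappa> * r\<close> and cancel the survival probability.\<close>
  also have "\<dots> = exp (- (h * (\<Sum>j<n. \<phi> (q + l * (h * (real n - real j))))) + \<kappa> * r)"
    using h(2) by (simp add: exp_sum[symmetric] sum_negf sum_distrib_left[symmetric] sum_subtractf algebra_simps)
  \<comment> \<open>Time reversal: counting the increments from the end turns the sum into an upper
    Riemann sum for \<open>\<phi> (q + l * u)\<close> over \<open>[0, r]\<close>.\<close>
  also have "(\<Sum>j<n. \<phi> (q + l * (h * (real n - real j)))) = (\<Sum>k<n. \<phi> (q + l * (real (Suc k) * h)))"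
  proof (rule sum.reindex_bij_witness[of _ "\<lambda>k. n - Suc k" "\<lambda>j. n - Suc j"])
    fix j assume j: "j \<in> {..<n}"
    then have "real (Suc (n - Suc j)) = real n - real j" by (simp add: of_nat_diff)
    then show "\<phi> (q + l * (real (Suc (n - Suc j)) * h)) = \<phi> (q + l * (h * (real n - real j)))"
      by (simp only: mult.commute[of h])
  qed auto
  finally show ?thesis by (simp add: exp_add[symmetric])
qed

lemma primitive_scaled_integral:
  assumes q: "0 < q" and l: "0 < l" and r: "0 \<le> r"
  shows "integral {0..r} (\<lambda>u. \<phi> (q + l * u)) = (\<Phi> (q + l * r) - \<Phi> q) / l"
proof -
  have "((\<lambda>u. \<phi> (q + l * u)) has_integral \<Phi> (q + l * r) / l - \<Phi> (q + l * 0) / l) {0..r}"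
  proof (rule fundamental_theorem_of_calculus[OF r])
    fix u assume u: "u \<in> {0..r}"
    have "0 < q + l * u" using q l u by (simp add: add_pos_nonneg)
    have "((\<lambda>u. \<Phi> (q + l * u) / l) has_real_derivative \<phi> (q + l * u) * l / l) (at u)"
      by (intro DERIV_cdivide DERIV_chain2[OF primitive_deriv]) (use \<open>0 < q + l * u\<close> in \<open>auto intro!: derivative_eq_intros\<close>)
    then show "((\<lambda>u. \<Phi> (q + l * u) / l) has_vector_derivative \<phi> (q + l * u)) (at u within {0..r})"
      using l by (simp add: has_real_derivative_iff_has_vector_derivative has_vector_derivative_at_within)
  qed
  then show ?thesis by (simp add: integral_unique diff_divide_distrib)
qed

text \<open>Riemann sums converge on both sides, for the area path by path and for
  \<open>\<phi>\<close> in the exponent, because both integrands are monotone; the expectations are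
  dominated by 1.\<close>

lemma area_laplace:
  assumes q: "0 < q" and l: "0 < l" and r: "0 \<le> r"
  shows "(\<integral>\<omega>. indicator {r<..} (\<zeta> \<omega>) * exp (- q * \<eta> r \<omega> - l * area r \<omega>) \<partial>M) =
    exp (- ((\<Phi> (q + l * r) - \<Phi> q) / l))"
proof -
  let ?h = "\<lambda>n. r / real (Suc n)"
  have [measurable]: "\<eta> r \<in> borel_measurable M" "area r \<in> borel_measurable M"
    by (rule eta_measurable[OF r], rule area_measurable[OF r])
  have [measurable]: "(\<lambda>\<omega>. \<eta> (real (Suc k) * ?h n) \<omega>) \<in> borel_measurable M" for k n
    by (rule eta_measurable) (use r in simp)
  have "(\<lambda>n. \<integral>\<omega>. indicator {r<..} (\<zeta> \<omega>) * exp (- q * \<eta> r \<omega> - l * (?h n * (\<Sum>k<Suc n. \<eta> (real (Suc k) * ?h n) \<omega>))) \<partial>M)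
      \<longlonglongrightarrow> (\<integral>\<omega>. indicator {r<..} (\<zeta> \<omega>) * exp (- q * \<eta> r \<omega> - l * area r \<omega>) \<partial>M)"
  proof (rule integral_dominated_convergence[where w = "\<lambda>_. 1"])
    show "AE \<omega> in M. (\<lambda>n. indicator {r<..} (\<zeta> \<omega>) * exp (- q * \<eta> r \<omega> - l * (?h n * (\<Sum>k<Suc n. \<eta> (real (Suc k) * ?h n) \<omega>))))
        \<longlonglongrightarrow> indicator {r<..} (\<zeta> \<omega>) * exp (- q * \<eta> r \<omega> - l * area r \<omega>)"
      by (intro AE_I2 tendsto_intros area_riemann r)
    show "(\<lambda>\<omega>. indicator {r<..} (\<zeta> \<omega>) * exp (- q * \<eta> r \<omega> - l * area r \<omega>)) \<in> borel_measurable M" by measurable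
    fix n
    show "(\<lambda>\<omega>. indicator {r<..} (\<zeta> \<omega>) * exp (- q * \<eta> r \<omega> - l * (?h n * (\<Sum>k<Suc n. \<eta> (real (Suc k) * ?h n) \<omega>)))) \<in> borel_measurable M"
      by measurable
    show "AE \<omega> in M. norm (indicator {r<..} (\<zeta> \<omega>) * exp (- q * \<eta> r \<omega> - l * (?h n * (\<Sum>k<Suc n. \<eta> (real (Suc k) * ?h n) \<omega>)))) \<le> 1"
    proof (rule AE_I2)
      fix \<omega> assume w: "\<omega> \<in> space M"
      have "0 \<le> q * \<eta> r \<omega>" using q r w by (simp add: eta_nonneg)
      moreover have "0 \<le> l * (?h n * (\<Sum>k<Suc n. \<eta> (real (Suc k) * ?h n) \<omega>))"
        using l r w by (intro mult_nonneg_nonneg sum_nonneg eta_nonneg) auto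
      ultimately show "norm (indicator {r<..} (\<zeta> \<omega>) * exp (- q * \<eta> r \<omega> - l * (?h n * (\<Sum>k<Suc n. \<eta> (real (Suc k) * ?h n) \<omega>)))) \<le> 1"
        by (auto simp: indicator_def)
    qed
  qed simp
  moreover have "(\<integral>\<omega>. indicator {r<..} (\<zeta> \<omega>) * exp (- q * \<eta> r \<omega> - l * (?h n * (\<Sum>k<Suc n. \<eta> (real (Suc k) * ?h n) \<omega>))) \<partial>M) =
      exp (- (?h n * (\<Sum>k<Suc n. \<phi> (q + l * (real (Suc k) * ?h n)))))" for n
    by (rule area_laplace_discrete) (use q l r in auto)
  moreover have "(\<lambda>n. exp (- (?h n * (\<Sum>k<Suc n. \<phi> (q + l * (real (Suc k) * ?h n)))))) \<longlonglongrightarrow>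
      exp (- integral {0..r} (\<lambda>u. \<phi> (q + l * u)))"
  proof (intro tendsto_exp tendsto_minus mono_riemann_tendsto[OF _ r])
    show "mono_on {0..} (\<lambda>u. \<phi> (q + l * u))"
      using q l by (intro mono_onI phi_mono) (auto intro!: add_nonneg_nonneg mult_left_mono)
  qed
  ultimately show ?thesis
    unfolding primitive_scaled_integral[OF q l r] using LIMSEQ_unique by fastforce
qed

end

section \<open>Time change by the area\<close>

text \<open>Evaluation at the grid point to the right of \<open>t\<close> takes one of countably
  many fixed times, hence is jointly measurable, and right-continuity passes this to the limit.
  \<open>max 0\<close> extends the process to negative times.\<close>

lemma borel_measurable_right_continuous_process:
  fixes X :: "real \<Rightarrow> 'a \<Rightarrow> real"
  assumes meas: "\<And>t. 0 \<le> t \<Longrightarrow> X t \<in> borel_measurable M"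
    and rc: "\<And>\<omega> t. \<omega> \<in> space M \<Longrightarrow> 0 \<le> t \<Longrightarrow> continuous (at_right t) (\<lambda>t. X t \<omega>)"
  shows "(\<lambda>(t, \<omega>). X (max 0 t) \<omega>) \<in> borel_measurable ((borel :: real measure) \<Otimes>\<^sub>M M)"
proof (rule borel_measurable_LIMSEQ_real)
  fix m :: nat
  define k :: "real \<times> 'a \<Rightarrow> int" where "k p = \<lfloor>max 0 (fst p) * real (Suc m)\<rfloor>" for p
  have "(\<lambda>p. X (max 0 ((of_int (k p) + 1) / real (Suc m))) (snd p)) \<in> borel_measurable ((borel :: real measure) \<Otimes>\<^sub>M M)"
  proof (rule measurable_compose_countable'[where g = k and I = UNIV])
    fix i :: int
    have [measurable]: "X (max 0 ((of_int i + 1) / real (Suc m))) \<in> borel_measurable M" by (rule meas) simp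
    show "(\<lambda>p. X (max 0 ((of_int i + 1) / real (Suc m))) (snd p)) \<in> borel_measurable ((borel :: real measure) \<Otimes>\<^sub>M M)" by measurable
  next
    show "k \<in> borel \<Otimes>\<^sub>M M \<rightarrow>\<^sub>M count_space UNIV" unfolding k_def by measurable
  qed auto
  moreover have "X (max 0 ((of_int (k p) + 1) / real (Suc m))) (snd p) = X (right_grid m (max 0 (fst p))) (snd p)" for p
  proof -
    have "0 \<le> right_grid m (max 0 (fst p))" using right_grid_gt[of "max 0 (fst p)" m] by simp
    then show ?thesis by (simp add: right_grid_def k_def)
  qed
  ultimately show "(\<lambda>p. X (right_grid m (max 0 (fst p))) (snd p)) \<in> borel_measurable ((borel :: real measure) \<Otimes>\<^sub>M M)" by simp
next
  fix p :: "real \<times> 'a" assume p: "p \<in> space (borel \<Otimes>\<^sub>M M)"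
  obtain t \<omega> where [simp]: "p = (t, \<omega>)" by (cases p)
  have w: "\<omega> \<in> space M" using p by (simp add: space_pair_measure)
  have lim: "filterlim (\<lambda>m. right_grid m (max 0 t)) (at_right (max 0 t)) sequentially"
    using right_grid_tendsto right_grid_gt by (auto simp: filterlim_at intro!: always_eventually) (metis less_irrefl)
  have "((\<lambda>t. X t \<omega>) \<longlongrightarrow> X (max 0 t) \<omega>) (at_right (max 0 t))"
    using rc[OF w, of "max 0 t"] by (simp add: continuous_within)
  from filterlim_compose[OF this lim]
  show "(\<lambda>m. X (right_grid m (max 0 (fst p))) (snd p)) \<longlonglongrightarrow> (case p of (t, \<omega>) \<Rightarrow> X (max 0 t) \<omega>)" by simp
qed

lemma ennreal_less_dense:
  assumes "ennreal r < z" "0 \<le> r" obtains r' where "r < r'" "ennreal r' < z"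
proof -
  obtain y where y: "ennreal r < y" "y < z" using dense[OF assms(1)] by auto
  then obtain r' where r': "y = ennreal r'" "0 \<le> r'" by (cases y) auto
  then have "r < r'" using y assms(2) by (simp add: ennreal_less_iff)
  then show thesis using that y r' by blast
qed

text \<open>One fixed path with its killing time: everything about area, passage and change of
  variables is deterministic.\<close>

locale killed_path =
  fixes x :: "real \<Rightarrow> real" and z :: ennreal
  assumes x_mono: "mono_on {0..} x" and x_0: "x 0 = 0" and z_pos: "0 < z"
begin

definition A :: "real \<Rightarrow> real" where "A r = integral {0..r} x"
text \<open>The levels exceeded by the area strictly before killing. Only for them does
  \<open>\<rho>\<close>, an infimum of reals, describe a passage; elsewhere its set is empty or the
  level negative.\<close>

definition T :: "real set" where "T = {t. 0 \<le> t \<and> (\<exists>r\<ge>0. ennreal r < z \<and> t < A r)}"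
definition \<rho> :: "real \<Rightarrow> real" where "\<rho> t = Inf {r. 0 \<le> r \<and> ennreal r < z \<and> t < A r}"

lemma x_le: "0 \<le> s \<Longrightarrow> s \<le> r \<Longrightarrow> x s \<le> x r" using mono_onD[OF x_mono] by simp
lemma x_nonneg: "0 \<le> r \<Longrightarrow> 0 \<le> x r" using x_le[of 0 r] x_0 by simp

lemma A_0: "A 0 = 0" by (simp add: A_def)

lemma A_upper: "0 \<le> s \<Longrightarrow> s \<le> r \<Longrightarrow> A r \<le> A s + (r - s) * x r"
  using mono_integral_bounds(2)[OF x_mono] by (simp add: A_def algebra_simps)

lemma A_mono: assumes "0 \<le> s" "s \<le> r" shows "A s \<le> A r"
proof -
  have "0 \<le> (r - s) * x s" using assms x_nonneg by simp
  then show ?thesis using mono_integral_bounds(1)[OF x_mono assms] by (simp add: A_def)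
qed

lemma A_nonneg: "0 \<le> r \<Longrightarrow> 0 \<le> A r" using A_mono[of 0 r] A_0 by simp

text \<open>Left-continuity of the area. The step \<open>d\<close> is chosen so that going back from
  \<open>r\<close> loses at most \<open>d * x r \<le> (A r - t) / 2\<close>.\<close>

lemma A_approx_left: assumes "0 < r" "t < A r" obtains s where "0 \<le> s" "s < r" "t < A s"
proof -
  have r0: "0 \<le> x r" using x_nonneg assms by simp
  define d where "d = min r ((A r - t) / (2 * (x r + 1)))"
  have d: "0 < d" "d \<le> r" using assms r0 by (auto simp: d_def)
  have "d * x r \<le> d * (x r + 1)" using d by (intro mult_left_mono) auto
  also have "\<dots> \<le> (A r - t) / (2 * (x r + 1)) * (x r + 1)"
    using r0 by (intro mult_right_mono) (auto simp: d_def)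
  also have "\<dots> = (A r - t) / 2" using r0 by (simp add: field_simps)
  finally have "t < A (r - d)" using A_upper[of "r - d" r] d assms by simp
  then show thesis using that[of "r - d"] d by simp
qed

lemma \<rho>_props:
  assumes t: "t \<in> T"
  shows "0 \<le> \<rho> t" "ennreal (\<rho> t) < z" "A (\<rho> t) = t" "\<And>r. \<rho> t < r \<Longrightarrow> t < A r"
    "\<And>r. 0 \<le> r \<Longrightarrow> t < A r \<Longrightarrow> \<rho> t \<le> r"
proof -
  let ?S = "{r. 0 \<le> r \<and> ennreal r < z \<and> t < A r}"
  have t0: "0 \<le> t" and ne: "?S \<noteq> {}" using t by (auto simp: T_def)
  have bdd: "bdd_below ?S" by (rule bdd_belowI[of _ 0]) auto
  show nn: "0 \<le> \<rho> t" unfolding \<rho>_def by (rule cInf_greatest[OF ne]) auto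
  have le: "\<rho> t \<le> r" if "r \<in> ?S" for r unfolding \<rho>_def by (rule cInf_lower[OF that bdd])
  obtain r0 where r0: "r0 \<in> ?S" using ne by auto
  show z: "ennreal (\<rho> t) < z"
    using le[OF r0] r0 nn by (auto intro: le_less_trans ennreal_leI)
  show le': "\<rho> t \<le> r" if "0 \<le> r" "t < A r" for r
  proof (cases "ennreal r < z")
    case True then show ?thesis using le that by auto
  next
    case False
    then have "ennreal (\<rho> t) < ennreal r" using z by (auto simp: not_less)
    then show ?thesis using nn that by (simp add: ennreal_less_iff)
  qed
  show gt: "t < A r" if "\<rho> t < r" for r
  proof -
    obtain r' where "r' \<in> ?S" "r' < r" using cInf_lessD[OF ne] \<open>\<rho> t < r\<close> unfolding \<rho>_def by blast
    then show ?thesis using A_mono[of r' r] by auto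
  qed
  have "\<not> t < A (\<rho> t)"
  proof
    assume a: "t < A (\<rho> t)"
    have "0 < \<rho> t" using a nn t0 A_0 by (cases "\<rho> t = 0") auto
    then obtain s where "0 \<le> s" "s < \<rho> t" "t < A s" using A_approx_left a by blast
    then show False using le'[of s] by simp
  qed
  moreover have "\<not> A (\<rho> t) < t"
  proof
    assume a: "A (\<rho> t) < t"
    \<comment> \<open>A bound for \<open>x\<close> on \<open>[\<rho> t, \<rho> t + 1]\<close>, kept
      positive by the added 1; a step of length \<open>(t - A (\<rho> t)) / X\<close> or less cannot
      carry the area past \<open>t\<close>, against \<open>gt\<close>.\<close>
    define X where "X = x (\<rho> t + 1) + 1"
    have X: "0 < X" using x_nonneg[of "\<rho> t + 1"] nn by (simp add: X_def)
    define d where "d = min 1 ((t - A (\<rho> t)) / X)"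
    have d: "0 < d" "d \<le> 1" using a X by (auto simp: d_def)
    have "t < A (\<rho> t + d)" using gt d by simp
    also have "\<dots> \<le> A (\<rho> t) + d * x (\<rho> t + d)" using A_upper[of "\<rho> t" "\<rho> t + d"] nn d by simp
    also have "d * x (\<rho> t + d) \<le> d * X" using x_le[of "\<rho> t + d" "\<rho> t + 1"] d nn by (intro mult_left_mono) (auto simp: X_def)
    also have "d * X \<le> (t - A (\<rho> t)) / X * X" using X by (intro mult_right_mono) (auto simp: d_def)
    finally show False using X by simp
  qed
  ultimately show "A (\<rho> t) = t" by simp
qed

definition y :: "real \<Rightarrow> ennreal" where "y u = (if ennreal u < z then ennreal (x u) else \<infinity>)"

lemma x_borel: "(\<lambda>u. x (max 0 u)) \<in> borel_measurable borel"
  by (rule borel_measurable_mono) (auto intro!: monoI x_le)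

lemma A_borel: "(\<lambda>u. A (max 0 u)) \<in> borel_measurable borel"
  by (rule borel_measurable_mono) (auto intro!: monoI A_mono)

lemma nn_integral_x: assumes r: "0 \<le> r"
  shows "(\<integral>\<^sup>+u. ennreal (x (max 0 u)) * indicator {0..r} u \<partial>lborel) = ennreal (A r)"
proof -
  have "x integrable_on {0..r}" by (rule integrable_on_mono_on) (rule mono_on_subset[OF x_mono], auto)
  then have "(x has_integral A r) {0..r}" unfolding A_def by (rule integrable_integral)
  then have "((\<lambda>u. x (max 0 u)) has_integral A r) {0..r}" by (rule has_integral_eq[rotated]) auto
  then have "((\<lambda>u. x (max 0 u) * indicator {0..r} u) has_integral A r) UNIV"
  proof (subst (asm) has_integral_restrict_UNIV[symmetric])
    have "(\<lambda>u. x (max 0 u) * indicator {0..r} u) = (\<lambda>u. if u \<in> {0..r} then x (max 0 u) else 0)"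
      by (auto simp: indicator_def)
    then show "((\<lambda>u. if u \<in> {0..r} then x (max 0 u) else 0) has_integral A r) UNIV \<Longrightarrow> ?thesis" by simp
  qed
  moreover have "(\<lambda>u. x (max 0 u) * indicator {0..r} u) \<in> borel_measurable borel"
    using x_borel by measurable
  ultimately have "(\<integral>\<^sup>+u. ennreal (x (max 0 u) * indicator {0..r} u) \<partial>lborel) = ennreal (A r)"
    by (intro nn_integral_has_integral_lborel) (auto simp: x_nonneg)
  then show ?thesis by (simp add: ennreal_mult'' ennreal_indicator)
qed

text \<open>For \<open>r \<le> z\<close> killing can affect only the single point
  \<open>u = r\<close>; for \<open>r > z\<close> the value \<infinity> is taken on an interval of
  positive length. The case \<open>r = z\<close> thus still has finite area.\<close>

lemma nn_integral_y:
  assumes r: "0 \<le> r"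
  shows "(\<integral>\<^sup>+u\<in>{0..r}. y u \<partial>lborel) = (if ennreal r \<le> z then ennreal (A r) else \<infinity>)"
proof (cases "ennreal r \<le> z")
  case True
  have "(\<integral>\<^sup>+u\<in>{0..r}. y u \<partial>lborel) = (\<integral>\<^sup>+u. ennreal (x (max 0 u)) * indicator {0..r} u \<partial>lborel)"
  proof (rule nn_integral_cong_AE, use AE_lborel_singleton[of r] in eventually_elim)
    case (elim u)
    have "ennreal u < z" if "0 \<le> u" "u \<le> r"
      using that elim True r by (intro less_le_trans[OF _ True]) (auto simp: ennreal_less_iff)
    then show ?case by (auto simp: y_def indicator_def)
  qed
  then show ?thesis using True nn_integral_x[OF r] by simp
next
  case False
  then obtain z' where z': "z = ennreal z'" "0 \<le> z'" by (cases z) auto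
  have zr: "z' < r" using False z' r by (simp add: not_le ennreal_less_iff)
  have "(\<integral>\<^sup>+u. \<infinity> * indicator {z'..r} u \<partial>lborel) \<le> (\<integral>\<^sup>+u\<in>{0..r}. y u \<partial>lborel)"
  proof (rule nn_integral_mono)
    fix u :: real
    have "y u = \<infinity>" if "z' \<le> u" unfolding y_def using ennreal_leI[OF that] z'(1) by (simp add: not_less[symmetric])
    then show "\<infinity> * indicator {z'..r} u \<le> y u * indicator {0..r} u" using z'(2) by (auto simp: indicator_def)
  qed
  moreover have "(\<integral>\<^sup>+u. \<infinity> * indicator {z'..r} u \<partial>lborel) = \<infinity>"
    using zr by (subst nn_integral_cmult_indicator) (auto simp: ennreal_top_mult)
  ultimately show ?thesis using False by (simp add: top_unique)
qed

text \<open>Outside \<open>T\<close> the area stays at most \<open>t\<close> up to and including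
  \<open>z\<close> and is infinite immediately afterwards, so the infimum is \<open>z\<close>. For
  \<open>z = \<infinity>\<close> the set is empty, which agrees with the convention.\<close>

lemma first_passage:
  assumes t: "0 \<le> t"
  shows "Inf {ennreal r | r. 0 \<le> r \<and> ennreal t < (\<integral>\<^sup>+u\<in>{0..r}. y u \<partial>lborel)} =
    (if t \<in> T then ennreal (\<rho> t) else z)"
proof -
  have iff: "0 \<le> r \<and> ennreal t < (\<integral>\<^sup>+u\<in>{0..r}. y u \<partial>lborel) \<longleftrightarrow> 0 \<le> r \<and> (ennreal r \<le> z \<longrightarrow> t < A r)" for r
    using t by (auto simp: nn_integral_y ennreal_less_iff)
  show ?thesis
  proof (cases "t \<in> T")
    case True
    have "Inf {ennreal r | r. 0 \<le> r \<and> (ennreal r \<le> z \<longrightarrow> t < A r)} = ennreal (\<rho> t)"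
    proof (rule antisym)
      show "Inf {ennreal r | r. 0 \<le> r \<and> (ennreal r \<le> z \<longrightarrow> t < A r)} \<le> ennreal (\<rho> t)"
      proof (rule dense_ge)
        fix v assume v: "ennreal (\<rho> t) < v"
        then obtain r where r: "\<rho> t < r" "ennreal r < v" using ennreal_less_dense \<rho>_props(1)[OF True] by blast
        then show "Inf {ennreal r | r. 0 \<le> r \<and> (ennreal r \<le> z \<longrightarrow> t < A r)} \<le> v"
          using \<rho>_props(1,4)[OF True] by (intro Inf_lower2[of "ennreal r"]) auto
      qed
      show "ennreal (\<rho> t) \<le> Inf {ennreal r | r. 0 \<le> r \<and> (ennreal r \<le> z \<longrightarrow> t < A r)}"
      proof (rule Inf_greatest, clarify)
        fix r assume r: "0 \<le> r" "ennreal r \<le> z \<longrightarrow> t < A r"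
        show "ennreal (\<rho> t) \<le> ennreal r"
        proof (cases "ennreal r \<le> z")
          case False then show ?thesis using \<rho>_props(2)[OF True] by simp
        qed (use r \<rho>_props(5)[OF True] in \<open>auto intro: ennreal_leI\<close>)
      qed
    qed
    then show ?thesis using True unfolding iff by simp
  next
    case False
    have no: "\<not> t < A r" if "0 \<le> r" "ennreal r \<le> z" for r
    proof
      assume a: "t < A r"
      have "0 < r" using a t A_0 that by (cases "r = 0") auto
      then obtain s where s: "0 \<le> s" "s < r" "t < A s" using A_approx_left a by blast
      then have "ennreal s < z" using that by (intro less_le_trans[OF _ that(2)]) (simp add: ennreal_less_iff)
      then show False using False s t by (auto simp: T_def)
    qed
    have "Inf {ennreal r | r. 0 \<le> r \<and> (ennreal r \<le> z \<longrightarrow> t < A r)} = z"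
    proof (rule antisym)
      show "z \<le> Inf {ennreal r | r. 0 \<le> r \<and> (ennreal r \<le> z \<longrightarrow> t < A r)}"
        by (rule Inf_greatest) (use no in fastforce)
      show "Inf {ennreal r | r. 0 \<le> r \<and> (ennreal r \<le> z \<longrightarrow> t < A r)} \<le> z"
      proof (cases z)
        case (real z')
        show ?thesis
        proof (rule dense_ge)
          fix v assume v: "z < v"
          then obtain r where r: "z' < r" "ennreal r < v" using ennreal_less_dense real by blast
          then show "Inf {ennreal r | r. 0 \<le> r \<and> (ennreal r \<le> z \<longrightarrow> t < A r)} \<le> v"
            using real by (intro Inf_lower2[of "ennreal r"]) (auto simp: ennreal_le_iff)
        qed
      qed simp
    qed
    then show ?thesis using False unfolding iff by simp
  qed
qed

text \<open>The union runs over uncountably many \<open>r\<close>, but its members are open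
  rays.\<close>

lemma T_borel: "T \<in> sets borel"
proof -
  have "T = {0..} \<inter> (\<Union>r\<in>{r. 0 \<le> r \<and> ennreal r < z}. {..<A r})" by (auto simp: T_def)
  also have "open (\<Union>r\<in>{r. 0 \<le> r \<and> ennreal r < z}. {..<A r})" by auto
  then have "{0..} \<inter> (\<Union>r\<in>{r. 0 \<le> r \<and> ennreal r < z}. {..<A r}) \<in> sets borel" by (intro sets.Int) (auto intro: borel_open)
  finally show ?thesis .
qed

lemma \<rho>_borel: "(\<lambda>t. if t \<in> T then \<rho> t else 0) \<in> borel_measurable borel"
proof (rule borel_measurableI_less)
  fix b
  have "{t. (if t \<in> T then \<rho> t else 0) < b} =
      (T \<inter> (\<Union>r\<in>{r. 0 \<le> r \<and> r < b}. {..<A r})) \<union> (if 0 < b then - T else {})"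
  proof (intro set_eqI iffI)
    fix t assume "t \<in> {t. (if t \<in> T then \<rho> t else 0) < b}"
    then have a: "(if t \<in> T then \<rho> t else 0) < b" by simp
    show "t \<in> (T \<inter> (\<Union>r\<in>{r. 0 \<le> r \<and> r < b}. {..<A r})) \<union> (if 0 < b then - T else {})"
    proof (cases "t \<in> T")
      case True
      then obtain r where "\<rho> t < r" "r < b" using a dense by auto
      then have "0 \<le> r" "r < b" "t < A r" using \<rho>_props(1,4)[OF True] by auto
      then show ?thesis using True by blast
    qed (use a in auto)
  next
    fix t assume "t \<in> (T \<inter> (\<Union>r\<in>{r. 0 \<le> r \<and> r < b}. {..<A r})) \<union> (if 0 < b then - T else {})"
    then show "t \<in> {t. (if t \<in> T then \<rho> t else 0) < b}"
      using \<rho>_props(5)[of t] by (auto split: if_splits intro: le_less_trans)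
  qed
  also have "\<dots> \<in> sets borel"
  proof -
    have "open (\<Union>r\<in>{r. 0 \<le> r \<and> r < b}. {..<A r})" by auto
    then have "(\<Union>r\<in>{r. 0 \<le> r \<and> r < b}. {..<A r}) \<in> sets borel" by (rule borel_open)
    then show ?thesis using T_borel by auto
  qed
  finally show "{t \<in> space borel. (if t \<in> T then \<rho> t else 0) < b} \<in> sets borel" by simp
qed

text \<open>The change of variables \<open>t = A r\<close>; the area \<open>A\<close> is strictly increasing only where \<open>x > 0\<close>, and
  \<open>\<rho>\<close> is its right-continuous inverse.\<close>

lemma time_change:
  assumes f[measurable]: "f \<in> borel_measurable borel"
  shows "(\<integral>\<^sup>+t. f (\<rho> t) * indicator T t \<partial>lborel) =
    (\<integral>\<^sup>+r. f r * (ennreal (x (max 0 r)) * indicator {r. 0 \<le> r \<and> ennreal r < z} r) \<partial>lborel)"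
proof -
  note [measurable] = T_borel \<rho>_borel x_borel
  let ?\<rho> = "\<lambda>t. if t \<in> T then \<rho> t else 0"
  let ?w = "\<lambda>r. ennreal (x (max 0 r)) * indicator {r. 0 \<le> r \<and> ennreal r < z} r"
  define \<mu>1 where "\<mu>1 = distr (density lborel (indicator T)) borel ?\<rho>"
  define \<mu>2 where "\<mu>2 = density lborel ?w"
  have [measurable]: "{r::real. 0 \<le> r \<and> ennreal r < z} \<in> sets borel" by measurable
  have e1: "emeasure \<mu>1 {..b} = emeasure lborel {t\<in>T. \<rho> t \<le> b}" for b
  proof -
    have "emeasure \<mu>1 {..b} = (\<integral>\<^sup>+t. indicator T t * indicator (?\<rho> -` {..b}) t \<partial>lborel)"
    proof -
      have "?\<rho> -` {..b} \<in> sets borel" using measurable_sets[OF \<rho>_borel, of "{..b}"] by simp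
      then show ?thesis unfolding \<mu>1_def by (subst emeasure_distr) (auto simp: emeasure_density)
    qed
    also have "\<dots> = (\<integral>\<^sup>+t. indicator {t\<in>T. \<rho> t \<le> b} t \<partial>lborel)"
      by (rule nn_integral_cong) (auto simp: indicator_def)
    also have "\<dots> = emeasure lborel {t\<in>T. \<rho> t \<le> b}"
    proof (rule nn_integral_indicator)
      have "{t\<in>T. \<rho> t \<le> b} = {t\<in>space borel. t \<in> T \<and> ?\<rho> t \<le> b}" by auto
      also have "\<dots> \<in> sets borel" by measurable
      finally show "{t\<in>T. \<rho> t \<le> b} \<in> sets lborel" by simp
    qed
    finally show ?thesis .
  qed
  have e2: "emeasure \<mu>2 {..b} = (\<integral>\<^sup>+r. ?w r * indicator {..b} r \<partial>lborel)" for b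
    unfolding \<mu>2_def by (subst emeasure_density) auto
  have eq: "emeasure \<mu>1 {..b} = emeasure \<mu>2 {..b} \<and> emeasure \<mu>2 {..b} \<noteq> \<infinity>" for b
  proof (cases "0 \<le> b")
    case False
    have "{t\<in>T. \<rho> t \<le> b} = {}" using False \<rho>_props(1) by force
    moreover have "(\<integral>\<^sup>+r. ?w r * indicator {..b} r \<partial>lborel) = (\<integral>\<^sup>+r. 0 \<partial>(lborel :: real measure))"
      by (rule nn_integral_cong) (use False in \<open>auto simp: indicator_def\<close>)
    ultimately show ?thesis unfolding e1 e2 by (simp only: emeasure_empty) simp
  next
    case b: True
    \<comment> \<open>The minimum of \<open>b\<close> and \<open>z\<close> as a real number: passage
      by \<open>b\<close> on \<open>T\<close> means passage by \<open>m\<close>.\<close>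
    define m where "m = (if ennreal b \<le> z then b else enn2real z)"
    have m: "0 \<le> m" "ennreal m \<le> z" "m \<le> b" and m': "\<And>s. 0 \<le> s \<Longrightarrow> ennreal s < z \<Longrightarrow> s \<le> b \<Longrightarrow> s \<le> m"
    proof -
      show "0 \<le> m" using b by (simp add: m_def)
      show "ennreal m \<le> z" by (cases z) (auto simp: m_def)
      show "m \<le> b"
      proof (cases "ennreal b \<le> z")
        case False
        then obtain z' where "z = ennreal z'" "0 \<le> z'" by (cases z) auto
        then show ?thesis using False b by (simp add: m_def ennreal_le_iff)
      qed (simp add: m_def)
      show "s \<le> m" if "0 \<le> s" "ennreal s < z" "s \<le> b" for s
      proof (cases "ennreal b \<le> z")
        case False
        then obtain z' where "z = ennreal z'" "0 \<le> z'" by (cases z) auto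
        then show ?thesis using False that by (simp add: m_def ennreal_less_iff)
      qed (use that in \<open>simp add: m_def\<close>)
    qed
    \<comment> \<open>The set of levels passed by \<open>b\<close> is \<open>[0, A m)\<close> up to
      the end point \<open>A m\<close>, so its Lebesgue measure is \<open>A m\<close> even where the
      area is flat and \<open>\<rho>\<close> jumps.\<close>
    have sub: "{0..<A m} \<subseteq> {t\<in>T. \<rho> t \<le> b}"
    proof
      fix t assume t: "t \<in> {0..<A m}"
      then have "0 < m" using m A_0 by (cases "m = 0") auto
      then obtain s where s: "0 \<le> s" "s < m" "t < A s" using A_approx_left[of m t] t by auto
      then have "ennreal s < z" using m by (intro less_le_trans[OF _ m(2)]) (simp add: ennreal_less_iff)
      then have "t \<in> T" using s t by (auto simp: T_def)
      then show "t \<in> {t\<in>T. \<rho> t \<le> b}" using \<rho>_props(5)[of t m] t m by auto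
    qed
    have sup: "{t\<in>T. \<rho> t \<le> b} \<subseteq> {0..A m}"
    proof
      fix t assume t: "t \<in> {t\<in>T. \<rho> t \<le> b}"
      then have "\<rho> t \<le> m" using \<rho>_props(1,2)[of t] m' by auto
      then have "A (\<rho> t) \<le> A m" using \<rho>_props(1)[of t] t by (intro A_mono) auto
      then show "t \<in> {0..A m}" using t \<rho>_props(3)[of t] by (auto simp: T_def)
    qed
    have "emeasure lborel {0..<A m} \<le> emeasure lborel {t\<in>T. \<rho> t \<le> b}"
    proof (rule emeasure_mono[OF sub])
      have "{t\<in>T. \<rho> t \<le> b} = {t\<in>space borel. t \<in> T \<and> ?\<rho> t \<le> b}" by auto
      also have "\<dots> \<in> sets borel" by measurable
      finally show "{t\<in>T. \<rho> t \<le> b} \<in> sets lborel" by simp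
    qed
    moreover have "emeasure lborel {t\<in>T. \<rho> t \<le> b} \<le> emeasure lborel {0..A m}"
      by (rule emeasure_mono[OF sup]) simp
    ultimately have "emeasure \<mu>1 {..b} = ennreal (A m)"
      unfolding e1 using A_nonneg[OF m(1)] by simp
    moreover have "emeasure \<mu>2 {..b} = ennreal (A m)"
    proof -
      have "emeasure \<mu>2 {..b} = (\<integral>\<^sup>+u. ennreal (x (max 0 u)) * indicator {0..m} u \<partial>lborel)"
        unfolding e2
      proof (rule nn_integral_cong_AE, use AE_lborel_singleton[of m] in eventually_elim)
        case (elim u)
        have "ennreal u < z" if "0 \<le> u" "u \<le> m"
          using that elim m by (intro less_le_trans[OF _ m(2)]) (auto simp: ennreal_less_iff)
        then show ?case using m' m by (auto simp: indicator_def)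
      qed
      then show ?thesis using nn_integral_x[OF m(1)] by simp
    qed
    ultimately show ?thesis by simp
  qed
  have "\<mu>1 = \<mu>2"
  proof (rule measure_eqI_generator_eq[where E = "range atMost" and \<Omega> = UNIV and A = "\<lambda>n. {..real n}"])
    show "Int_stable (range (atMost :: real \<Rightarrow> _))" by (auto simp: Int_stable_def)
    show "sets \<mu>1 = sigma_sets UNIV (range atMost)" by (simp add: \<mu>1_def borel_eq_atMost)
    show "sets \<mu>2 = sigma_sets UNIV (range atMost)" by (simp add: \<mu>2_def borel_eq_atMost)
    show "(\<Union>n. {..real n}) = UNIV" by (auto simp: real_arch_simple)
  qed (use eq in auto)
  moreover have "(\<integral>\<^sup>+r. f r \<partial>\<mu>1) = (\<integral>\<^sup>+t. f (\<rho> t) * indicator T t \<partial>lborel)"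
    unfolding \<mu>1_def
    by (subst nn_integral_distr) (auto simp: nn_integral_density indicator_def intro!: nn_integral_cong)
  moreover have "(\<integral>\<^sup>+r. f r \<partial>\<mu>2) = (\<integral>\<^sup>+r. f r * ?w r \<partial>lborel)"
    unfolding \<mu>2_def by (subst nn_integral_density) (auto simp: mult.commute)
  ultimately show ?thesis by simp
qed

text \<open>Outside \<open>T\<close> the passage time is \<open>z\<close>. The killed path at a
  finite \<open>z\<close>, and the convention at time \<infinity>, both give the value \<infinity>,
  on which \<open>exp_neg\<close> is 0.\<close>

lemma exp_neg_first_passage:
  assumes t: "0 \<le> t"
  defines "R \<equiv> Inf {ennreal r | r. 0 \<le> r \<and> ennreal t < (\<integral>\<^sup>+u\<in>{0..r}. y u \<partial>lborel)}"
  shows "exp_neg q (if R = \<infinity> then \<infinity> else y (enn2real R)) = (if t \<in> T then exp (- q * x (\<rho> t)) else 0)"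
proof (cases "t \<in> T")
  case True
  then have "R = ennreal (\<rho> t)" unfolding R_def first_passage[OF t] by simp
  then show ?thesis
    using True \<rho>_props(1,2)[OF True] x_nonneg by (simp add: y_def exp_neg_def)
next
  case False
  then have "R = z" unfolding R_def first_passage[OF t] by simp
  moreover have "y (enn2real z) = \<infinity>" if "z \<noteq> \<infinity>"
    using that unfolding y_def by (simp add: less_top)
  ultimately show ?thesis using False by (simp add: exp_neg_def)
qed

text \<open>On \<open>T\<close> the level is recovered as \<open>t = A (\<rho> t)\<close>, so
  \<open>exp (- l * t)\<close> is a function of \<open>\<rho> t\<close>, as
  \<open>time_change\<close> requires.\<close>

lemma laplace_time_change:
  shows "(\<integral>\<^sup>+t. ennreal (exp (- l * t)) * (ennreal (if t \<in> T then exp (- q * x (\<rho> t)) else 0) * indicator {0..} t) \<partial>lborel) =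
    (\<integral>\<^sup>+r. ennreal (x (max 0 r) * exp (- q * x (max 0 r) - l * A (max 0 r))) * indicator {r. 0 \<le> r \<and> ennreal r < z} r \<partial>lborel)"
proof -
  note [measurable] = x_borel A_borel
  define f where "f r = ennreal (exp (- q * x (max 0 r) - l * A (max 0 r)))" for r
  have [measurable]: "f \<in> borel_measurable borel" unfolding f_def by measurable
  have "(\<integral>\<^sup>+t. ennreal (exp (- l * t)) * (ennreal (if t \<in> T then exp (- q * x (\<rho> t)) else 0) * indicator {0..} t) \<partial>lborel) =
      (\<integral>\<^sup>+t. f (\<rho> t) * indicator T t \<partial>lborel)"
  proof (rule nn_integral_cong)
    fix t
    have "0 \<le> t" if "t \<in> T" using that by (auto simp: T_def)
    then show "ennreal (exp (- l * t)) * (ennreal (if t \<in> T then exp (- q * x (\<rho> t)) else 0) * indicator {0..} t) = f (\<rho> t) * indicator T t"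
      using \<rho>_props(1,3)[of t] by (auto simp: f_def indicator_def exp_add[symmetric] simp flip: ennreal_mult)
  qed
  also have "\<dots> = (\<integral>\<^sup>+r. f r * (ennreal (x (max 0 r)) * indicator {r. 0 \<le> r \<and> ennreal r < z} r) \<partial>lborel)"
    by (rule time_change) simp
  also have "\<dots> = (\<integral>\<^sup>+r. ennreal (x (max 0 r) * exp (- q * x (max 0 r) - l * A (max 0 r))) * indicator {r. 0 \<le> r \<and> ennreal r < z} r \<partial>lborel)"
    by (rule nn_integral_cong) (auto simp: f_def indicator_def x_nonneg mult.commute simp flip: ennreal_mult)
  finally show ?thesis .
qed

end

section \<open>The value at the passage time\<close>

context killed_path
begin

text \<open>Countable descriptions of \<open>T\<close> and of \<open>{\<rho> t < b}\<close>, from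
  which joint measurability in the level and the sample point follows.\<close>

lemma T_rational: "t \<in> T \<longleftrightarrow> 0 \<le> t \<and> (\<exists>r\<in>\<rat> \<inter> {0..}. ennreal r < z \<and> t < A r)"
proof
  assume "t \<in> T"
  then obtain r0 where r0: "0 \<le> t" "0 \<le> r0" "ennreal r0 < z" "t < A r0" by (auto simp: T_def)
  obtain r' where r': "r0 < r'" "ennreal r' < z" using ennreal_less_dense[OF r0(3,2)] .
  obtain r where r: "r \<in> \<rat>" "r0 < r" "r < r'" using Rats_dense_in_real[OF r'(1)] by auto
  have "ennreal r < z" using r r' r0 by (intro le_less_trans[OF _ r'(2)] ennreal_leI) simp
  moreover have "t < A r" using A_mono[of r0 r] r r0 by simp
  ultimately show "0 \<le> t \<and> (\<exists>r\<in>\<rat> \<inter> {0..}. ennreal r < z \<and> t < A r)" using r r0 by auto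
qed (auto simp: T_def)

lemma \<rho>_less_rational: assumes "t \<in> T" shows "\<rho> t < b \<longleftrightarrow> (\<exists>r\<in>\<rat> \<inter> {0..}. r < b \<and> t < A r)"
proof
  assume "\<rho> t < b"
  then obtain r where r: "r \<in> \<rat>" "\<rho> t < r" "r < b" using Rats_dense_in_real by blast
  then have "0 \<le> r" "t < A r" using \<rho>_props(1,4)[OF assms] by auto
  then show "\<exists>r\<in>\<rat> \<inter> {0..}. r < b \<and> t < A r" using r by auto
qed (use \<rho>_props(5)[OF assms] in \<open>auto intro: le_less_trans\<close>)

text \<open>If \<open>t\<close> is not passed, no higher level is. If it is, \<open>t < A r\<close>
  for every \<open>r > \<rho> t\<close>, so levels slightly above \<open>t\<close> are passed
  shortly after \<open>\<rho> t\<close>, and right-continuity of the path finishes.\<close>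

lemma passage_right_continuous:
  assumes rc: "\<And>t. 0 \<le> t \<Longrightarrow> continuous (at_right t) x"
    and X: "\<And>n. t < X n" "X \<longlonglongrightarrow> t" and t: "0 \<le> t"
  shows "(\<lambda>n. if X n \<in> T then exp (- q * x (\<rho> (X n))) else 0) \<longlonglongrightarrow> (if t \<in> T then exp (- q * x (\<rho> t)) else 0)"
proof (cases "t \<in> T")
  case False
  have "X n \<notin> T" for n
  proof
    assume "X n \<in> T"
    then obtain r where "0 \<le> r" "ennreal r < z" "X n < A r" by (auto simp: T_def)
    moreover have "t < X n" by (rule X)
    ultimately have "0 \<le> r \<and> ennreal r < z \<and> t < A r" by auto
    then show False using False t by (auto simp: T_def)
  qed
  then show ?thesis using False by simp
next
  case True
  note P = \<rho>_props[OF True]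
  obtain r1 where r1: "\<rho> t < r1" "ennreal r1 < z" using ennreal_less_dense[OF P(2,1)] .
  have up: "X n \<in> T \<and> \<rho> t \<le> \<rho> (X n) \<and> \<rho> (X n) \<le> r" if "0 \<le> r" "ennreal r < z" "X n < A r" for n r
  proof -
    have XT: "X n \<in> T" using that X(1)[of n] t by (auto simp: T_def intro: less_imp_le le_less_trans)
    moreover have "\<rho> t \<le> \<rho> (X n)"
      using \<rho>_props(1,3)[OF XT] X(1)[of n] by (intro P(5)) auto
    moreover have "\<rho> (X n) \<le> r" using \<rho>_props(5)[OF XT] that by simp
    ultimately show ?thesis by simp
  qed
  have ev: "eventually (\<lambda>n. X n \<in> T \<and> \<rho> t \<le> \<rho> (X n) \<and> \<rho> (X n) \<le> r) sequentially"
    if "\<rho> t < r" for r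
  proof -
    define r' where "r' = min r r1"
    have r': "\<rho> t < r'" "r' \<le> r" "r' \<le> r1" using that r1 by (auto simp: r'_def)
    have z': "ennreal r' < z" using ennreal_leI[OF r'(3)] r1(2) by (rule le_less_trans)
    have "eventually (\<lambda>n. X n < A r') sequentially" using X(2) P(4)[OF r'(1)] by (rule order_tendstoD)
    then show ?thesis
    proof eventually_elim
      case (elim n)
      then show ?case using up[of r' n] r' z' P(1) by auto
    qed
  qed
  have "(\<lambda>n. x (\<rho> (X n))) \<longlonglongrightarrow> x (\<rho> t)"
  proof (rule tendstoI)
    fix e :: real assume e: "0 < e"
    have "eventually (\<lambda>u. dist (x u) (x (\<rho> t)) < e) (at_right (\<rho> t))"
      using rc[OF P(1)] e by (auto simp: continuous_within tendsto_iff)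
    then obtain b where b: "\<rho> t < b" "\<And>u. \<rho> t < u \<Longrightarrow> u < b \<Longrightarrow> dist (x u) (x (\<rho> t)) < e"
      by (auto simp: eventually_at_right_field)
    obtain r where r: "\<rho> t < r" "r < b" using dense[OF b(1)] by auto
    show "eventually (\<lambda>n. dist (x (\<rho> (X n))) (x (\<rho> t)) < e) sequentially"
      using ev[OF r(1)]
    proof eventually_elim
      case (elim n)
      then show ?case using b(2)[of "\<rho> (X n)"] r e by (cases "\<rho> (X n) = \<rho> t") auto
    qed
  qed
  then have "(\<lambda>n. exp (- q * x (\<rho> (X n)))) \<longlonglongrightarrow> exp (- q * x (\<rho> t))" by (intro tendsto_intros)
  then have "(\<lambda>n. if X n \<in> T then exp (- q * x (\<rho> (X n))) else 0) \<longlonglongrightarrow> exp (- q * x (\<rho> t))"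
    by (rule Lim_transform_eventually) (use ev[OF r1(1)] in \<open>eventually_elim, simp\<close>)
  then show ?thesis using True by simp
qed

end

context killed_subordinator
begin

lemma eta_right_continuous: "\<omega> \<in> space M \<Longrightarrow> 0 \<le> t \<Longrightarrow> continuous (at_right t) (\<lambda>t. \<eta> t \<omega>)"
  using eta_paths(3)[of \<omega>] by (simp add: cadlag_def)

lemma killed_path: "\<omega> \<in> space M \<Longrightarrow> killed_path (\<lambda>u. \<eta> u \<omega>) (\<zeta> \<omega>)"
  by unfold_locales (auto intro: eta_paths zeta_pos)

lemma killed_path_A: "\<omega> \<in> space M \<Longrightarrow> killed_path.A (\<lambda>u. \<eta> u \<omega>) r = area r \<omega>"
  using killed_path.A_def[OF killed_path] by (simp add: area_def)

definition passed :: "'a \<Rightarrow> real set" where "passed \<omega> = killed_path.T (\<lambda>u. \<eta> u \<omega>) (\<zeta> \<omega>)"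
definition passage :: "real \<Rightarrow> 'a \<Rightarrow> real" where "passage t \<omega> = killed_path.\<rho> (\<lambda>u. \<eta> u \<omega>) (\<zeta> \<omega>) t"
definition hval :: "real \<Rightarrow> real \<Rightarrow> 'a \<Rightarrow> real" where
  "hval q t \<omega> = (if t \<in> passed \<omega> then exp (- q * \<eta> (passage t \<omega>) \<omega>) else 0)"

lemma hval_bounds: "\<omega> \<in> space M \<Longrightarrow> 0 \<le> q \<Longrightarrow> 0 \<le> hval q t \<omega> \<and> hval q t \<omega> \<le> 1"
  using killed_path.\<rho>_props(1)[OF killed_path, of \<omega> t]
  by (auto simp: hval_def passed_def passage_def eta_nonneg)

lemma exp_neg_at_rho:
  assumes w: "\<omega> \<in> space M" and t: "0 \<le> t" and \<xi>: "\<And>u. 0 \<le> u \<Longrightarrow> \<xi> u \<omega> = kill_at \<zeta> \<eta> u \<omega>"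
  shows "exp_neg q (at_time \<xi> (rho \<xi> t \<omega>) \<omega>) = hval q t \<omega>"
proof -
  interpret killed_path "\<lambda>u. \<eta> u \<omega>" "\<zeta> \<omega>" by (rule killed_path[OF w])
  have y: "\<xi> u \<omega> = y u" if "0 \<le> u" for u using \<xi>[OF that] by (simp add: kill_at_def y_def)
  have "(\<integral>\<^sup>+u\<in>{0..r}. \<xi> u \<omega> \<partial>lborel) = (\<integral>\<^sup>+u\<in>{0..r}. y u \<partial>lborel)" for r
    by (rule nn_integral_cong) (auto simp: y indicator_def)
  then have rho: "rho \<xi> t \<omega> = Inf {ennreal r | r. 0 \<le> r \<and> ennreal t < (\<integral>\<^sup>+u\<in>{0..r}. y u \<partial>lborel)}"
    by (simp add: rho_def)
  have "at_time \<xi> (rho \<xi> t \<omega>) \<omega> = (if rho \<xi> t \<omega> = \<infinity> then \<infinity> else y (enn2real (rho \<xi> t \<omega>)))"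
    by (simp add: at_time_def y)
  then show ?thesis
    using exp_neg_first_passage[OF t, of q] unfolding rho by (simp add: hval_def passed_def passage_def)
qed

lemma eta_joint: "(\<lambda>(t, \<omega>). \<eta> (max 0 t) \<omega>) \<in> borel_measurable ((borel :: real measure) \<Otimes>\<^sub>M M)"
  by (rule borel_measurable_right_continuous_process) (auto intro: eta_measurable eta_right_continuous)

lemma area_joint: "(\<lambda>(t, \<omega>). area (max 0 t) \<omega>) \<in> borel_measurable ((borel :: real measure) \<Otimes>\<^sub>M M)"
proof (rule borel_measurable_right_continuous_process)
  fix \<omega> and t :: real assume w: "\<omega> \<in> space M" and t: "0 \<le> t"
  interpret killed_path "\<lambda>u. \<eta> u \<omega>" "\<zeta> \<omega>" by (rule killed_path[OF w])
  show "continuous (at_right t) (\<lambda>t. area t \<omega>)" unfolding continuous_within killed_path_A[OF w, symmetric]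
  proof (rule tendsto_sandwich)
    show "eventually (\<lambda>r. A t \<le> A r) (at_right t)"
      using eventually_at_right_less[of t] by eventually_elim (use t A_mono in auto)
    show "eventually (\<lambda>r. A r \<le> A t + (r - t) * \<eta> (t + 1) \<omega>) (at_right t)"
    proof -
      have "eventually (\<lambda>r. r \<in> {t<..<t + 1}) (at_right t)" by (rule eventually_at_right_real) simp
      then show ?thesis
      proof eventually_elim
        case (elim r)
        have "A r \<le> A t + (r - t) * \<eta> r \<omega>" using A_upper[of t r] elim t by simp
        also have "(r - t) * \<eta> r \<omega> \<le> (r - t) * \<eta> (t + 1) \<omega>"
          using elim t by (intro mult_left_mono x_le) auto
        finally show ?case by simp
      qed
    qed
    have "((\<lambda>r. A t + (r - t) * \<eta> (t + 1) \<omega>) \<longlongrightarrow> A t + (t - t) * \<eta> (t + 1) \<omega>) (at_right t)"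
      by (intro tendsto_intros)
    then show "((\<lambda>r. A t + (r - t) * \<eta> (t + 1) \<omega>) \<longlongrightarrow> A t) (at_right t)" by simp
  qed simp
qed (rule area_measurable)

text \<open>The passage time is made a jointly measurable real function \<open>R\<close>, with value
  0 off \<open>S\<close>, and then inserted into the jointly measurable process
  \<open>\<eta>\<close>.\<close>

lemma hval_joint: "(\<lambda>(t, \<omega>). hval q t \<omega>) \<in> borel_measurable ((borel :: real measure) \<Otimes>\<^sub>M M)"
proof -
  let ?B = "(borel :: real measure) \<Otimes>\<^sub>M M"
  define S where "S = {p \<in> space ?B. fst p \<in> passed (snd p)}"
  define R where "R p = (if p \<in> S then passage (fst p) (snd p) else 0)" for p
  have [measurable]: "area r \<in> borel_measurable M" if "r \<in> \<rat> \<inter> {0..}" for r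
    using that by (intro area_measurable) auto
  have w: "snd p \<in> space M" if "p \<in> space ?B" for p using that by (auto simp: space_pair_measure)
  have S_eq: "S = {p \<in> space ?B. 0 \<le> fst p} \<inter> (\<Union>r\<in>\<rat> \<inter> {0..}. {p \<in> space ?B. ennreal r < \<zeta> (snd p) \<and> fst p < area r (snd p)})"
    using killed_path.T_rational[OF killed_path[OF w]] killed_path_A[OF w]
    by (auto simp: S_def passed_def)
  have U: "(\<Union>r\<in>\<rat> \<inter> {0..}. {p \<in> space ?B. ennreal r < \<zeta> (snd p) \<and> fst p < area r (snd p)}) \<in> sets ?B"
    by (rule sets.countable_UN''[OF countable_Int1[OF countable_rat]]) auto
  have S_sets[measurable]: "S \<in> sets ?B"
    unfolding S_eq by (rule sets.Int[OF _ U]) measurable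
  have R_meas[measurable]: "R \<in> borel_measurable ?B"
  proof (rule borel_measurableI_less)
    fix b
    have less: "passage (fst p) (snd p) < b \<longleftrightarrow> (\<exists>r\<in>\<rat> \<inter> {0..}. r < b \<and> fst p < area r (snd p))" if p: "p \<in> S" for p
    proof -
      have "p \<in> space ?B" "fst p \<in> killed_path.T (\<lambda>u. \<eta> u (snd p)) (\<zeta> (snd p))" using p by (auto simp: S_def passed_def)
      then show ?thesis
        using killed_path.\<rho>_less_rational[OF killed_path[OF w], of p "fst p" b] killed_path_A[OF w, of p]
        by (simp add: passage_def)
    qed
    have "{p \<in> space ?B. R p < b} =
        (S \<inter> (\<Union>r\<in>\<rat> \<inter> {0..<b}. {p \<in> space ?B. fst p < area r (snd p)})) \<union> (if 0 < b then space ?B - S else {})"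
    proof (intro set_eqI)
      fix p
      show "p \<in> {p \<in> space ?B. R p < b} \<longleftrightarrow> p \<in> (S \<inter> (\<Union>r\<in>\<rat> \<inter> {0..<b}. {p \<in> space ?B. fst p < area r (snd p)})) \<union> (if 0 < b then space ?B - S else {})"
      proof (cases "p \<in> S")
        case True
        then have "p \<in> space ?B" by (simp add: S_def)
        then show ?thesis using True less[OF True] by (auto simp: R_def)
      qed (auto simp: R_def)
    qed
    also have "\<dots> \<in> sets ?B"
    proof -
      have "(\<Union>r\<in>\<rat> \<inter> {0..<b}. {p \<in> space ?B. fst p < area r (snd p)}) \<in> sets ?B"
      proof (rule sets.countable_UN''[OF countable_Int1[OF countable_rat]])
        fix r :: real assume "r \<in> \<rat> \<inter> {0..<b}"
        then have [measurable]: "area r \<in> borel_measurable M" by (intro area_measurable) auto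
        show "{p \<in> space ?B. fst p < area r (snd p)} \<in> sets ?B" by measurable
      qed
      then show ?thesis using S_sets by auto
    qed
    finally show "{p \<in> space ?B. R p < b} \<in> sets ?B" .
  qed
  have "(\<lambda>p. (R p, snd p)) \<in> measurable ?B ?B" by measurable
  from measurable_compose[OF this eta_joint]
  have [measurable]: "(\<lambda>p. \<eta> (max 0 (R p)) (snd p)) \<in> borel_measurable ?B" by simp
  have meas: "(\<lambda>p. if p \<in> S then exp (- q * \<eta> (max 0 (R p)) (snd p)) else 0) \<in> borel_measurable ?B" by measurable
  have eq: "(if p \<in> S then exp (- q * \<eta> (max 0 (R p)) (snd p)) else 0) = (case p of (t, \<omega>) \<Rightarrow> hval q t \<omega>)"
    if "p \<in> space ?B" for p
  proof (cases "p \<in> S")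
    case True
    have "fst p \<in> killed_path.T (\<lambda>u. \<eta> u (snd p)) (\<zeta> (snd p))" using True by (auto simp: S_def passed_def)
    then have "0 \<le> passage (fst p) (snd p)"
      using killed_path.\<rho>_props(1)[OF killed_path[OF w[OF that]], of "fst p"] by (simp add: passage_def)
    then show ?thesis using True by (cases p) (simp add: R_def hval_def S_def)
  next
    case False
    then show ?thesis using that by (cases p) (simp add: S_def hval_def)
  qed
  show ?thesis by (rule measurable_cong[THEN iffD1, OF eq meas])
qed

lemma hval_measurable: "hval q t \<in> borel_measurable M"
proof -
  have "(\<lambda>\<omega>. (t, \<omega>)) \<in> measurable M ((borel :: real measure) \<Otimes>\<^sub>M M)" by simp
  from measurable_compose[OF this hval_joint] show ?thesis by simp
qed

text \<open>The factor \<open>\<eta> r\<close> appears when \<open>area_laplace\<close> is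
  differentiated in \<open>q\<close>. To do so, survival and the area are put into a weight, and
  \<open>m\<close> is the law of \<open>\<eta> r\<close> under it.\<close>

lemma area_size_laplace:
  assumes q: "0 < q" and l: "0 < l" and r: "0 \<le> r"
  shows "(\<integral>\<^sup>+\<omega>. ennreal (indicator {r<..} (\<zeta> \<omega>) * (\<eta> r \<omega> * exp (- q * \<eta> r \<omega> - l * area r \<omega>))) \<partial>M) =
    ennreal ((\<phi> (q + l * r) - \<phi> q) / l * exp (- ((\<Phi> (q + l * r) - \<Phi> q) / l)))"
proof -
  have [measurable]: "\<eta> r \<in> borel_measurable M" "area r \<in> borel_measurable M"
    by (rule eta_measurable[OF r], rule area_measurable[OF r])
  define w where "w \<omega> = indicator {ennreal r<..} (\<zeta> \<omega>) * exp (- l * area r \<omega>)" for \<omega>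
  have [measurable]: "w \<in> borel_measurable M" unfolding w_def by measurable
  have w: "0 \<le> w \<omega>" "w \<omega> \<le> 1" if "\<omega> \<in> space M" for \<omega>
    using area_nonneg[OF that r] l by (auto simp: w_def indicator_def)
  define m where "m = distr (density M (\<lambda>\<omega>. ennreal (w \<omega>))) borel (\<eta> r)"
  have m_int: "(\<integral>x. f x \<partial>m) = (\<integral>\<omega>. w \<omega> * f (\<eta> r \<omega>) \<partial>M)" if [measurable]: "f \<in> borel_measurable borel" for f :: "real \<Rightarrow> real"
    unfolding m_def using w by (subst integral_distr) (auto simp: integral_density)
  have m_integrable: "integrable m f" if [measurable]: "f \<in> borel_measurable borel" and "\<And>x. 0 \<le> x \<Longrightarrow> \<bar>f x\<bar> \<le> B" for f :: "real \<Rightarrow> real" and B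
  proof -
    have "integrable M (\<lambda>\<omega>. w \<omega> * f (\<eta> r \<omega>))"
    proof (rule integrable_const_bound[where B = B])
      show "AE \<omega> in M. norm (w \<omega> * f (\<eta> r \<omega>)) \<le> B"
      proof (rule AE_I2)
        fix \<omega> assume s: "\<omega> \<in> space M"
        have "\<bar>f (\<eta> r \<omega>)\<bar> \<le> B" using that(2) eta_nonneg[OF s r] by simp
        moreover have "w \<omega> * \<bar>f (\<eta> r \<omega>)\<bar> \<le> 1 * \<bar>f (\<eta> r \<omega>)\<bar>" using w[OF s] by (intro mult_right_mono) auto
        ultimately show "norm (w \<omega> * f (\<eta> r \<omega>)) \<le> B" using w[OF s] by (simp add: abs_mult)
      qed
    qed measurable
    then show ?thesis unfolding m_def using w by (subst integrable_distr_eq) (auto simp: integrable_density)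
  qed
  have W: "(\<integral>\<omega>. w \<omega> * exp (- p * \<eta> r \<omega>) \<partial>M) = exp (- ((\<Phi> (p + l * r) - \<Phi> p) / l))" if "0 < p" for p
    unfolding area_laplace[OF that l r, symmetric]
    by (intro Bochner_Integration.integral_cong refl) (simp add: w_def exp_add[symmetric] algebra_simps)
  \<comment> \<open>Minus the transform of \<open>m\<close>: with this sign its derivative is the
    integral of \<open>x * exp (- q * x)\<close>.\<close>
  define E where "E p = - exp (- ((\<Phi> (p + l * r) - \<Phi> p) / l))" for p
  have "(E has_real_derivative (\<integral>x. 1 * (x * exp (- q * x)) \<partial>m)) (at q)"
  proof (rule laplace_difference_deriv[OF _ _ _ _ _ q])
    show "sets m = sets borel" by (simp add: m_def)
    show "AE x in m. 0 \<le> x"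
      unfolding m_def using r by (subst AE_distr_iff) (auto simp: AE_density eta_nonneg)
    fix p q :: real assume p: "0 < p" and q: "0 < q"
    show "integrable m (\<lambda>x. 1 * (x * exp (- q * x)))"
      using exp_mult_le q by (intro m_integrable[of _ "1 / q"]) (auto simp: abs_mult)
    have "integrable m (\<lambda>x. exp (- s * x))" if "0 < s" for s
      using that by (intro m_integrable[of _ 1]) auto
    then have "(\<integral>x. 1 * (exp (- q * x) - exp (- p * x)) \<partial>m) = (\<integral>x. exp (- q * x) \<partial>m) - (\<integral>x. exp (- p * x) \<partial>m)"
      using p q Bochner_Integration.integral_diff[of m "\<lambda>x. exp (- q * x)" "\<lambda>x. exp (- p * x)"] by simp
    then show "E p - E q = (\<integral>x. 1 * (exp (- q * x) - exp (- p * x)) \<partial>m)"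
      using W[OF p] W[OF q] by (simp add: m_int E_def)
  qed simp
  moreover have "(E has_real_derivative (\<phi> (q + l * r) - \<phi> q) / l * exp (- ((\<Phi> (q + l * r) - \<Phi> q) / l))) (at q)"
  proof -
    have pos: "0 < q + l * r" using q l r by (simp add: add_pos_nonneg)
    have "((\<lambda>p. \<Phi> (p + l * r)) has_real_derivative \<phi> (q + l * r) * 1) (at q)"
      by (rule DERIV_chain2[where f = \<Phi> and g = "\<lambda>p. p + l * r"], rule primitive_deriv[OF pos])
        (auto intro!: derivative_eq_intros)
    from DERIV_diff[OF this primitive_deriv[OF q]]
    have "((\<lambda>p. - ((\<Phi> (p + l * r) - \<Phi> p) / l)) has_real_derivative - ((\<phi> (q + l * r) - \<phi> q) / l)) (at q)"
      by (intro DERIV_minus DERIV_cdivide) simp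
    from DERIV_minus[OF DERIV_fun_exp[OF this]]
    show ?thesis by (simp add: E_def[abs_def] mult.commute)
  qed
  ultimately have eq: "(\<integral>x. x * exp (- q * x) \<partial>m) = (\<phi> (q + l * r) - \<phi> q) / l * exp (- ((\<Phi> (q + l * r) - \<Phi> q) / l))"
    using DERIV_unique by fastforce
  have "(\<integral>\<^sup>+\<omega>. ennreal (indicator {r<..} (\<zeta> \<omega>) * (\<eta> r \<omega> * exp (- q * \<eta> r \<omega> - l * area r \<omega>))) \<partial>M) =
      (\<integral>\<^sup>+\<omega>. ennreal (w \<omega>) * ennreal (\<eta> r \<omega> * exp (- q * \<eta> r \<omega>)) \<partial>M)"
  proof (rule nn_integral_cong)
    fix \<omega> assume s: "\<omega> \<in> space M"
    have e: "indicator {r<..} (\<zeta> \<omega>) * (\<eta> r \<omega> * exp (- q * \<eta> r \<omega> - l * area r \<omega>)) = w \<omega> * (\<eta> r \<omega> * exp (- q * \<eta> r \<omega>))"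
      by (simp add: w_def exp_diff exp_minus divide_inverse)
    show "ennreal (indicator {r<..} (\<zeta> \<omega>) * (\<eta> r \<omega> * exp (- q * \<eta> r \<omega> - l * area r \<omega>))) =
        ennreal (w \<omega>) * ennreal (\<eta> r \<omega> * exp (- q * \<eta> r \<omega>))"
      unfolding e using w[OF s] eta_nonneg[OF s r] by (intro ennreal_mult) auto
  qed
  also have "\<dots> = (\<integral>\<^sup>+x. ennreal (x * exp (- q * x)) \<partial>m)"
    unfolding m_def by (subst nn_integral_distr) (auto simp: nn_integral_density)
  also have "\<dots> = ennreal (\<integral>x. x * exp (- q * x) \<partial>m)"
  proof (rule nn_integral_eq_integral)
    show "integrable m (\<lambda>x. x * exp (- q * x))"
      using exp_mult_le q by (intro m_integrable[of _ "1 / q"]) (auto simp: abs_mult)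
    show "AE x in m. 0 \<le> x * exp (- q * x)"
      unfolding m_def using r by (subst AE_distr_iff) (auto simp: AE_density eta_nonneg)
  qed
  finally show ?thesis unfolding eq .
qed

text \<open>Fubini brings the integral over \<open>t\<close> inside the expectation, the change of
  variables turns it path by path into one over \<open>r\<close>, and Fubini back leaves an
  expectation at fixed \<open>r\<close>.\<close>

lemma hval_laplace:
  assumes q: "0 < q" and l: "0 < l"
  shows "(\<integral>\<^sup>+t. ennreal (exp (- l * t)) * (ennreal (\<integral>\<omega>. hval q t \<omega> \<partial>M) * indicator {0..} t) \<partial>lborel) =
    (\<integral>\<^sup>+r. ennreal ((\<phi> (q + l * r) - \<phi> q) / l * exp (- ((\<Phi> (q + l * r) - \<Phi> q) / l))) * indicator {0..} r \<partial>lborel)"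
proof -
  interpret P: pair_sigma_finite M "lborel :: real measure" ..
  have swap: "(\<lambda>p. (snd p, fst p)) \<in> measurable (M \<Otimes>\<^sub>M lborel) ((borel :: real measure) \<Otimes>\<^sub>M M)" by measurable
  have [measurable]: "(\<lambda>p. hval q (snd p) (fst p)) \<in> borel_measurable (M \<Otimes>\<^sub>M lborel)"
    using measurable_compose[OF swap hval_joint] by simp
  have [measurable]: "(\<lambda>p. \<eta> (max 0 (snd p)) (fst p)) \<in> borel_measurable (M \<Otimes>\<^sub>M lborel)"
    using measurable_compose[OF swap eta_joint] by simp
  have [measurable]: "(\<lambda>p. area (max 0 (snd p)) (fst p)) \<in> borel_measurable (M \<Otimes>\<^sub>M lborel)"
    using measurable_compose[OF swap area_joint] by simp
  have "(\<integral>\<^sup>+t. ennreal (exp (- l * t)) * (ennreal (\<integral>\<omega>. hval q t \<omega> \<partial>M) * indicator {0..} t) \<partial>lborel) =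
      (\<integral>\<^sup>+t. \<integral>\<^sup>+\<omega>. ennreal (exp (- l * t)) * (ennreal (hval q t \<omega>) * indicator {0..} t) \<partial>M \<partial>lborel)"
  proof (rule nn_integral_cong)
    fix t :: real
    note [measurable] = hval_measurable[of q t]
    have "integrable M (hval q t)"
      by (rule integrable_const_bound[where B = 1]) (use hval_bounds[of _ q t] q in auto)
    then have "ennreal (\<integral>\<omega>. hval q t \<omega> \<partial>M) = (\<integral>\<^sup>+\<omega>. ennreal (hval q t \<omega>) \<partial>M)"
      by (subst nn_integral_eq_integral) (use hval_bounds[of _ q t] q in auto)
    then show "ennreal (exp (- l * t)) * (ennreal (\<integral>\<omega>. hval q t \<omega> \<partial>M) * indicator {0..} t) =
        (\<integral>\<^sup>+\<omega>. ennreal (exp (- l * t)) * (ennreal (hval q t \<omega>) * indicator {0..} t) \<partial>M)"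
      by (simp add: nn_integral_cmult nn_integral_multc)
  qed
  also have "\<dots> = (\<integral>\<^sup>+\<omega>. \<integral>\<^sup>+t. ennreal (exp (- l * t)) * (ennreal (hval q t \<omega>) * indicator {0..} t) \<partial>lborel \<partial>M)"
    by (rule P.Fubini') measurable
  also have "\<dots> = (\<integral>\<^sup>+\<omega>. \<integral>\<^sup>+r. ennreal (\<eta> (max 0 r) \<omega> * exp (- q * \<eta> (max 0 r) \<omega> - l * area (max 0 r) \<omega>)) *
      indicator {r. 0 \<le> r \<and> ennreal r < \<zeta> \<omega>} r \<partial>lborel \<partial>M)"
  proof (rule nn_integral_cong)
    fix \<omega> assume w: "\<omega> \<in> space M"
    show "(\<integral>\<^sup>+t. ennreal (exp (- l * t)) * (ennreal (hval q t \<omega>) * indicator {0..} t) \<partial>lborel) =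
      (\<integral>\<^sup>+r. ennreal (\<eta> (max 0 r) \<omega> * exp (- q * \<eta> (max 0 r) \<omega> - l * area (max 0 r) \<omega>)) *
        indicator {r. 0 \<le> r \<and> ennreal r < \<zeta> \<omega>} r \<partial>lborel)"
      using killed_path.laplace_time_change[OF killed_path[OF w], of l q]
      unfolding hval_def passed_def passage_def killed_path_A[OF w] .
  qed
  also have "\<dots> = (\<integral>\<^sup>+\<omega>. \<integral>\<^sup>+r. ennreal (indicator {ennreal r<..} (\<zeta> \<omega>) * (\<eta> (max 0 r) \<omega> * exp (- q * \<eta> (max 0 r) \<omega> - l * area (max 0 r) \<omega>))) *
      indicator {0..} r \<partial>lborel \<partial>M)"
    by (intro nn_integral_cong) (auto simp: indicator_def)
  also have "\<dots> = (\<integral>\<^sup>+r. \<integral>\<^sup>+\<omega>. ennreal (indicator {ennreal r<..} (\<zeta> \<omega>) * (\<eta> (max 0 r) \<omega> * exp (- q * \<eta> (max 0 r) \<omega> - l * area (max 0 r) \<omega>))) *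
      indicator {0..} r \<partial>M \<partial>lborel)"
  proof (rule P.Fubini'[symmetric])
    have [measurable]: "(\<lambda>p. indicat_real {ennreal (snd p)<..} (\<zeta> (fst p))) \<in> borel_measurable (M \<Otimes>\<^sub>M lborel)"
    proof -
      have "(\<lambda>p. if ennreal (snd p) < \<zeta> (fst p) then 1 else 0 :: real) \<in> borel_measurable (M \<Otimes>\<^sub>M lborel)" by measurable
      then show ?thesis by (simp add: indicator_def of_bool_def)
    qed
    show "(\<lambda>(\<omega>, r). ennreal (indicator {ennreal r<..} (\<zeta> \<omega>) * (\<eta> (max 0 r) \<omega> * exp (- q * \<eta> (max 0 r) \<omega> - l * area (max 0 r) \<omega>))) *
      indicator {0..} r) \<in> borel_measurable (M \<Otimes>\<^sub>M lborel)"
      unfolding split_beta' by measurable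
  qed
  also have "\<dots> = (\<integral>\<^sup>+r. ennreal ((\<phi> (q + l * r) - \<phi> q) / l * exp (- ((\<Phi> (q + l * r) - \<Phi> q) / l))) * indicator {0..} r \<partial>lborel)"
  proof (rule nn_integral_cong)
    fix r :: real
    show "(\<integral>\<^sup>+\<omega>. ennreal (indicator {ennreal r<..} (\<zeta> \<omega>) * (\<eta> (max 0 r) \<omega> * exp (- q * \<eta> (max 0 r) \<omega> - l * area (max 0 r) \<omega>))) *
      indicator {0..} r \<partial>M) = ennreal ((\<phi> (q + l * r) - \<phi> q) / l * exp (- ((\<Phi> (q + l * r) - \<Phi> q) / l))) * indicator {0..} r"
      using area_size_laplace[OF q l, of r] by (cases "0 \<le> r") (simp_all add: indicator_def)
  qed
  finally show ?thesis .
qed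

lemma hval_right_continuous:
  assumes t: "0 \<le> t" and X: "\<And>n. t < X n" "X \<longlonglongrightarrow> t" and q: "0 \<le> q"
  shows "(\<lambda>n. \<integral>\<omega>. hval q (X n) \<omega> \<partial>M) \<longlonglongrightarrow> (\<integral>\<omega>. hval q t \<omega> \<partial>M)"
proof (rule integral_dominated_convergence[where w = "\<lambda>_. 1"])
  show "AE \<omega> in M. (\<lambda>n. hval q (X n) \<omega>) \<longlonglongrightarrow> hval q t \<omega>"
  proof (rule AE_I2)
    fix \<omega> assume w: "\<omega> \<in> space M"
    interpret killed_path "\<lambda>u. \<eta> u \<omega>" "\<zeta> \<omega>" by (rule killed_path[OF w])
    show "(\<lambda>n. hval q (X n) \<omega>) \<longlonglongrightarrow> hval q t \<omega>"
      unfolding hval_def passed_def passage_def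
      by (rule passage_right_continuous[OF eta_right_continuous[OF w] X t])
  qed
  show "AE \<omega> in M. norm (hval q (X n) \<omega>) \<le> 1" for n
    using hval_bounds[of _ q "X n"] q by auto
qed (auto intro: hval_measurable)

end

section \<open>The Laplace transform in time\<close>

lemma nn_integral_exp_atLeast:
  assumes "0 < (a::real)"
  shows "(\<integral>\<^sup>+t. ennreal (exp (- a * t)) * indicator {0..} t \<partial>lborel) = ennreal (1 / a)"
proof -
  have "(\<integral>\<^sup>+t. ennreal (exp (- a * t)) * indicator {0..} t \<partial>lborel) = ennreal (0 - (- exp (- a * 0) / a))"
  proof (rule nn_integral_FTC_atLeast)
    show "((\<lambda>t. - exp (- a * t) / a) has_real_derivative exp (- a * t)) (at t)" for t
      using assms by (auto intro!: derivative_eq_intros)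
    have "((\<lambda>t. exp (- a * t)) \<longlongrightarrow> 0) at_top"
      using assms
      by (intro filterlim_compose[OF exp_at_bot] filterlim_tendsto_neg_mult_at_bot[OF tendsto_const] filterlim_ident) auto
    then have "((\<lambda>t. - exp (- a * t) / a) \<longlongrightarrow> - 0 / a) at_top" by (intro tendsto_intros) (use assms in auto)
    then show "((\<lambda>t. - exp (- a * t) / a) \<longlongrightarrow> 0) at_top" by simp
  qed auto
  then show ?thesis by simp
qed

text \<open>No interval to the right of \<open>t\<close> fits into the exceptional null set, so
  points of agreement decrease to \<open>t\<close>.\<close>

lemma right_continuous_AE_eq:
  fixes f g :: "real \<Rightarrow> real"
  assumes ae: "AE t in lborel. 0 \<le> t \<longrightarrow> f t = g t" and t: "0 \<le> t"
    and f: "\<And>X. (\<And>n. t < X n) \<Longrightarrow> X \<longlonglongrightarrow> t \<Longrightarrow> (\<lambda>n. f (X n)) \<longlonglongrightarrow> f t"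
    and g: "\<And>X. (\<And>n. t < X n) \<Longrightarrow> X \<longlonglongrightarrow> t \<Longrightarrow> (\<lambda>n. g (X n)) \<longlonglongrightarrow> g t"
  shows "f t = g t"
proof -
  have "\<exists>s. t < s \<and> s < t + 1 / real (Suc n) \<and> f s = g s" for n
  proof (rule ccontr)
    assume "\<not> ?thesis"
    then have "AE s in lborel. s \<notin> {t<..<t + 1 / real (Suc n)}"
      using ae t by (auto elim!: eventually_mono)
    then have "emeasure lborel {t<..<t + 1 / real (Suc n)} = 0"
      by (subst (asm) AE_iff_measurable[where N = "{t<..<t + 1 / real (Suc n)}"]) auto
    then show False by simp
  qed
  then obtain X where X: "\<And>n. t < X n" "\<And>n. X n < t + 1 / real (Suc n)" "\<And>n. f (X n) = g (X n)" by metis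
  have "X \<longlonglongrightarrow> t"
  proof (rule tendsto_sandwich[where f = "\<lambda>_. t" and h = "\<lambda>n. t + 1 / real (Suc n)"])
    have "(\<lambda>n. t + 1 / real (Suc n)) \<longlonglongrightarrow> t + 0" by (intro tendsto_intros LIMSEQ_Suc[OF lim_const_over_n])
    then show "(\<lambda>n. t + 1 / real (Suc n)) \<longlonglongrightarrow> t" by simp
  qed (use X(1,2) in \<open>auto intro!: always_eventually less_imp_le simp del: of_nat_Suc\<close>)
  then have "(\<lambda>n. f (X n)) \<longlonglongrightarrow> f t" "(\<lambda>n. f (X n)) \<longlonglongrightarrow> g t" using f[of X] g[of X] X(1,3) by auto
  then show ?thesis by (rule LIMSEQ_unique)
qed

context levy_exponent
begin

text \<open>Any representation of \<open>\<psi>\<close> differentiates to the same function. The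
  final identity therefore holds for every admissible \<open>L\<close>, with no appeal to uniqueness
  of the Levy measure.\<close>

lemma psi_deriv_representation:
  assumes L: "levy_khintchine \<psi> k d L" and y: "0 < y"
  shows "1 / \<phi> (\<psi> y) = d + (\<integral>x. x * exp (- y * x) \<partial>L)"
  by (rule DERIV_unique[OF psi_deriv[OF y] levy_khintchine_deriv[OF L y]])

lemma primitive_at_top: "filterlim (\<lambda>n. \<Phi> (q + l * real n)) at_top sequentially" if "0 < q" "0 < l"
proof (rule filterlim_at_top_mono)
  have "filterlim (\<lambda>n. q + l * real n) at_top sequentially"
    by (intro filterlim_tendsto_add_at_top[OF tendsto_const] filterlim_tendsto_pos_mult_at_top[OF tendsto_const that(2)]
        filterlim_real_sequentially)
  then have ev: "eventually (\<lambda>n. 1 < q + l * real n) sequentially" by (simp add: filterlim_at_top_dense)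
  have "filterlim (\<lambda>n. (q - 1) + l * real n) at_top sequentially"
    by (intro filterlim_tendsto_add_at_top[OF tendsto_const] filterlim_tendsto_pos_mult_at_top[OF tendsto_const that(2)]
        filterlim_real_sequentially)
  then show "filterlim (\<lambda>n. \<phi> 1 * ((q - 1) + l * real n)) at_top sequentially"
    by (intro filterlim_tendsto_pos_mult_at_top[OF tendsto_const phi_pos]) auto
  show "eventually (\<lambda>n. \<phi> 1 * ((q - 1) + l * real n) \<le> \<Phi> (q + l * real n)) sequentially"
    using ev by eventually_elim (use primitive_lower in \<open>fastforce simp: algebra_simps\<close>)
qed

text \<open>After the substitution \<open>v = (\<Phi> (q + l r) - \<Phi> q) / l\<close> the integrand becomes
  \<open>(1 - \<phi> q \<psi>' (\<Phi> q + l v)) e\<^sup>-\<^sup>v / l\<close>, and \<open>1 = \<phi> q \<psi>' (\<Phi> q)\<close>, so that the drift of \<open>\<psi>\<close> cancels.\<close>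

lemma laplace_substitution:
  assumes L: "levy_khintchine \<psi> k d L" and q: "0 < q" and l: "0 < l"
  shows "(\<integral>\<^sup>+r. ennreal ((\<phi> (q + l * r) - \<phi> q) / l * exp (- ((\<Phi> (q + l * r) - \<Phi> q) / l))) * indicator {0..} r \<partial>lborel) =
    (\<integral>\<^sup>+v. (\<integral>\<^sup>+x. ennreal (\<phi> q / l * (x * exp (- \<Phi> q * x) * (1 - exp (- (l * v * x))))) \<partial>L) * ennreal (exp (- v)) * indicator {0..} v \<partial>lborel)"
proof -
  have lev: "levy_measure L" using L by (simp add: levy_khintchine_def)
  note [measurable_cong] = levy_sets[OF lev]
  interpret L: sigma_finite_measure L by (rule levy_sigma_finite[OF lev])
  define B where "B r = (\<Phi> (q + l * r) - \<Phi> q) / l" for r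
  define f where "f v = (\<integral>\<^sup>+x. ennreal (\<phi> q / l * (x * exp (- \<Phi> q * x) * (1 - exp (- (l * v * x))))) \<partial>L) * ennreal (exp (- v))" for v
  have f_meas[measurable]: "f \<in> borel_measurable borel" unfolding f_def by measurable
  have pos: "0 < q + l * r" if "0 \<le> r" for r using q l that by (simp add: add_pos_nonneg)
  have B_deriv: "(B has_real_derivative \<phi> (q + l * r)) (at r)" if "0 \<le> r" for r
  proof -
    have "((\<lambda>r. \<Phi> (q + l * r)) has_real_derivative \<phi> (q + l * r) * l) (at r)"
      by (rule DERIV_chain2[where f = \<Phi> and g = "\<lambda>r. q + l * r"], rule primitive_deriv[OF pos[OF that]])
        (auto intro!: derivative_eq_intros)
    then have "((\<lambda>r. (\<Phi> (q + l * r) - \<Phi> q) / l) has_real_derivative (\<phi> (q + l * r) * l - 0) / l) (at r)"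
      by (intro DERIV_cdivide DERIV_diff DERIV_const)
    then show ?thesis using l by (simp add: B_def[abs_def])
  qed
  have B0: "B 0 = 0" by (simp add: B_def)
  have \<Phi>q: "0 < \<Phi> q" by (rule primitive_pos[OF q])
  have f_B: "f (B r) * ennreal (\<phi> (q + l * r)) = ennreal ((\<phi> (q + l * r) - \<phi> q) / l * exp (- B r))" if r: "0 \<le> r" for r
  proof -
    define s where "s = q + l * r"
    have s: "0 < s" "q \<le> s" using pos[OF r] l r by (auto simp: s_def)
    \<comment> \<open>After the substitution the rate \<open>\<Phi> q + l * v\<close> is
      \<open>\<Phi> s\<close>, where \<open>\<psi>'\<close> takes the value
      \<open>1 / \<phi> s\<close>.\<close>
    have lB: "\<Phi> q + l * B r = \<Phi> s" using l by (simp add: B_def s_def)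
    have \<Phi>s: "0 < \<Phi> s" by (rule primitive_pos[OF s(1)])
    have lB0: "0 \<le> l * B r" using lB primitive_less[of q s] q s by (cases "q = s") auto
    have int: "integrable L (\<lambda>x. x * exp (- \<Phi> q * x))" "integrable L (\<lambda>x. x * exp (- \<Phi> s * x))"
      by (rule levy_integrable_exp[OF lev \<Phi>q], rule levy_integrable_exp[OF lev \<Phi>s])
    have e: "x * exp (- \<Phi> q * x) * (1 - exp (- (l * B r * x))) = x * exp (- \<Phi> q * x) - x * exp (- \<Phi> s * x)" for x
    proof -
      have "exp (- \<Phi> s * x) = exp (- \<Phi> q * x) * exp (- (l * B r * x))"
        unfolding lB[symmetric] exp_add[symmetric] by (simp add: ring_distribs)
      then show ?thesis by (simp add: right_diff_distrib mult.assoc)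
    qed
    have "(\<integral>\<^sup>+x. ennreal (\<phi> q / l * (x * exp (- \<Phi> q * x) * (1 - exp (- (l * B r * x))))) \<partial>L) =
        ennreal (\<integral>x. \<phi> q / l * (x * exp (- \<Phi> q * x) * (1 - exp (- (l * B r * x)))) \<partial>L)"
    proof (rule nn_integral_eq_integral)
      show "integrable L (\<lambda>x. \<phi> q / l * (x * exp (- \<Phi> q * x) * (1 - exp (- (l * B r * x)))))"
        unfolding e by (intro integrable_mult_right Bochner_Integration.integrable_diff int)
      show "AE x in L. 0 \<le> \<phi> q / l * (x * exp (- \<Phi> q * x) * (1 - exp (- (l * B r * x))))"
        using levy_AE_pos[OF lev]
      proof eventually_elim
        case (elim x)
        have "exp (- (l * B r * x)) \<le> 1" using lB0 elim by simp
        then show ?case using phi_pos[OF q] l elim by (intro mult_nonneg_nonneg divide_nonneg_nonneg) auto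
      qed
    qed
    also have "(\<integral>x. \<phi> q / l * (x * exp (- \<Phi> q * x) * (1 - exp (- (l * B r * x)))) \<partial>L) =
        \<phi> q / l * ((\<integral>x. x * exp (- \<Phi> q * x) \<partial>L) - (\<integral>x. x * exp (- \<Phi> s * x) \<partial>L))"
      unfolding e by (simp only: integral_mult_right_zero Bochner_Integration.integral_diff[OF int])
    also have "\<dots> = \<phi> q / l * (1 / \<phi> q - 1 / \<phi> s)"
      using psi_deriv_representation[OF L \<Phi>q] psi_deriv_representation[OF L \<Phi>s] q s by (simp add: psi_primitive)
    finally have "f (B r) * ennreal (\<phi> s) = ennreal (\<phi> q / l * (1 / \<phi> q - 1 / \<phi> s)) * ennreal (exp (- B r)) * ennreal (\<phi> s)"
      by (simp add: f_def)
    also have "\<dots> = ennreal (\<phi> q / l * (1 / \<phi> q - 1 / \<phi> s) * exp (- B r) * \<phi> s)"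
    proof -
      have "0 \<le> 1 / \<phi> q - 1 / \<phi> s" using phi_pos[OF q] phi_mono[of q s] q s by (simp add: frac_le)
      then have "0 \<le> \<phi> q / l * (1 / \<phi> q - 1 / \<phi> s)" using phi_pos[OF q] l by simp
      then show ?thesis using phi_pos[OF s(1)] by (simp only: ennreal_mult[symmetric] mult_nonneg_nonneg exp_ge_zero less_imp_le)
    qed
    also have "\<phi> q / l * (1 / \<phi> q - 1 / \<phi> s) * exp (- B r) * \<phi> s = (\<phi> s - \<phi> q) / l * exp (- B r)"
      using phi_pos[OF q] phi_pos[OF s(1)] l by (simp add: field_simps)
    finally show ?thesis by (simp add: s_def)
  qed
  \<comment> \<open>The substitution rule applies on compact ranges; monotone convergence on both
    sides then removes the upper limit, using that \<open>B\<close> tends to infinity.\<close>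
  have step: "(\<integral>\<^sup>+v. f v * indicator {0..B (real (Suc n))} v \<partial>lborel) =
      (\<integral>\<^sup>+r. ennreal ((\<phi> (q + l * r) - \<phi> q) / l * exp (- B r)) * indicator {0..real (Suc n)} r \<partial>lborel)" for n
  proof -
    have "(\<integral>\<^sup>+v. f v * indicator {B 0..B (real (Suc n))} v \<partial>lborel) =
        (\<integral>\<^sup>+r. f (B r) * ennreal (\<phi> (q + l * r)) * indicator {0..real (Suc n)} r \<partial>lborel)"
    proof (rule nn_integral_substitution_aux[OF f_meas])
      show "continuous_on {0..real (Suc n)} (\<lambda>r. \<phi> (q + l * r))"
        by (rule continuous_on_compose2[OF phi_cont]) (use q l in \<open>auto intro!: continuous_intros add_nonneg_nonneg\<close>)
    qed (use B_deriv phi_pos pos in \<open>auto intro: less_imp_le\<close>)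
    also have "\<dots> = (\<integral>\<^sup>+r. ennreal ((\<phi> (q + l * r) - \<phi> q) / l * exp (- B r)) * indicator {0..real (Suc n)} r \<partial>lborel)"
      by (rule nn_integral_cong) (auto simp: f_B indicator_def)
    finally show ?thesis by (simp add: B0)
  qed
  have B_mono: "B s \<le> B r" if "0 \<le> s" "s \<le> r" for r s
  proof -
    have "q + l * s \<le> q + l * r" using l that by simp
    then have "\<Phi> (q + l * s) \<le> \<Phi> (q + l * r)"
      using primitive_less[of "q + l * s" "q + l * r"] pos[OF that(1)] by (cases "q + l * s = q + l * r") (auto intro: less_imp_le)
    then show ?thesis using l by (simp add: B_def divide_right_mono)
  qed
  have B_top: "filterlim (\<lambda>n. B (real (Suc n))) at_top sequentially"
  proof -
    have "filterlim (\<lambda>n. \<Phi> (q + l * real (Suc n))) at_top sequentially"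
      using primitive_at_top[OF q l] by (rule filterlim_compose[OF _ filterlim_Suc])
    then have "filterlim (\<lambda>n. - \<Phi> q + \<Phi> (q + l * real (Suc n))) at_top sequentially"
      by (rule filterlim_tendsto_add_at_top[OF tendsto_const])
    from filterlim_tendsto_pos_mult_at_top[OF tendsto_const[of "1 / l"] _ this]
    show ?thesis using l by (simp add: B_def[abs_def] diff_divide_distrib algebra_simps del: of_nat_Suc)
  qed
  have "(\<lambda>n. \<integral>\<^sup>+v. f v * indicator {0..B (real (Suc n))} v \<partial>lborel) \<longlonglongrightarrow> (\<integral>\<^sup>+v. f v * indicator {0..} v \<partial>lborel)"
  proof (rule nn_integral_LIMSEQ)
    show "incseq (\<lambda>n v. f v * indicator {0..B (real (Suc n))} v)"
      by (auto simp: incseq_def le_fun_def indicator_def intro: order_trans[OF _ B_mono])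
    fix v
    have "eventually (\<lambda>n. v \<le> B (real (Suc n))) sequentially"
      using B_top by (simp add: filterlim_at_top)
    then have "eventually (\<lambda>n. f v * indicator {0..} v = f v * indicator {0..B (real (Suc n))} v) sequentially"
      by eventually_elim (auto simp: indicator_def)
    then show "(\<lambda>n. f v * indicator {0..B (real (Suc n))} v) \<longlonglongrightarrow> f v * indicator {0..} v"
      by (rule Lim_transform_eventually[OF tendsto_const])
  qed measurable
  moreover have "(\<lambda>n. \<integral>\<^sup>+r. ennreal ((\<phi> (q + l * r) - \<phi> q) / l * exp (- B r)) * indicator {0..real (Suc n)} r \<partial>lborel) \<longlonglongrightarrow>
      (\<integral>\<^sup>+r. ennreal ((\<phi> (q + l * r) - \<phi> q) / l * exp (- B r)) * indicator {0..} r \<partial>lborel)"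
  proof -
    define g where "g r = ennreal ((\<phi> (q + l * max 0 r) - \<phi> q) / l * exp (- B (max 0 r)))" for r
    have [measurable]: "(\<lambda>r. \<phi> (q + l * max 0 r)) \<in> borel_measurable borel"
      by (rule borel_measurable_mono) (use q l in \<open>auto intro!: monoI phi_mono mult_left_mono add_nonneg_nonneg\<close>)
    have [measurable]: "(\<lambda>r. B (max 0 r)) \<in> borel_measurable borel"
      by (rule borel_measurable_mono) (auto intro!: monoI B_mono)
    have [measurable]: "g \<in> borel_measurable borel" unfolding g_def by measurable
    have "(\<lambda>n. \<integral>\<^sup>+r. g r * indicator {0..real (Suc n)} r \<partial>lborel) \<longlonglongrightarrow> (\<integral>\<^sup>+r. g r * indicator {0..} r \<partial>lborel)"
    proof (rule nn_integral_LIMSEQ)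
      show "incseq (\<lambda>n r. g r * indicator {0..real (Suc n)} r)"
        by (auto simp: incseq_def le_fun_def indicator_def)
      fix r
      have "eventually (\<lambda>n. r \<le> real (Suc n)) sequentially"
        using filterlim_compose[OF filterlim_real_sequentially filterlim_Suc] by (simp add: filterlim_at_top)
      then have "eventually (\<lambda>n. g r * indicator {0..} r = g r * indicator {0..real (Suc n)} r) sequentially"
        by eventually_elim (auto simp: indicator_def)
      then show "(\<lambda>n. g r * indicator {0..real (Suc n)} r) \<longlonglongrightarrow> g r * indicator {0..} r"
        by (rule Lim_transform_eventually[OF tendsto_const])
    qed measurable
    moreover have "ennreal ((\<phi> (q + l * r) - \<phi> q) / l * exp (- B r)) * indicator {0..b} r = g r * indicator {0..b} r"
      "ennreal ((\<phi> (q + l * r) - \<phi> q) / l * exp (- B r)) * indicator {0..} r = g r * indicator {0..} r" for r b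
      by (auto simp: g_def indicator_def)
    ultimately show ?thesis by simp
  qed
  ultimately have "(\<integral>\<^sup>+v. f v * indicator {0..} v \<partial>lborel) =
      (\<integral>\<^sup>+r. ennreal ((\<phi> (q + l * r) - \<phi> q) / l * exp (- B r)) * indicator {0..} r \<partial>lborel)"
    unfolding step by (rule LIMSEQ_unique)
  then show ?thesis by (simp add: f_def B_def)
qed

lemma rhs_integrable:
  assumes lev: "levy_measure L" and q: "0 < q" and t: "0 \<le> t"
  shows "integrable L (\<lambda>x. exp (- \<Phi> q * x - t / x) * x)"
proof (rule Bochner_Integration.integrable_bound)
  note [measurable_cong] = levy_sets[OF lev]
  show "integrable L (\<lambda>x. x * exp (- \<Phi> q * x))" by (rule levy_integrable_exp[OF lev primitive_pos[OF q]])
  show "(\<lambda>x. exp (- \<Phi> q * x - t / x) * x) \<in> borel_measurable L" by measurable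
  show "AE x in L. norm (exp (- \<Phi> q * x - t / x) * x) \<le> norm (x * exp (- \<Phi> q * x))"
    using levy_AE_pos[OF lev]
  proof eventually_elim
    case (elim x)
    have "exp (- \<Phi> q * x - t / x) \<le> exp (- \<Phi> q * x)" using elim t by simp
    then show ?case using elim by (simp add: abs_mult mult.commute mult_right_mono)
  qed
qed

text \<open>\<open>x / (1 + l * x)\<close> is read in two ways: as the integral over
  \<open>v\<close> of \<open>(exp (- v) - exp (- (1 + l * x) * v)) / l\<close>, and as
  \<open>1 / (l + 1 / x)\<close>, the integral over \<open>t\<close> of
  \<open>exp (- (l + 1 / x) * t)\<close>. The second reading is the source of
  \<open>exp (- t / x)\<close>.\<close>

lemma laplace_rhs:
  assumes L: "levy_khintchine \<psi> k d L" and q: "0 < q" and l: "0 < l"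
  shows "(\<integral>\<^sup>+r. ennreal ((\<phi> (q + l * r) - \<phi> q) / l * exp (- ((\<Phi> (q + l * r) - \<Phi> q) / l))) * indicator {0..} r \<partial>lborel) =
    (\<integral>\<^sup>+t. ennreal (exp (- l * t)) * (ennreal (\<phi> q * (\<integral>x. exp (- \<Phi> q * x - t / x) * x \<partial>L)) * indicator {0..} t) \<partial>lborel)"
proof -
  have lev: "levy_measure L" using L by (simp add: levy_khintchine_def)
  note [measurable_cong] = levy_sets[OF lev]
  interpret L: sigma_finite_measure L by (rule levy_sigma_finite[OF lev])
  interpret P: pair_sigma_finite L "lborel :: real measure" ..
  have pq: "0 < \<phi> q" by (rule phi_pos[OF q])
  define h where "h x = \<phi> q * (x * exp (- \<Phi> q * x))" for x
  have h: "0 \<le> h x" if "0 < x" for x using pq that by (simp add: h_def)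
  have [measurable]: "h \<in> borel_measurable borel" unfolding h_def by measurable
  have "(\<integral>\<^sup>+v. (\<integral>\<^sup>+x. ennreal (\<phi> q / l * (x * exp (- \<Phi> q * x) * (1 - exp (- (l * v * x))))) \<partial>L) * ennreal (exp (- v)) * indicator {0..} v \<partial>lborel) =
      (\<integral>\<^sup>+v. \<integral>\<^sup>+x. ennreal (\<phi> q / l * (x * exp (- \<Phi> q * x) * (1 - exp (- (l * v * x))))) * ennreal (exp (- v)) * indicator {0..} v \<partial>L \<partial>lborel)"
    by (intro nn_integral_cong) (simp add: nn_integral_multc)
  also have "\<dots> = (\<integral>\<^sup>+x. \<integral>\<^sup>+v. ennreal (\<phi> q / l * (x * exp (- \<Phi> q * x) * (1 - exp (- (l * v * x))))) * ennreal (exp (- v)) * indicator {0..} v \<partial>lborel \<partial>L)"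
    by (rule P.Fubini') measurable
  also have "\<dots> = (\<integral>\<^sup>+x. ennreal (h x * (x / (1 + l * x))) \<partial>L)"
  proof (rule nn_integral_cong_AE, use levy_AE_pos[OF lev] in eventually_elim)
    case (elim x)
    have lx: "0 < 1 + l * x" using l elim by (simp add: add_pos_pos)
    have "(\<integral>\<^sup>+v. ennreal (\<phi> q / l * (x * exp (- \<Phi> q * x) * (1 - exp (- (l * v * x))))) * ennreal (exp (- v)) * indicator {0..} v \<partial>lborel) =
        (\<integral>\<^sup>+v. ennreal (h x / l) * (ennreal (exp (- v) - exp (- (1 + l * x) * v)) * indicator {0..} v) \<partial>lborel)"
    proof (rule nn_integral_cong)
      fix v :: real
      show "ennreal (\<phi> q / l * (x * exp (- \<Phi> q * x) * (1 - exp (- (l * v * x))))) * ennreal (exp (- v)) * indicator {0..} v =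
          ennreal (h x / l) * (ennreal (exp (- v) - exp (- (1 + l * x) * v)) * indicator {0..} v)"
      proof (cases "0 \<le> v")
        case True
        have 1: "0 \<le> 1 - exp (- (l * v * x))" using True l elim by simp
        have e1: "\<phi> q / l * (x * exp (- \<Phi> q * x) * (1 - exp (- (l * v * x)))) = h x / l * (1 - exp (- (l * v * x)))"
          by (simp add: h_def)
        have e2: "(1 - exp (- (l * v * x))) * exp (- v) = exp (- v) - exp (- (1 + l * x) * v)"
          by (simp add: algebra_simps exp_add[symmetric])
        have "0 \<le> h x / l" using h[OF elim] l by simp
        then have "ennreal (h x / l * (1 - exp (- (l * v * x)))) * ennreal (exp (- v)) =
            ennreal (h x / l) * ennreal ((1 - exp (- (l * v * x))) * exp (- v))"
          using 1 by (simp only: ennreal_mult exp_ge_zero mult.assoc)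
        then show ?thesis unfolding e1 e2 by (simp only: mult.assoc)
      qed simp
    qed
    also have "\<dots> = ennreal (h x / l) * (\<integral>\<^sup>+v. ennreal (exp (- v) - exp (- (1 + l * x) * v)) * indicator {0..} v \<partial>lborel)"
      by (rule nn_integral_cmult) measurable
    also have "(\<integral>\<^sup>+v. ennreal (exp (- v) - exp (- (1 + l * x) * v)) * indicator {0..} v \<partial>lborel) = ennreal (l * x / (1 + l * x))"
    proof -
      have "(\<integral>\<^sup>+v. ennreal (exp (- v) - exp (- (1 + l * x) * v)) * indicator {0..} v \<partial>lborel) =
          (\<integral>\<^sup>+v. ennreal (exp (- 1 * v)) * indicator {0..} v - ennreal (exp (- (1 + l * x) * v)) * indicator {0..} v \<partial>lborel)"
        by (rule nn_integral_cong) (auto simp: indicator_def ennreal_minus)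
      also have "\<dots> = (\<integral>\<^sup>+v. ennreal (exp (- 1 * v)) * indicator {0..} v \<partial>lborel) - (\<integral>\<^sup>+v. ennreal (exp (- (1 + l * x) * v)) * indicator {0..} v \<partial>lborel)"
      proof (rule nn_integral_diff)
        show "(\<integral>\<^sup>+v. ennreal (exp (- (1 + l * x) * v)) * indicator {0..} v \<partial>lborel) \<noteq> \<infinity>"
          unfolding nn_integral_exp_atLeast[OF lx] by simp
        show "AE v in lborel. ennreal (exp (- (1 + l * x) * v)) * indicator {0..} v \<le> ennreal (exp (- 1 * v)) * indicator {0..} v"
        proof (rule AE_I2)
          fix v :: real
          have "exp (- (1 + l * x) * v) \<le> exp (- 1 * v)" if "0 \<le> v" using l elim that by (simp add: algebra_simps)
          then show "ennreal (exp (- (1 + l * x) * v)) * indicator {0..} v \<le> ennreal (exp (- 1 * v)) * indicator {0..} v"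
            by (auto simp: indicator_def intro: ennreal_leI)
        qed
      qed measurable
      also have "\<dots> = ennreal (1 - 1 / (1 + l * x))"
        unfolding nn_integral_exp_atLeast[OF lx] nn_integral_exp_atLeast[OF zero_less_one]
        using lx by (subst ennreal_minus) auto
      also have "1 - 1 / (1 + l * x) = l * x / (1 + l * x)" using lx by (simp add: field_simps)
      finally show ?thesis .
    qed
    also have "ennreal (h x / l) * ennreal (l * x / (1 + l * x)) = ennreal (h x / l * (l * x / (1 + l * x)))"
      using h[OF elim] l elim lx by (intro ennreal_mult[symmetric]) auto
    also have "h x / l * (l * x / (1 + l * x)) = h x * (x / (1 + l * x))" using l by simp
    finally show ?case .
  qed
  also have "\<dots> = (\<integral>\<^sup>+x. \<integral>\<^sup>+t. ennreal (h x) * (ennreal (exp (- (l + 1 / x) * t)) * indicator {0..} t) \<partial>lborel \<partial>L)"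
  proof (rule nn_integral_cong_AE, use levy_AE_pos[OF lev] in eventually_elim)
    case (elim x)
    have lx: "0 < l + 1 / x" using l elim by (simp add: add_pos_pos)
    have "(\<integral>\<^sup>+t. ennreal (h x) * (ennreal (exp (- (l + 1 / x) * t)) * indicator {0..} t) \<partial>lborel) = ennreal (h x) * ennreal (1 / (l + 1 / x))"
      by (subst nn_integral_cmult) (simp_all only: nn_integral_exp_atLeast[OF lx], measurable)
    also have "\<dots> = ennreal (h x * (1 / (l + 1 / x)))" using h[OF elim] lx by (intro ennreal_mult[symmetric]) auto
    also have "1 / (l + 1 / x) = x / (1 + l * x)" using elim l by (simp add: field_simps)
    finally show ?case by simp
  qed
  also have "\<dots> = (\<integral>\<^sup>+t. \<integral>\<^sup>+x. ennreal (h x) * (ennreal (exp (- (l + 1 / x) * t)) * indicator {0..} t) \<partial>L \<partial>lborel)"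
    by (rule P.Fubini'[symmetric]) measurable
  also have "\<dots> = (\<integral>\<^sup>+t. ennreal (exp (- l * t)) * (ennreal (\<phi> q * (\<integral>x. exp (- \<Phi> q * x - t / x) * x \<partial>L)) * indicator {0..} t) \<partial>lborel)"
  proof (rule nn_integral_cong)
    fix t :: real
    show "(\<integral>\<^sup>+x. ennreal (h x) * (ennreal (exp (- (l + 1 / x) * t)) * indicator {0..} t) \<partial>L) =
      ennreal (exp (- l * t)) * (ennreal (\<phi> q * (\<integral>x. exp (- \<Phi> q * x - t / x) * x \<partial>L)) * indicator {0..} t)"
    proof (cases "0 \<le> t")
      case True
      have "(\<integral>\<^sup>+x. ennreal (h x) * (ennreal (exp (- (l + 1 / x) * t)) * indicator {0..} t) \<partial>L) =
          (\<integral>\<^sup>+x. ennreal (exp (- l * t)) * ennreal (\<phi> q * (exp (- \<Phi> q * x - t / x) * x)) \<partial>L)"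
      proof (rule nn_integral_cong_AE, use levy_AE_pos[OF lev] in eventually_elim)
        case (elim x)
        have "h x * exp (- (l + 1 / x) * t) = exp (- l * t) * (\<phi> q * (exp (- \<Phi> q * x - t / x) * x))"
          by (simp add: h_def exp_diff exp_minus exp_add ring_distribs divide_inverse)
        then show ?case using True h[OF elim] pq elim by (simp add: ennreal_mult[symmetric])
      qed
      also have "\<dots> = ennreal (exp (- l * t)) * (\<integral>\<^sup>+x. ennreal (\<phi> q * (exp (- \<Phi> q * x - t / x) * x)) \<partial>L)"
        by (rule nn_integral_cmult) measurable
      also have "(\<integral>\<^sup>+x. ennreal (\<phi> q * (exp (- \<Phi> q * x - t / x) * x)) \<partial>L) = ennreal (\<integral>x. \<phi> q * (exp (- \<Phi> q * x - t / x) * x) \<partial>L)"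
        by (rule nn_integral_eq_integral)
          (use rhs_integrable[OF lev q True] levy_AE_pos[OF lev] pq in \<open>auto elim!: eventually_mono\<close>)
      finally show ?thesis using True by simp
    qed simp
  qed
  finally show ?thesis unfolding laplace_substitution[OF L q l] .
qed

lemma rhs_right_continuous:
  assumes lev: "levy_measure L" and q: "0 < q" and t: "0 \<le> t" and X: "\<And>n. t < X n" "X \<longlonglongrightarrow> t"
  shows "(\<lambda>n. \<phi> q * (\<integral>x. exp (- \<Phi> q * x - X n / x) * x \<partial>L)) \<longlonglongrightarrow> \<phi> q * (\<integral>x. exp (- \<Phi> q * x - t / x) * x \<partial>L)"
proof (rule tendsto_mult_left, rule integral_dominated_convergence[where w = "\<lambda>x. x * exp (- \<Phi> q * x)"])
  note [measurable_cong] = levy_sets[OF lev]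
  show "integrable L (\<lambda>x. x * exp (- \<Phi> q * x))" by (rule levy_integrable_exp[OF lev primitive_pos[OF q]])
  show "(\<lambda>x. exp (- \<Phi> q * x - t / x) * x) \<in> borel_measurable L" by measurable
  show "AE x in L. (\<lambda>n. exp (- \<Phi> q * x - X n / x) * x) \<longlonglongrightarrow> exp (- \<Phi> q * x - t / x) * x"
    using levy_AE_pos[OF lev] by eventually_elim (intro tendsto_intros X, simp)
  fix n
  show "(\<lambda>x. exp (- \<Phi> q * x - X n / x) * x) \<in> borel_measurable L" by measurable
  show "AE x in L. norm (exp (- \<Phi> q * x - X n / x) * x) \<le> x * exp (- \<Phi> q * x)"
    using levy_AE_pos[OF lev]
  proof eventually_elim
    case (elim x)
    have "exp (- \<Phi> q * x - X n / x) \<le> exp (- \<Phi> q * x)" using elim t X(1)[of n] by simp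
    then show ?case using elim by (simp add: abs_mult mult.commute mult_right_mono)
  qed
qed

end

lemma (in killed_subordinator) expectation_at_passage:
  assumes L: "levy_khintchine \<psi> k d L" and q: "0 < q" and t: "0 \<le> t"
  shows "(\<integral>\<omega>. hval q t \<omega> \<partial>M) = \<phi> q * (\<integral>x. exp (- \<Phi> q * x - t / x) * x \<partial>L)"
proof -
  have lev: "levy_measure L" using L by (simp add: levy_khintchine_def)
  note [measurable_cong] = levy_sets[OF lev]
  interpret L: sigma_finite_measure L by (rule levy_sigma_finite[OF lev])
  define f where "f t = (\<integral>\<omega>. hval q t \<omega> \<partial>M)" for t
  define g where "g t = \<phi> q * (\<integral>x. exp (- \<Phi> q * x - t / x) * x \<partial>L)" for t
  have f0: "0 \<le> f t" for t unfolding f_def by (rule integral_nonneg_AE) (use hval_bounds q in auto)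
  have g0: "0 \<le> g t" for t unfolding g_def
    using phi_pos[OF q] levy_AE_pos[OF lev] by (intro mult_nonneg_nonneg integral_nonneg_AE) (auto elim!: eventually_mono)
  have f_meas[measurable]: "f \<in> borel_measurable borel" unfolding f_def
    using hval_joint by (rule borel_measurable_lebesgue_integral)
  have g_meas[measurable]: "g \<in> borel_measurable borel" unfolding g_def by measurable
  \<comment> \<open>Bounds the transform of the left-hand density, as \<open>laplace_unique\<close>
    requires; equality then transfers finiteness to the right-hand one.\<close>
  have f1: "f t \<le> 1" for t
  proof -
    have "f t \<le> (\<integral>\<omega>. 1 \<partial>M)" unfolding f_def
      by (intro integral_mono integrable_const_bound[where B = 1]) (use hval_bounds[of _ q t] hval_measurable q in auto)
    then show ?thesis by (simp add: prob_space)
  qed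
  have "density lborel (\<lambda>t. ennreal (f t) * indicator {0..} t) = density lborel (\<lambda>t. ennreal (g t) * indicator {0..} t)"
  proof (rule laplace_unique)
    have "emeasure (density lborel (\<lambda>t. ennreal (u t) * indicator {0..} t)) {..<0} = 0"
      if [measurable]: "u \<in> borel_measurable borel" for u :: "real \<Rightarrow> real"
      by (subst emeasure_density) (auto simp: nn_integral_0_iff_AE indicator_def)
    then show "emeasure (density lborel (\<lambda>t. ennreal (f t) * indicator {0..} t)) {..<0} = 0"
      "emeasure (density lborel (\<lambda>t. ennreal (g t) * indicator {0..} t)) {..<0} = 0" by simp_all
    fix l :: real assume l: "0 < l"
    have dens: "(\<integral>\<^sup>+t. ennreal (exp (- l * t)) \<partial>density lborel (\<lambda>t. ennreal (u t) * indicator {0..} t)) =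
        (\<integral>\<^sup>+t. ennreal (exp (- l * t)) * (ennreal (u t) * indicator {0..} t) \<partial>lborel)"
      if [measurable]: "u \<in> borel_measurable borel" for u :: "real \<Rightarrow> real"
      by (subst nn_integral_density) (auto simp: mult_ac)
    show "(\<integral>\<^sup>+t. ennreal (exp (- l * t)) \<partial>density lborel (\<lambda>t. ennreal (f t) * indicator {0..} t)) =
        (\<integral>\<^sup>+t. ennreal (exp (- l * t)) \<partial>density lborel (\<lambda>t. ennreal (g t) * indicator {0..} t))"
      unfolding dens[OF f_meas] dens[OF g_meas] unfolding f_def g_def
      by (rule trans[OF hval_laplace[OF q l] laplace_rhs[OF L q l]])
    have "(\<integral>\<^sup>+t. ennreal (exp (- l * t)) * (ennreal (f t) * indicator {0..} t) \<partial>lborel) \<le>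
        (\<integral>\<^sup>+t. ennreal (exp (- l * t)) * indicator {0..} t \<partial>lborel)"
      by (intro nn_integral_mono mult_left_mono) (use f1 in \<open>auto simp: indicator_def\<close>)
    also have "\<dots> < \<infinity>" unfolding nn_integral_exp_atLeast[OF l] by simp
    finally show "(\<integral>\<^sup>+t. ennreal (exp (- l * t)) \<partial>density lborel (\<lambda>t. ennreal (f t) * indicator {0..} t)) < \<infinity>"
      unfolding dens[OF f_meas] .
  qed simp_all
  then have "AE t in lborel. ennreal (f t) * indicator {0..} t = ennreal (g t) * indicator {0..} t"
    by (subst (asm) sigma_finite_measure.density_unique_iff[OF sigma_finite_lborel]) simp_all
  then have "AE t in lborel. 0 \<le> t \<longrightarrow> f t = g t"
    by eventually_elim (auto simp: indicator_def f0 g0)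
  then have "f t = g t"
  proof (rule right_continuous_AE_eq[OF _ t])
    fix X assume X: "\<And>n::nat. t < X n" "X \<longlonglongrightarrow> t"
    show "(\<lambda>n. f (X n)) \<longlonglongrightarrow> f t" unfolding f_def by (rule hval_right_continuous[OF t X]) (use q in simp)
    show "(\<lambda>n. g (X n)) \<longlonglongrightarrow> g t" unfolding g_def by (rule rhs_right_continuous[OF lev q t X])
  qed
  then show ?thesis by (simp add: f_def g_def)
qed

theorem theorem1p2:
  fixes M :: "'a measure" and \<xi> :: "real \<Rightarrow> 'a \<Rightarrow> ennreal"
    and \<phi> :: "real \<Rightarrow> real" and \<kappa> c :: real and \<pi> :: "real measure"
  assumes "subordinator_with M \<xi> \<phi> \<kappa> c \<pi>"
    and "emeasure \<pi> {0<..} > 0"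
  shows "subordinator_exponent (primitive_inv \<phi>) \<and>
    (\<forall>L. levy_measure_of (primitive_inv \<phi>) L \<longrightarrow>
      (\<forall>q t. 0 < q \<longrightarrow> 0 \<le> t \<longrightarrow>
        (\<integral>\<omega>. exp_neg q (at_time \<xi> (rho \<xi> t \<omega>) \<omega>) \<partial>M) =
          \<phi> q * (LINT x:{0<..}|L. exp (- primitive \<phi> q * x - t / x) * x)))"
proof (intro conjI allI impI)
  have sub: "subordinator M \<kappa> \<xi>" and lap: "has_laplace_exponent M \<xi> \<phi>" and LK: "levy_khintchine \<phi> \<kappa> c \<pi>"
    using assms(1) by (auto simp: subordinator_with_def)
  interpret levy_exponent \<phi> \<kappa> c \<pi> using LK assms(2) by unfold_locales
  show "subordinator_exponent (primitive_inv \<phi>)" by (rule psi_subordinator_exponent)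
  obtain \<eta> \<zeta> where *: "unkilled_subordinator M \<eta>" "\<zeta> \<in> borel_measurable M" "\<forall>\<omega>\<in>space M. 0 < \<zeta> \<omega>"
    "\<forall>t\<ge>0. measure M {\<omega> \<in> space M. ennreal t < \<zeta> \<omega>} = exp (- \<kappa> * t)"
    "prob_space.indep_set M
          (sets (vimage_algebra (space M) (\<lambda>\<omega>. \<lambda>t\<in>{0..}. \<eta> t \<omega>) (PiM {0..} (\<lambda>_. borel))))
          (sets (vimage_algebra (space M) \<zeta> borel))"
    and \<xi>: "\<forall>t\<ge>0. \<forall>\<omega>\<in>space M. \<xi> t \<omega> = kill_at \<zeta> \<eta> t \<omega>"
    using sub unfolding subordinator_def by blast
  interpret prob_space M using *(1) by (simp add: unkilled_subordinator_def)
  \<comment> \<open>\<open>\<xi>\<close> coincides with the killed path only for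
    \<open>t \<ge> 0\<close> and on \<open>space M\<close>, which is enough to transfer the exponent
    read off at time 1.\<close>
  have lap': "has_laplace_exponent M (kill_at \<zeta> \<eta>) \<phi>"
    unfolding has_laplace_exponent_def
  proof (intro allI impI)
    fix q :: real assume "0 \<le> q"
    then have "\<phi> q = - ln (\<integral>\<omega>. exp_neg q (\<xi> 1 \<omega>) \<partial>M)" using lap by (simp add: has_laplace_exponent_def)
    also have "(\<integral>\<omega>. exp_neg q (\<xi> 1 \<omega>) \<partial>M) = (\<integral>\<omega>. exp_neg q (kill_at \<zeta> \<eta> 1 \<omega>) \<partial>M)"
      using \<xi> by (intro Bochner_Integration.integral_cong) auto
    finally show "\<phi> q = - ln (\<integral>\<omega>. exp_neg q (kill_at \<zeta> \<eta> 1 \<omega>) \<partial>M)" .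
  qed
  interpret killed_subordinator M \<eta> \<zeta> \<phi> \<kappa> c \<pi>
    by unfold_locales (use * lap' in auto)
  fix L :: "real measure" and q t :: real
  assume "levy_measure_of (primitive_inv \<phi>) L" and q: "0 < q" and t: "0 \<le> t"
  then obtain k d where L: "levy_khintchine (primitive_inv \<phi>) k d L" by (auto simp: levy_measure_of_def)
  then have lev: "levy_measure L" by (simp add: levy_khintchine_def)
  have "(\<integral>\<omega>. exp_neg q (at_time \<xi> (rho \<xi> t \<omega>) \<omega>) \<partial>M) = (\<integral>\<omega>. hval q t \<omega> \<partial>M)"
    using \<xi> by (intro Bochner_Integration.integral_cong refl exp_neg_at_rho t) auto
  also have "\<dots> = \<phi> q * (\<integral>x. exp (- primitive \<phi> q * x - t / x) * x \<partial>L)"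
    by (rule expectation_at_passage[OF L q t])
  also have "(\<integral>x. exp (- primitive \<phi> q * x - t / x) * x \<partial>L) = (LINT x:{0<..}|L. exp (- primitive \<phi> q * x - t / x) * x)"
    by (rule levy_set_integral[OF lev, symmetric]) measurable
  finally show "(\<integral>\<omega>. exp_neg q (at_time \<xi> (rho \<xi> t \<omega>) \<omega>) \<partial>M) =
      \<phi> q * (LINT x:{0<..}|L. exp (- primitive \<phi> q * x - t / x) * x)" .
qed

end
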